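(* For $\epsilon>0$ let $S_\epsilon(z)=\epsilon S(z/\epsilon)$ and $P_\epsilon(z)=\epsilon P(z/\epsilon)$, where $S(z)=z+\frac1z$ and $P(z)=z(1+\frac1z)^{4/3}(1-\frac1z)^{2/3}$. (1) The composition $S_\epsilon(P_\epsilon^{-1}(w))$ is a family in $\epsilon$ varying from the identity, with first and second variation cocycles (first and second $\epsilon$-derivatives at $\epsilon=0$) $$-\frac23\frac{d}{dw}\qquad\text{and}\qquad\frac{32}{9}\frac1w\frac{d}{dw}.$$ (2) The pushforward of the differential $\omega=-w^2dw$ by $S_\epsilon(P_\epsilon^{-1})$ extends to a holomorphic differential on $\mathbb C$ which is nonzero at the image of the vertex of the sector of angle $2\pi/3$, has a simple zero at the (common) image of the two slit tips, and has a simple zero at the image of the vertex of the sector of angle $4\pi/3$; thus the map splits a double zero into simple zeros at distance scale $\epsilon$. (3) If the construction is performed in a coordinate $w$ in a small disc on a compact Riemann surface $R$ in which an Abelian differential has the normal form $-w^2dw$, the deformation of the differential is isoperiodic (the periods are not changed), and the integral norm of the differential is not changed.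
   Context: $S$ is the Riemann mapping from $\{|z|>1\}$ to the complement of the segment $[-2,2]$. $P$ (branch with $P(z)\sim z$ at infinity) is the Riemann mapping from $\{|z|>1\}$ to the complement of two equal length slits from the origin, at angles $\pm\pi/3$ with the positive real axis. The slits divide a neighborhood of the origin into a sector of angle $2\pi/3$ (containing the positive axis) and a sector of angle $4\pi/3$; the origin, as a boundary point of the cut-open plane, gives one vertex for each sector. $S_\epsilon,P_\epsilon$ have domain $\{|z|>\epsilon\}$; the composition maps the complement of the scaled slits $\Sigma_\epsilon$ of $P_\epsilon$ onto the complement of $\{\zeta\mid-2\epsilon\le\Re\zeta\le2\epsilon,\ \Im\zeta=0\}$ and extends to the cut-open slit edges. Pushforward means pullback by the inverse of the (injective) map, a priori defined on the complement of the image slit. A holomorphic family $A_\epsilon(w)$ with $A_0(w)=w$, holomorphic away from a small neighborhood of $w=0$, has variation cocycles the vector fields $\dot A(w)\frac{d}{dw}$ and $\ddot A(w)\frac{d}{dw}$ on an annulus around $w=0$. Construction on a surface: with $A_\epsilon=S_\epsilon\circ P_\epsilon^{-1}$, $\epsilon$ small and $\Sigma_\epsilon$ contained in a disc $\{|w|<\rho\}$ of the coordinate, the deformed surface is obtained by cutting $R$ open along $\Sigma_\epsilon$ and regluing the slit edges via $A_\epsilon$, i.e. $\{|w|<\rho\}\setminus\Sigma_\epsilon$ is identified by $\zeta=A_\epsilon(w)$ with its image in the $\zeta$-plane and the image slit is filled in. The deformed differential is the extension of the original differential on $R\setminus\Sigma_\epsilon$. Periods are compared on cycles disjoint from the disc;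 the integral norm of $\omega$ is $\frac i2\int\omega\wedge\overline{\omega}$. *)

theory Defs
  imports "HOL-Complex_Analysis.Complex_Analysis" "HOL-Library.Poly_Mapping"
begin

section \<open>The slit mappings\<close>

definition Smap :: "complex \<Rightarrow> complex" where
  "Smap z = z + 1 / z"

text \<open>For \<open>norm z > 1\<close> both \<open>1 + 1 / z\<close> and \<open>1 - 1 / z\<close> lie in the right half plane, so the
  principal powers are holomorphic there, and they give the branch with \<open>Pmap z \<sim> z\<close> at infinity.\<close>

definition Pmap :: "complex \<Rightarrow> complex" where
  "Pmap z = z * (1 + 1 / z) powr (4 / 3) * (1 - 1 / z) powr (2 / 3)"

definition rescale :: "real \<Rightarrow> (complex \<Rightarrow> complex) \<Rightarrow> complex \<Rightarrow> complex" where
  "rescale \<epsilon> f z = of_real \<epsilon> * f (z / of_real \<epsilon>)"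

definition exterior :: "real \<Rightarrow> complex set" where
  "exterior \<epsilon> = {z. \<epsilon> < norm z}"

text \<open>The slit tips of \<open>Pmap\<close> are its critical values on the unit circle: \<open>Pmap'\<close> vanishes where
  \<open>z\<^sup>2 - 2 / 3 * z + 1 = 0\<close>, and there \<open>Pmap z ^ 3 = (z + 1) ^ 4 * (z - 1)\<^sup>2 / z ^ 3 = - 256 / 27\<close>.\<close>

definition slit_length :: real where
  "slit_length = root 3 (256 / 27)"

definition upper_tip :: "real \<Rightarrow> complex" where
  "upper_tip \<epsilon> = of_real (\<epsilon> * slit_length) * cis (pi / 3)"

definition lower_tip :: "real \<Rightarrow> complex" where
  "lower_tip \<epsilon> = of_real (\<epsilon> * slit_length) * cis (- (pi / 3))"

definition slits :: "real \<Rightarrow> complex set" where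
  "slits \<epsilon> = closed_segment 0 (upper_tip \<epsilon>) \<union> closed_segment 0 (lower_tip \<epsilon>)"

definition image_slit :: "real \<Rightarrow> complex set" where
  "image_slit \<epsilon> = {\<zeta>. - 2 * \<epsilon> \<le> Re \<zeta> \<and> Re \<zeta> \<le> 2 * \<epsilon> \<and> Im \<zeta> = 0}"

text \<open>The two sectors at the origin cut out by the slits, of angle \<open>2 * pi / 3\<close> and
  \<open>4 * pi / 3\<close>. A vertex of the cut-open plane is the origin approached within one of them.\<close>

definition narrow_sector :: "complex set" where
  "narrow_sector = {w. w \<noteq> 0 \<and> \<bar>Arg w\<bar> < pi / 3}"

definition wide_sector :: "complex set" where
  "wide_sector = {w. w \<noteq> 0 \<and> \<bar>Arg w\<bar> > pi / 3}"

definition slit_map :: "real \<Rightarrow> complex \<Rightarrow> complex" where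
  "slit_map \<epsilon> w =
     (if \<epsilon> = 0 then w else rescale \<epsilon> Smap (inv_into (exterior \<epsilon>) (rescale \<epsilon> Pmap) w))"

section \<open>Families and variation cocycles\<close>

text \<open>The parameter runs over \<open>\<epsilon> \<ge> 0\<close>; \<open>B\<close> extends the family to complex parameters.\<close>

definition holomorphic_family_from_id :: "(real \<Rightarrow> complex \<Rightarrow> complex) \<Rightarrow> bool" where
  "holomorphic_family_from_id A \<longleftrightarrow>
     (\<forall>w. A 0 w = w) \<and>
     (\<forall>r>0. \<exists>\<delta>>0. \<exists>B.
        (\<forall>\<epsilon>\<in>{0..<\<delta>}. \<forall>w\<in>exterior r. B (complex_of_real \<epsilon>) w = A \<epsilon> w) \<and>
        (\<forall>e\<in>ball 0 \<delta>. B e holomorphic_on exterior r) \<and>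
        (\<forall>w\<in>exterior r. (\<lambda>e. B e w) holomorphic_on ball 0 \<delta>))"

text \<open>The vector field \<open>v d/dw\<close> is represented by its coefficient \<open>v\<close>. Derivatives with respect
  to the parameter are one-sided at \<open>0\<close>, since the family is given for \<open>\<epsilon> \<ge> 0\<close> only.\<close>

definition has_variation_cocycles ::
  "(real \<Rightarrow> complex \<Rightarrow> complex) \<Rightarrow> (complex \<Rightarrow> complex) \<Rightarrow> (complex \<Rightarrow> complex) \<Rightarrow> bool" where
  "has_variation_cocycles A v\<^sub>1 v\<^sub>2 \<longleftrightarrow>
     (\<forall>w. w \<noteq> 0 \<longrightarrow> (\<exists>\<delta>>0. \<exists>A'.
        (\<forall>\<epsilon>\<in>{0..<\<delta>}. ((\<lambda>e. A e w) has_vector_derivative A' \<epsilon>) (at \<epsilon> within {0..})) \<and>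
        A' 0 = v\<^sub>1 w \<and>
        (A' has_vector_derivative v\<^sub>2 w) (at 0 within {0..})))"

section \<open>Differentials in the plane\<close>

text \<open>The differential \<open>f dw\<close> is represented by \<open>f\<close>; its pushforward by an injective map \<open>h\<close> on
  \<open>X\<close> is the pullback by the inverse map, and is meaningful on \<open>h ` X\<close>.\<close>

definition pushforward ::
  "complex set \<Rightarrow> (complex \<Rightarrow> complex) \<Rightarrow> (complex \<Rightarrow> complex) \<Rightarrow> complex \<Rightarrow> complex" where
  "pushforward X h f \<zeta> = f (inv_into X h \<zeta>) * deriv (inv_into X h) \<zeta>"

definition simple_zero :: "(complex \<Rightarrow> complex) \<Rightarrow> complex \<Rightarrow> bool" where
  "simple_zero f z \<longleftrightarrow> isolated_zero f z \<and> zorder f z = 1"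

section \<open>Riemann surfaces and Abelian differentials\<close>

type_synonym 'a chart = "'a set \<times> ('a \<Rightarrow> complex)"

record 'a surface =
  stop :: "'a topology"
  atlas :: "'a chart set"

text \<open>The atlas is not required to be maximal.\<close>

definition riemann_surface :: "'a surface \<Rightarrow> bool" where
  "riemann_surface R \<longleftrightarrow>
     connected_space (stop R) \<and> Hausdorff_space (stop R) \<and>
     (\<Union>(U, \<phi>)\<in>atlas R. U) = topspace (stop R) \<and>
     (\<forall>(U, \<phi>)\<in>atlas R. openin (stop R) U \<and> open (\<phi> ` U) \<and>
        homeomorphic_map (subtopology (stop R) U) (top_of_set (\<phi> ` U)) \<phi>) \<and>
     (\<forall>(U, \<phi>)\<in>atlas R. \<forall>(V, \<psi>)\<in>atlas R. (\<psi> \<circ> inv_into U \<phi>) holomorphic_on \<phi> ` (U \<inter> V))"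

definition compact_riemann_surface :: "'a surface \<Rightarrow> bool" where
  "compact_riemann_surface R \<longleftrightarrow> riemann_surface R \<and> compact_space (stop R)"

text \<open>A differential assigns to a chart \<open>c = (U, \<phi>)\<close> and a point \<open>x \<in> U\<close> the coefficient
  \<open>\<omega> c x\<close> of \<open>d\<phi>\<close> at \<open>x\<close>; values for \<open>x \<notin> U\<close> are irrelevant.\<close>

type_synonym 'a differential = "'a chart \<Rightarrow> 'a \<Rightarrow> complex"

definition abelian_differential :: "'a surface \<Rightarrow> 'a differential \<Rightarrow> bool" where
  "abelian_differential R \<omega> \<longleftrightarrow>
     (\<forall>(U, \<phi>)\<in>atlas R. (\<omega> (U, \<phi>) \<circ> inv_into U \<phi>) holomorphic_on \<phi> ` U) \<and>
     (\<forall>(U, \<phi>)\<in>atlas R. \<forall>(V, \<psi>)\<in>atlas R. \<forall>x\<in>U \<inter> V.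
        \<omega> (U, \<phi>) x = \<omega> (V, \<psi>) x * deriv (\<psi> \<circ> inv_into U \<phi>) (\<phi> x))"

definition piecewise_C1_path :: "'a surface \<Rightarrow> (real \<Rightarrow> 'a) \<Rightarrow> bool" where
  "piecewise_C1_path R \<gamma> \<longleftrightarrow> pathin (stop R) \<gamma> \<and>
     (\<exists>K. finite K \<and>
        (\<forall>(U, \<phi>)\<in>atlas R. (\<phi> \<circ> \<gamma>) C1_differentiable_on ({0..1} \<inter> \<gamma> -` U - K)))"

text \<open>The value below does not depend on the chosen chart around \<open>\<gamma> t\<close>, by the transformation law
  of a differential.\<close>

definition path_pullback :: "'a surface \<Rightarrow> 'a differential \<Rightarrow> (real \<Rightarrow> 'a) \<Rightarrow> real \<Rightarrow> complex" where
  "path_pullback R \<omega> \<gamma> t =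
     (let c = (SOME c. c \<in> atlas R \<and> \<gamma> t \<in> fst c)
      in \<omega> c (\<gamma> t) * vector_derivative (snd c \<circ> \<gamma>) (at t))"

definition path_integral :: "'a surface \<Rightarrow> 'a differential \<Rightarrow> (real \<Rightarrow> 'a) \<Rightarrow> complex" where
  "path_integral R \<omega> \<gamma> = integral {0..1} (path_pullback R \<omega> \<gamma>)"

text \<open>A 1-chain is a formal integer combination of paths.\<close>

definition cycle_in :: "'a surface \<Rightarrow> 'a set \<Rightarrow> ((real \<Rightarrow> 'a) \<Rightarrow>\<^sub>0 int) \<Rightarrow> bool" where
  "cycle_in R X c \<longleftrightarrow>
     (\<forall>\<gamma>\<in>Poly_Mapping.keys c. piecewise_C1_path R \<gamma> \<and> \<gamma> ` {0..1} \<subseteq> X) \<and>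
     frag_extend (\<lambda>\<gamma>. frag_of (\<gamma> 1) - frag_of (\<gamma> 0)) c = 0"

definition period :: "'a surface \<Rightarrow> 'a differential \<Rightarrow> ((real \<Rightarrow> 'a) \<Rightarrow>\<^sub>0 int) \<Rightarrow> complex" where
  "period R \<omega> c =
     (\<Sum>\<gamma>\<in>Poly_Mapping.keys c. of_int (Poly_Mapping.lookup c \<gamma>) * path_integral R \<omega> \<gamma>)"

text \<open>In a coordinate \<open>z = x + i y\<close> with \<open>\<omega> = f dz\<close> one has
  \<open>i / 2 * \<omega> \<and> cnj \<omega> = (norm f)\<^sup>2 dx \<and> dy\<close>. The integral of this nonnegative area form over the
  surface is the supremum of its sums over finite disjoint families of Borel pieces, each contained
  in a chart domain; it is attained by any partition of the surface into such pieces.\<close>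

definition chart_norm :: "'a differential \<Rightarrow> 'a chart \<Rightarrow> 'a set \<Rightarrow> ennreal" where
  "chart_norm \<omega> c E =
     (\<integral>\<^sup>+z\<in>snd c ` E. ennreal ((norm (\<omega> c (inv_into (fst c) (snd c) z)))\<^sup>2) \<partial>lborel)"

definition integral_norm :: "'a surface \<Rightarrow> 'a differential \<Rightarrow> ennreal" where
  "integral_norm R \<omega> =
     (SUP F\<in>{F. finite F \<and> disjoint_family_on fst F \<and>
               (\<forall>(E, U, \<phi>)\<in>F. (U, \<phi>) \<in> atlas R \<and> E \<subseteq> U \<and> \<phi> ` E \<in> sets borel)}.
        \<Sum>(E, c)\<in>F. chart_norm \<omega> c E)"

section \<open>The deformed surface\<close>

definition atlas_topology :: "'a chart set \<Rightarrow> 'a topology" where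
  "atlas_topology \<A> =
     topology (\<lambda>W. W \<subseteq> (\<Union>(U, \<phi>)\<in>\<A>. U) \<and> (\<forall>(U, \<phi>)\<in>\<A>. open (\<phi> ` (W \<inter> U))))"

definition surface_slits :: "'a chart \<Rightarrow> real \<Rightarrow> 'a set" where
  "surface_slits c \<epsilon> = {x \<in> fst c. snd c x \<in> slits \<epsilon>}"

text \<open>The points of the deformed surface are the points \<open>Inl x\<close> of the original surface off the
  slits and the points \<open>Inr \<zeta>\<close> of the filled in image slit. The charts are those of the original
  surface off the slits, together with the coordinate \<open>\<zeta>\<close>, which is \<open>slit_map \<epsilon> w\<close> on the slit
  disc and glues the image slit into it.\<close>

definition restricted_chart :: "'a chart \<Rightarrow> real \<Rightarrow> 'a chart \<Rightarrow> ('a + complex) chart" where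
  "restricted_chart c \<epsilon> d = (Inl ` (fst d - surface_slits c \<epsilon>), snd d \<circ> projl)"

definition filled_chart :: "'a chart \<Rightarrow> real \<Rightarrow> ('a + complex) chart" where
  "filled_chart c \<epsilon> =
     (Inl ` (fst c - surface_slits c \<epsilon>) \<union> Inr ` image_slit \<epsilon>,
      case_sum (\<lambda>x. slit_map \<epsilon> (snd c x)) (\<lambda>\<zeta>. \<zeta>))"

definition deformed_surface :: "'a surface \<Rightarrow> 'a chart \<Rightarrow> real \<Rightarrow> ('a + complex) surface" where
  "deformed_surface R c \<epsilon> =
     (let \<A> = insert (filled_chart c \<epsilon>) (restricted_chart c \<epsilon> ` atlas R)
      in \<lparr>stop = atlas_topology \<A>, atlas = \<A>\<rparr>)"

definition deformed_differential ::
  "'a surface \<Rightarrow> 'a chart \<Rightarrow> real \<Rightarrow> 'a differential \<Rightarrow> ('a + complex) differential \<Rightarrow> bool" where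
  "deformed_differential R c \<epsilon> \<omega> \<omega>' \<longleftrightarrow>
     abelian_differential (deformed_surface R c \<epsilon>) \<omega>' \<and>
     (\<forall>d\<in>atlas R. \<forall>x\<in>fst d - surface_slits c \<epsilon>. \<omega>' (restricted_chart c \<epsilon> d) (Inl x) = \<omega> d x)"

definition transferred_chain ::
  "((real \<Rightarrow> 'a) \<Rightarrow>\<^sub>0 int) \<Rightarrow> ((real \<Rightarrow> 'a + complex) \<Rightarrow>\<^sub>0 int)" where
  "transferred_chain k = frag_extend (\<lambda>\<gamma>. frag_of (Inl \<circ> \<gamma>)) k"

end

theory Submission
  imports Defs
begin

text \<open>Both slit mappings are functions of \<open>z\<close> with \<open>(z + 1)\<^sup>2 / z = S z + 2\<close> and
  \<open>(z - 1)\<^sup>2 / z = S z - 2\<close>, so \<open>w = P\<^sub>\<epsilon> z\<close> and \<open>\<zeta> = S\<^sub>\<epsilon> z\<close> satisfy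
  \<open>w ^ 3 = (\<zeta> + 2 * \<epsilon>)\<^sup>2 * (\<zeta> - 2 * \<epsilon>)\<close>. Since \<open>- w\<^sup>2 dw = - 1/3 d(w ^ 3)\<close>, the pushed forward
  differential is \<open>- (\<zeta> - 2/3 * \<epsilon>) * (\<zeta> + 2 * \<epsilon>) d\<zeta>\<close>, and implicit differentiation of the cubic
  gives the two cocycles. The cubic also yields \<open>\<bar>\<bar>w\<bar> - \<bar>\<zeta>\<bar>\<bar> \<le> 2 * \<epsilon>\<close>; hence \<open>\<zeta> = A\<^sub>\<epsilon>(w)\<close> and its
  inverse map closed subsets of the plane that avoid the slits to closed sets, which is all that
  the topology of the reglued surface needs: boundary values on the slit edges never enter.
  Periods and norm are unchanged because the deformed differential is the original one off the
  slits, and both slits are null sets.\<close>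

section \<open>The slit mappings and the cubic relation\<close>

text \<open>The cubic alone determines neither variable from the other: each \<open>w\<close> has
  three roots \<zeta>, and each \<zeta> fixes \<open>w\<close> only up to a cube root of unity.
  Passing from the relation to the maps always requires the choice of a branch, and the real axis
  makes it, since \<open>Pmap\<close> is real and keeps the sign on real points outside the unit
  disc. For \<epsilon> = 1 the number 256/27 is the maximum of (x + 2)^2 (2 - x) on [-2, 2], taken
  at x = 2/3. The cubic therefore sends the image slit into [-256/27, 0], whose cube roots fill the
  two slits and a segment of the negative axis; that segment is no boundary, because real values of
  \<open>Pmap\<close> cover it. The critical points of the cubic are 2/3 \<epsilon> and -2
  \<epsilon>. They are the limits of the map at the tips and at the wide vertex, whereas the narrow
  vertex goes to the simple root 2 \<epsilon>, where the derivative does not vanish. On the surface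
  the difficulty is that the map is undefined on the slits, so neighbourhoods of the filled slit
  have no direct description. They are handled through their complements, which lie off the
  slits.\<close>

definition slit_cubic :: "real \<Rightarrow> complex \<Rightarrow> complex" where
  "slit_cubic e \<zeta> = (\<zeta> + 2 * of_real e)\<^sup>2 * (\<zeta> - 2 * of_real e)"

section \<open>The map S from the exterior of the unit disc to the complement of a segment\<close>

lemma Im_Smap: "z \<noteq> 0 \<Longrightarrow> Im (Smap z) = Im z * (1 - 1 / (norm z)\<^sup>2)"
  by (simp add: Smap_def Im_divide cmod_power2 right_diff_distrib)

lemma inj_on_Smap: "inj_on Smap (exterior 1)"
proof (rule inj_onI)
  fix z y assume z: "z \<in> exterior 1" and y: "y \<in> exterior 1" and eq: "Smap z = Smap y"
  have nz: "z \<noteq> 0" "y \<noteq> 0" using z y by (auto simp: exterior_def)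
  have "z * y \<noteq> 1"
  proof
    assume "z * y = 1"
    hence "norm z * norm y = 1" by (metis norm_mult norm_one)
    moreover have "norm z * norm y > 1" using z y by (simp add: exterior_def less_1_mult)
    ultimately show False by simp
  qed
  moreover have "(z - y) * (z * y - 1) = 0"
    using eq nz by (simp add: Smap_def field_simps)
  ultimately show "z = y" by simp
qed

lemma Smap_notin_image_slit: "z \<in> exterior 1 \<Longrightarrow> Smap z \<notin> image_slit 1"
proof
  assume z: "z \<in> exterior 1" and s: "Smap z \<in> image_slit 1"
  have n: "norm z > 1" "z \<noteq> 0" using z by (auto simp: exterior_def)
  have "1 / (norm z)\<^sup>2 < 1" using n by (simp add: power_gt1 one_less_power)
  moreover have "Im (Smap z) = 0" using s by (simp add: image_slit_def)
  ultimately have im: "Im z = 0" using Im_Smap[OF n(2)] by (metis diff_gt_0_iff_gt less_irrefl mult_eq_0_iff)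
  define x where "x = Re z"
  have zx: "z = of_real x" using im by (simp add: complex_eq_iff x_def)
  have x1: "\<bar>x\<bar> > 1" using n zx by simp
  have "Smap z = of_real (x + 1/x)" by (simp add: Smap_def zx)
  hence "\<bar>x + 1/x\<bar> \<le> 2" using s by (simp add: image_slit_def abs_le_iff)
  moreover have "\<bar>x + 1/x\<bar> * \<bar>x\<bar> = x\<^sup>2 + 1"
  proof -
    have "\<bar>x + 1/x\<bar> * \<bar>x\<bar> = \<bar>x*x + 1\<bar>" using x1 by (simp add: abs_mult[symmetric] field_simps)
    also have "\<dots> = x\<^sup>2 + 1" by (simp add: power2_eq_square)
    finally show ?thesis .
  qed
  ultimately have "x\<^sup>2 + 1 \<le> 2 * \<bar>x\<bar>" by (metis abs_ge_zero mult_right_mono)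
  hence "(\<bar>x\<bar> - 1)\<^sup>2 \<le> 0" by (simp add: power2_diff)
  thus False using x1 by simp
qed

text \<open>The candidates are the two roots of z^2 - \<zeta> z + 1, whose product is 1. Either one
  of them lies outside the unit circle, or both lie on it and are conjugate, and then \<zeta> = 2 Re
  z would be on the segment.\<close>

lemma Smap_surj:
  assumes "\<zeta> \<notin> image_slit 1"
  obtains z where "z \<in> exterior 1" "Smap z = \<zeta>"
proof -
  define s where "s = csqrt (\<zeta>\<^sup>2 - 4)"
  define z where "z = (\<zeta> + s) / 2"
  define y where "y = (\<zeta> - s) / 2"
  have ss: "s\<^sup>2 = \<zeta>\<^sup>2 - 4" by (simp add: s_def)
  have zy: "z * y = 1" using ss by (simp add: z_def y_def field_simps power2_eq_square)
  have sum: "z + y = \<zeta>" by (simp add: z_def y_def field_simps)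
  have nz: "z \<noteq> 0" "y \<noteq> 0" using zy by auto
  have yz: "y = 1 / z" "z = 1 / y" using zy nz by (simp_all add: field_simps)
  have S: "Smap z = \<zeta>" "Smap y = \<zeta>" using sum yz unfolding Smap_def by (metis add.commute)+
  have n: "norm z * norm y = 1" using zy by (metis norm_mult norm_one)
  consider "norm z > 1" | "norm y > 1" | "norm z = 1"
  proof -
    have "norm y > 1" if zl: "norm z < 1"
    proof (rule ccontr)
      assume "\<not> norm y > 1"
      hence "norm z * norm y \<le> norm z * 1" by (intro mult_left_mono) auto
      thus False using n zl by simp
    qed
    thus thesis using that by (meson linorder_less_linear)
  qed
  thus thesis
  proof cases
    case 1 thus ?thesis using that[of z] S by (simp add: exterior_def)
  next
    case 2 thus ?thesis using that[of y] S by (simp add: exterior_def)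
  next
    case 3
    have "y = cnj z" using yz(1) complex_div_cnj[of 1 z] 3 by simp
    hence "\<zeta> = of_real (2 * Re z)" using sum by (simp add: complex_eq_iff)
    moreover have "\<bar>Re z\<bar> \<le> 1" using 3 abs_Re_le_cmod[of z] by simp
    ultimately have "\<zeta> \<in> image_slit 1" by (simp add: image_slit_def abs_le_iff)
    thus ?thesis using assms by simp
  qed
qed

lemma bij_betw_Smap: "bij_betw Smap (exterior 1) (- image_slit 1)"
  unfolding bij_betw_def using inj_on_Smap Smap_notin_image_slit Smap_surj by blast

section \<open>Principal powers and the cubic relation for P\<close>

text \<open>The exponent \<open>n / 3\<close> becomes the integer \<open>n\<close> after cubing, so
  the choice of the logarithm cancels.\<close>

lemma powr_third_cube:
  fixes a :: complex
  shows "a \<noteq> 0 \<Longrightarrow> (a powr (of_nat n / 3)) ^ 3 = a ^ n"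
  by (simp add: powr_def exp_of_nat_mult[symmetric]) (simp add: exp_of_nat_mult)

lemma exterior_one_plus:
  assumes "z \<in> exterior 1"
  shows "Re (1 + 1 / z) > 0" "Re (1 - 1 / z) > 0"
proof -
  have "norm (1 / z) < 1" using assms by (simp add: exterior_def norm_divide divide_less_eq)
  hence "\<bar>Re (1/z)\<bar> < 1" using abs_Re_le_cmod[of "1/z"] by linarith
  thus "Re (1 + 1 / z) > 0" "Re (1 - 1 / z) > 0" by auto
qed

lemma exterior_one_nonzero:
  assumes "z \<in> exterior 1"
  shows "z \<noteq> 0" "1 + 1 / z \<noteq> 0" "1 - 1 / z \<noteq> 0"
proof -
  show "z \<noteq> 0" using assms by (auto simp: exterior_def)
  show "1 + 1 / z \<noteq> 0" "1 - 1 / z \<noteq> 0"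
    using exterior_one_plus[OF assms] by (metis less_irrefl zero_complex.sel(1))+
qed

lemma Pmap_nonzero: "z \<in> exterior 1 \<Longrightarrow> Pmap z \<noteq> 0"
  using exterior_one_nonzero[of z] by (simp add: Pmap_def)

lemma Pmap_cube:
  assumes z: "z \<in> exterior 1"
  shows "Pmap z ^ 3 = slit_cubic 1 (Smap z)"
proof -
  note n = exterior_one_nonzero[OF z]
  have "Pmap z ^ 3 = z ^ 3 * (1 + 1/z)^4 * (1 - 1/z)^2"
    unfolding Pmap_def power_mult_distrib
    using powr_third_cube[OF n(2), of 4] powr_third_cube[OF n(3), of 2] by simp
  also have "\<dots> = slit_cubic 1 (Smap z)"
  proof -
    have "z * (1 + 1/z)^2 = Smap z + 2" "z * (1 - 1/z)^2 = Smap z - 2"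
      using n by (simp_all add: Smap_def power2_eq_square field_simps)
    hence "slit_cubic 1 (Smap z) = (z * (1 + 1/z)^2)^2 * (z * (1 - 1/z)^2)"
      by (simp add: slit_cubic_def)
    thus ?thesis by (simp add: power_mult_distrib eval_nat_numeral)
  qed
  finally show ?thesis .
qed

lemma holomorphic_Smap: "Smap holomorphic_on exterior 1"
  unfolding Smap_def by (intro holomorphic_intros) (auto simp: exterior_def)

lemma Re_pos_nonpos_Reals: "Re a > 0 \<Longrightarrow> a \<notin> \<real>\<^sub>\<le>\<^sub>0"
  by (auto simp: complex_nonpos_Reals_iff)

lemma holomorphic_Pmap: "Pmap holomorphic_on exterior 1"
  unfolding Pmap_def
  by (intro holomorphic_intros Re_pos_nonpos_Reals exterior_one_plus) (auto simp: exterior_def)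

lemma open_exterior: "open (exterior r)"
  unfolding exterior_def by (intro open_Collect_less continuous_intros)

section \<open>Injectivity of P\<close>

text \<open>Dividing by \<open>b - a\<close> before the mean value theorem along the segment turns
  the increment into \<open>Re (f' u)\<close> itself, so equal values at \<open>a\<close> and
  \<open>b\<close> would force this real part to vanish.\<close>

lemma Noshiro_Warschawski:
  assumes "convex S" "\<And>z. z \<in> S \<Longrightarrow> (f has_field_derivative f' z) (at z)"
    "\<And>z. z \<in> S \<Longrightarrow> Re (f' z) > 0"
  shows "inj_on f S"
proof (rule inj_onI, rule ccontr)
  fix a b assume ab: "a \<in> S" "b \<in> S" "f a = f b" "a \<noteq> b"
  have seg: "closed_segment a b \<subseteq> S" using ab assms(1) by (simp add: closed_segment_subset)
  obtain u where u: "u \<in> closed_segment a b"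
    "Re (f b / (b - a)) - Re (f a / (b - a)) = Re (f' u / (b - a) * (b - a))"
    using complex_mvt_line[of a b "\<lambda>z. f z / (b - a)" "\<lambda>z. f' z / (b - a)"] seg assms(2)
    by (metis DERIV_cdivide subsetD)
  thus False using ab seg assms(3)[of u] by auto
qed

text \<open>Inversion maps the disc of radius 1 about 1 onto the half plane to the right of 1/2. The
  exponents 4/3 and 2/3 of \<open>Pmap\<close> add up to 2, so the bound 1/2 is exactly what is
  needed to beat the constant -1 in \<open>L' s\<close>.\<close>

lemma Re_inverse_one_plus: 
  fixes u :: complex
  assumes "norm u < 1"
  shows "Re (1 / (1 + u)) > 1 / 2"
proof -
  have u: "(Re u)\<^sup>2 + (Im u)\<^sup>2 < 1" using assms 
    by (metis cmod_power2 norm_ge_zero one_power2 power_strict_mono zero_less_numeral)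
  have "\<bar>Re u\<bar> < 1" using assms abs_Re_le_cmod[of u] by linarith
  hence "(1 + Re u)\<^sup>2 > 0" by (intro zero_less_power) linarith
  hence p: "(1 + Re u)\<^sup>2 + (Im u)\<^sup>2 > 0" by (simp add: add_pos_nonneg)
  have "(1 + Re u)\<^sup>2 + (Im u)\<^sup>2 < 2 * (1 + Re u)" using u by (simp add: power2_sum)
  hence "1 / 2 < (1 + Re u) / ((1 + Re u)\<^sup>2 + (Im u)\<^sup>2)" using p by (simp add: less_divide_eq)
  thus ?thesis by (simp add: Re_divide)
qed

lemma inj_on_Pmap: "inj_on Pmap (exterior 1)"
proof (rule inj_onI)
  fix z y assume z: "z \<in> exterior 1" and y: "y \<in> exterior 1" and eq: "Pmap z = Pmap y"
  \<comment> \<open>\<open>L\<close> is the logarithm of \<open>Pmap\<close> in the coordinate \<open>exp s\<close>; \<open>Re L' > 0\<close> says that the slit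
    domain is starlike with respect to infinity.\<close>
  define L :: "complex \<Rightarrow> complex" where
    "L s = s + 4 / 3 * Ln (1 + exp (-s)) + 2 / 3 * Ln (1 - exp (-s))" for s
  define L' :: "complex \<Rightarrow> complex" where
    "L' s = 1 + 4 / 3 * (inverse (1 + exp (-s)) * - exp (-s)) + 2 / 3 * (inverse (1 - exp (-s)) * exp (-s))" for s
  have ext: "exp s \<in> exterior 1" if "Re s > 0" for s using that by (simp add: exterior_def)
  have plus: "Re (1 + exp (-s)) > 0" "Re (1 - exp (-s)) > 0" if "Re s > 0" for s
    using exterior_one_plus[OF ext[OF that]] by (simp_all add: exp_minus divide_inverse)
  have nz: "1 + exp (-s) \<noteq> 0" "1 - exp (-s) \<noteq> 0" if "Re s > 0" for s
    using plus[OF that] by (metis less_irrefl zero_complex.sel(1))+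
  have inj: "inj_on L {s. 0 < Re s}"
  proof (rule Noshiro_Warschawski)
    show "convex {s. 0 < Re s}" by (rule convex_halfspace_Re_gt)
  next
    fix s assume "s \<in> {s. 0 < Re s}"
    hence s: "Re s > 0" by simp
    show "(L has_field_derivative L' s) (at s)" unfolding L_def L'_def
      by (rule derivative_eq_intros refl Re_pos_nonpos_Reals plus s | simp add: algebra_simps)+
    define u where "u = exp (-s)"
    have u: "norm u < 1" using s by (simp add: u_def)
    have "L' s = - 1 + 4 / 3 * (1 / (1 + u)) + 2 / 3 * (1 / (1 + - u))"
    proof -
      have "inverse (1 + u) * - u = 1 / (1 + u) - 1" "inverse (1 - u) * u = 1 / (1 + - u) - 1"
        using nz[OF s] unfolding u_def[symmetric] by (simp_all add: field_simps)
      hence "L' s = 1 + 4 / 3 * (1 / (1 + u) - 1) + 2 / 3 * (1 / (1 + - u) - 1)"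
        unfolding L'_def u_def[symmetric] by (simp only:)
      moreover have "1 + 4 / 3 * (A - 1) + 2 / 3 * (B - 1) = - 1 + 4 / 3 * A + 2 / 3 * B" for A B :: complex
        by (simp add: field_simps)
      ultimately show ?thesis by (simp only:)
    qed
    moreover have "Re (1 / (1 + u)) > 1 / 2" "Re (1 / (1 + - u)) > 1 / 2"
      using Re_inverse_one_plus[of u] Re_inverse_one_plus[of "- u"] u by simp_all
    moreover have "Re (4 / 3 * (1 / (1 + u))) = 4 / 3 * Re (1 / (1 + u))"
      "Re (2 / 3 * (1 / (1 + - u))) = 2 / 3 * Re (1 / (1 + - u))"
    proof -
      have "Re (of_real c * a) = c * Re a" for c a by simp
      from this[of "4 / 3" "1 / (1 + u)"] this[of "2 / 3" "1 / (1 + - u)"]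
      show "Re (4 / 3 * (1 / (1 + u))) = 4 / 3 * Re (1 / (1 + u))"
        "Re (2 / 3 * (1 / (1 + - u))) = 2 / 3 * Re (1 / (1 + - u))"
        by (simp_all only: of_real_divide of_real_numeral)
    qed
    ultimately show "Re (L' s) > 0" by (simp only: plus_complex.sel uminus_complex.sel one_complex.sel)
  qed
  have expL: "exp (L s) = Pmap (exp s)" if "Re s > 0" for s
  proof -
    have e: "1 / exp s = exp (- s)" by (simp add: exp_minus divide_inverse)
    show ?thesis unfolding L_def Pmap_def e exp_add powr_def using nz[OF that] by simp
  qed
  have "z \<noteq> 0" "y \<noteq> 0" using z y exterior_one_nonzero by auto
  hence lz: "exp (Ln z) = z" "Re (Ln z) > 0" and ly: "exp (Ln y) = y" "Re (Ln y) > 0"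
    using z y by (auto simp: exterior_def)
  have "exp (L (Ln z)) = exp (L (Ln y))" using expL lz ly eq by simp
  then obtain n :: int where n: "L (Ln z) = L (Ln y) + (of_int (2 * n) * pi) * \<i>"
    using exp_eq by metis
  \<comment> \<open>\<open>L s - s\<close> depends on \<open>exp (- s)\<close> only, so the
    ambiguity of the logarithm is absorbed by translating the argument. The half plane is invariant
    under this translation, and injectivity of \<open>L\<close> applies to \<open>t\<close>.\<close>
  define t where "t = Ln y + (of_int (2 * n) * pi) * \<i>"
  have et: "exp (- t) = exp (- Ln y)" unfolding exp_eq t_def
    by (intro exI[of _ "- n"]) simp
  have "L (Ln z) = L t" using n et by (simp add: L_def t_def)
  moreover have "Re t > 0" using ly by (simp add: t_def)
  ultimately have "Ln z = t" using inj lz by (simp add: inj_on_def)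
  hence "exp (- Ln z) = exp (- Ln y)" using et by simp
  thus "z = y" using lz ly by (simp add: exp_minus)
qed

section \<open>P and S on the real axis\<close>

lemma Pmap_of_real:
  assumes "\<bar>x\<bar> > 1"
  shows "Pmap (of_real x) = of_real (x * (1 + 1 / x) powr (4 / 3) * (1 - 1 / x) powr (2 / 3))"
    "1 + 1 / x > 0" "1 - 1 / x > 0"
proof -
  have "\<bar>1 / x\<bar> < 1" using assms by (simp add: field_simps)
  thus p: "1 + 1 / x > 0" "1 - 1 / x > 0" by linarith+
  have "complex_of_real ((1 + 1 / x) powr (4 / 3)) = of_real (1 + 1 / x) powr of_real (4 / 3)"
    "complex_of_real ((1 - 1 / x) powr (2 / 3)) = of_real (1 - 1 / x) powr of_real (2 / 3)"
    using p by (intro powr_of_real[symmetric]; simp)+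
  thus "Pmap (of_real x) = of_real (x * (1 + 1 / x) powr (4 / 3) * (1 - 1 / x) powr (2 / 3))"
    by (simp add: Pmap_def)
qed

text \<open>By \<open>Im_Smap\<close> the imaginary part of the value is that of \<open>z\<close>
  times a nonzero factor. The final inequality records that a real point and its image have the same
  sign, which \<open>Pmap_real_surj\<close> uses to keep track of the branch.\<close>

lemma Smap_real:
  assumes z: "z \<in> exterior 1" and im: "Im (Smap z) = 0"
  obtains x where "z = of_real x" "\<bar>x\<bar> > 1" "Smap z = of_real (x + 1 / x)" "x * (x + 1 / x) > 0"
proof -
  have n: "norm z > 1" "z \<noteq> 0" using z by (auto simp: exterior_def)
  have "1 / (norm z)\<^sup>2 < 1" using n by (simp add: one_less_power)
  hence "Im z = 0" using Im_Smap[OF n(2)] im by (metis diff_gt_0_iff_gt less_irrefl mult_eq_0_iff)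
  hence zx: "z = of_real (Re z)" by (simp add: complex_eq_iff)
  have "\<bar>Re z\<bar> > 1" using n zx by (metis norm_of_real)
  moreover have "Smap z = of_real (Re z + 1 / Re z)" by (subst zx) (simp add: Smap_def)
  moreover have "Re z * (Re z + 1 / Re z) = (Re z)\<^sup>2 + 1" using \<open>\<bar>Re z\<bar> > 1\<close>
    by (simp add: field_simps power2_eq_square)
  ultimately show thesis using that zx by (metis add_nonneg_pos zero_le_power2 zero_less_one)
qed

text \<open>The intermediate value theorem is applied to the real cubic \<open>q\<close> on the two
  rays outside [-2, 2], and the solution is pulled back by \<open>Smap\<close>. Cubes determine real
  numbers, so no root of unity is left over when \<open>Pmap\<close> is compared with
  \<open>y\<close>.\<close>

lemma Pmap_real_surj:
  assumes "y \<noteq> (0 :: real)"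
  obtains x where "\<bar>x\<bar> > 1" "x * y > 0" "Pmap (of_real x) = of_real y"
proof -
  define q where "q \<xi> = (\<xi> + 2)\<^sup>2 * (\<xi> - 2)" for \<xi> :: real
  have cq: "isCont q t" for t unfolding q_def by (intro continuous_intros)
  have "\<exists>\<xi>. \<bar>\<xi>\<bar> > 2 \<and> \<xi> * y > 0 \<and> q \<xi> = y ^ 3"
  proof (cases "y > 0")
    case True
    have "y * y\<^sup>2 \<le> y * (4 + y)\<^sup>2" using True by (intro mult_left_mono power_mono) auto
    hence "q 2 \<le> y ^ 3" "y ^ 3 \<le> q (2 + y)" using True
      by (simp_all add: q_def power3_eq_cube power2_eq_square algebra_simps)
    then obtain \<xi> where "2 \<le> \<xi>" "\<xi> \<le> 2 + y" "q \<xi> = y ^ 3"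
      using IVT[of q 2 "y ^ 3" "2 + y"] cq True by auto
    moreover have "\<xi> \<noteq> 2" using True \<open>q \<xi> = y ^ 3\<close> by (auto simp: q_def)
    ultimately show ?thesis using True by (intro exI[of _ \<xi>]) auto
  next
    case False
    hence y: "y < 0" using assms by simp
    have "q (- 2 + y) \<le> y ^ 3"
    proof -
      have "q (- 2 + y) = y ^ 3 - 4 * y\<^sup>2" by (simp add: q_def power3_eq_cube power2_eq_square algebra_simps)
      thus ?thesis by simp
    qed
    moreover have "y ^ 3 \<le> q (- 2)" using y by (simp add: q_def power_less_zero_eq less_imp_le)
    ultimately obtain \<xi> where "- 2 + y \<le> \<xi>" "\<xi> \<le> - 2" "q \<xi> = y ^ 3"
      using IVT[of q "- 2 + y" "y ^ 3" "- 2"] cq y by auto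
    moreover have "\<xi> \<noteq> - 2" using y \<open>q \<xi> = y ^ 3\<close> by (auto simp: q_def)
    ultimately show ?thesis using y by (intro exI[of _ \<xi>]) (auto intro: mult_neg_neg)
  qed
  then obtain \<xi> where \<xi>: "\<bar>\<xi>\<bar> > 2" "\<xi> * y > 0" "q \<xi> = y ^ 3" by blast
  have "complex_of_real \<xi> \<notin> image_slit 1" using \<xi> by (auto simp: image_slit_def)
  then obtain z where z: "z \<in> exterior 1" "Smap z = of_real \<xi>" by (rule Smap_surj)
  then obtain x where x: "z = of_real x" "\<bar>x\<bar> > 1" "Smap z = of_real (x + 1 / x)" "x * (x + 1 / x) > 0"
    using Smap_real by (metis Im_complex_of_real)
  have "x + 1 / x = \<xi>" using x z by (metis of_real_eq_iff)
  hence "x * \<xi> > 0" using x(4) by simp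
  hence xy: "x * y > 0" using \<xi>(2) by (auto simp: zero_less_mult_iff)
  obtain p where p: "Pmap (of_real x) = of_real (x * p)" "p > 0"
    using Pmap_of_real[OF x(2)] by (metis mult.assoc mult_pos_pos powr_gt_zero less_irrefl)
  have "Pmap z ^ 3 = of_real (q \<xi>)"
    using Pmap_cube[OF z(1)] z(2) by (simp add: slit_cubic_def q_def)
  hence "complex_of_real ((x * p) ^ 3) = of_real (y ^ 3)" using p x \<xi> by simp
  hence "(x * p) ^ 3 = y ^ 3" using of_real_eq_iff by blast
  hence "x * p = y" by (metis odd_real_root_power_cancel odd_numeral)
  thus thesis using that[of x] x xy p by simp
qed

section \<open>The slits described by the cube of w\<close>

lemma slit_length_cube: "slit_length ^ 3 = 256 / 27" "slit_length > 0"
  by (simp_all add: slit_length_def odd_real_root_pow)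

lemma cis_third_cube: "cis (pi / 3) ^ 3 = - 1" "cis (- (pi / 3)) ^ 3 = - 1"
proof -
  have a: "real 3 * (pi / 3) = pi" "real 3 * (- (pi / 3)) = - pi" by simp_all
  show "cis (pi / 3) ^ 3 = - 1" unfolding Complex.DeMoivre a by (rule cis_pi)
  show "cis (- (pi / 3)) ^ 3 = - 1" unfolding Complex.DeMoivre a by (simp add: complex_eq_iff)
qed

lemma mem_slits_iff:
  assumes "e > 0"
  shows "w \<in> slits e \<longleftrightarrow> (\<exists>r\<in>{0..e * slit_length}. w = of_real r * cis (pi / 3) \<or> w = of_real r * cis (- (pi / 3)))"
    (is "_ \<longleftrightarrow> ?R")
proof -
  have l: "e * slit_length > 0" using assms slit_length_cube by simp
  show ?thesis
  proof
    assume "w \<in> slits e"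
    then obtain u where u: "0 \<le> u" "u \<le> 1" "w = of_real u * upper_tip e \<or> w = of_real u * lower_tip e"
      unfolding slits_def by (auto simp: in_segment scaleR_conv_of_real)
    show ?R
      using u l by (intro bexI[of _ "u * (e * slit_length)"])
        (auto simp: upper_tip_def lower_tip_def mult_left_le_one_le)
  next
    assume ?R
    then obtain r where r: "0 \<le> r" "r \<le> e * slit_length"
      "w = of_real r * cis (pi / 3) \<or> w = of_real r * cis (- (pi / 3))" by auto
    define u where "u = r / (e * slit_length)"
    have u: "0 \<le> u" "u \<le> 1" "r = u * (e * slit_length)" using r l by (auto simp: u_def)
    have "w = u *\<^sub>R upper_tip e \<or> w = u *\<^sub>R lower_tip e"
      using r(3) unfolding u(3) by (auto simp: upper_tip_def lower_tip_def scaleR_conv_of_real mult.assoc)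
    thus "w \<in> slits e" unfolding slits_def using u by (auto simp: in_segment)
  qed
qed

lemma slits_cube:
  assumes "w \<in> slits 1"
  obtains s where "0 \<le> s" "s \<le> 256 / 27" "w ^ 3 = - of_real s"
proof -
  obtain r where r: "0 \<le> r" "r \<le> slit_length" "w = of_real r * cis (pi / 3) \<or> w = of_real r * cis (- (pi / 3))"
    using assms mem_slits_iff[of 1] by auto
  have "w ^ 3 = - of_real (r ^ 3)" using r(3) cis_third_cube by (auto simp: power_mult_distrib)
  moreover have "r ^ 3 \<le> 256 / 27"
    using power_mono[OF r(2) r(1), of 3] unfolding slit_length_cube .
  ultimately show thesis using that[of "r ^ 3"] r(1) by simp
qed

text \<open>The cube roots of - r^3 are - r and r times the two unit vectors at angles
  \<plusminus>pi/3. Those unit vectors have sum 1 and product 1, which gives the factorization of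
  w^3 + r^3; the bound on \<open>s\<close> puts the last two roots on the slits.\<close>

lemma cube_nonpos_cases:
  assumes "w ^ 3 = - complex_of_real s" "0 \<le> s" "s \<le> 256 / 27"
  shows "w \<in> slits 1 \<or> (\<exists>r>0. w = - of_real r)"
proof -
  define r where "r = root 3 s"
  have r: "r \<ge> 0" "r ^ 3 = s" using assms by (simp_all add: r_def odd_real_root_pow)
  have rl: "r \<le> slit_length" using assms(3) by (simp add: r_def slit_length_def)
  define a where "a = cis (pi / 3)"
  define b where "b = cis (- (pi / 3))"
  have ab: "a + b = 1" "a * b = 1"
    by (simp_all add: a_def b_def cis_mult complex_eq_iff cos_60)
  have "(w + of_real r) * ((w - of_real r * a) * (w - of_real r * b))
      = (w + of_real r) * (w\<^sup>2 - of_real r * w * (a + b) + (of_real r)\<^sup>2 * (a * b))"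
    by (simp add: algebra_simps power2_eq_square)
  also have "\<dots> = w ^ 3 + of_real (r ^ 3)" unfolding ab
    by (simp add: algebra_simps power2_eq_square power3_eq_cube)
  also have "\<dots> = 0" using assms(1) r by simp
  finally consider "w = - of_real r" | "w = of_real r * a" | "w = of_real r * b"
    by (auto simp: add_eq_0_iff2)
  thus ?thesis
  proof cases
    case 1
    show ?thesis
    proof (cases "r = 0")
      case True
      hence "w \<in> slits 1" using 1 by (simp add: slits_def)
      thus ?thesis ..
    qed (use 1 r in auto)
  qed (use r rl mem_slits_iff[of 1 w] in \<open>auto simp: a_def b_def\<close>)
qed

text \<open>A non-real root forces \<open>s = 8 * x\<^sup>2 * (x + 2)\<close> with \<open>x = Re \<zeta>\<close>, which lies outside \<open>[0, 256 / 27]\<close>.\<close>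

lemma slit_cubic_real_cases:
  assumes "slit_cubic 1 \<zeta> = - of_real s" "0 \<le> s" "s \<le> 256 / 27" "\<zeta> \<notin> image_slit 1"
  shows "Im \<zeta> = 0" "Re \<zeta> < - 2"
proof -
  define x where "x = Re \<zeta>"
  define y where "y = Im \<zeta>"
  have z: "\<zeta> = Complex x y" by (simp add: x_def y_def)
  have "Re (slit_cubic 1 \<zeta>) = (x + 2)\<^sup>2 * (x - 2) - (3 * x + 2) * y\<^sup>2"
    "Im (slit_cubic 1 \<zeta>) = y * ((3 * x - 2) * (x + 2) - y\<^sup>2)"
    unfolding slit_cubic_def z by (simp_all add: power2_eq_square algebra_simps)
  hence re: "(x + 2)\<^sup>2 * (x - 2) - (3 * x + 2) * y\<^sup>2 = - s"
    and im: "y * ((3 * x - 2) * (x + 2) - y\<^sup>2) = 0"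
    using assms(1) by simp_all
  have y0: "y = 0"
  proof (rule ccontr)
    assume y: "y \<noteq> 0"
    hence y2: "y\<^sup>2 = (3 * x - 2) * (x + 2)" using im by simp
    have yp: "(3 * x - 2) * (x + 2) > 0" using y y2 by (metis zero_less_power2)
    have "(x + 2)\<^sup>2 * (x - 2) - (3 * x + 2) * y\<^sup>2 = - 8 * x\<^sup>2 * (x + 2)"
      unfolding y2 by (simp add: power2_eq_square algebra_simps)
    hence s: "s = 8 * x\<^sup>2 * (x + 2)" using re by simp
    \<comment> \<open>Positivity of y^2 leaves two ranges: for x < -2 the value \<open>s\<close> is
      negative, and for x > 2/3 it exceeds 8 (2/3)^2 (8/3) = 256/27.\<close>
    show False
    proof (cases "x < - 2")
      case True
      hence "8 * x\<^sup>2 * (x + 2) < 0" by (intro mult_pos_neg) auto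
      thus False using s assms(2) by simp
    next
      case False
      hence x: "x > 2 / 3" using yp by (auto simp: zero_less_mult_iff)
      hence "x\<^sup>2 > (2 / 3)\<^sup>2" by (intro power_strict_mono) auto
      hence "x\<^sup>2 > 4 / 9" by (simp add: power2_eq_square)
      hence "8 * x\<^sup>2 * (x + 2) > (32 / 9) * (8 / 3)" using x by (intro mult_strict_mono) auto
      thus False using s assms(3) by simp
    qed
  qed
  thus "Im \<zeta> = 0" by (simp add: y_def)
  have "x < - 2 \<or> x > 2" using assms(4) y0 by (auto simp: image_slit_def x_def y_def)
  moreover have "\<not> x > 2"
  proof
    assume "x > 2"
    hence "(x + 2)\<^sup>2 * (x - 2) > 0" by simp
    thus False using re y0 assms(2) by simp
  qed
  ultimately show "Re \<zeta> < - 2" by (simp add: x_def)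
qed

text \<open>A value on a slit has its cube in [-256/27, 0]. That forces \<open>Smap z\<close>, hence
  \<open>z\<close>, hence \<open>Pmap z\<close> to be real; but the slits meet the real axis only in
  0, which \<open>Pmap\<close> omits.\<close>

lemma Pmap_notin_slits:
  assumes z: "z \<in> exterior 1"
  shows "Pmap z \<notin> slits 1"
proof
  assume P: "Pmap z \<in> slits 1"
  obtain s where s: "0 \<le> s" "s \<le> 256 / 27" "Pmap z ^ 3 = - of_real s" using slits_cube[OF P] .
  have "Im (Smap z) = 0"
    using slit_cubic_real_cases(1)[of "Smap z" s] s Pmap_cube[OF z] Smap_notin_image_slit[OF z] by simp
  then obtain x where x: "z = of_real x" "\<bar>x\<bar> > 1" using Smap_real[OF z] by metis
  have im: "Im (Pmap z) = 0" using Pmap_of_real(1)[OF x(2)] x(1) by simp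
  obtain r where r: "Pmap z = of_real r * cis (pi / 3) \<or> Pmap z = of_real r * cis (- (pi / 3))"
    using P mem_slits_iff[of 1] by auto
  hence "r = 0" using im by (auto simp: sin_60)
  thus False using r Pmap_nonzero[OF z] by auto
qed

section \<open>Properness from the cubic\<close>

text \<open>Bounded preimages of bounded sets suffice: a convergent sequence of images then comes
  from a bounded sequence, which has a subsequence converging inside the closed set
  \<open>C\<close>.\<close>

lemma closed_image_proper:
  fixes f :: "'a::heine_borel \<Rightarrow> 'b::metric_space"
  assumes "closed C" "continuous_on C f" and bdd: "\<And>B. bounded B \<Longrightarrow> bounded {x \<in> C. f x \<in> B}"
  shows "closed (f ` C)"
  unfolding closed_sequential_limits
proof (intro allI impI, elim conjE)
  fix y l assume y: "\<forall>n. y n \<in> f ` C" and lim: "y \<longlonglongrightarrow> l"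
  have "\<exists>x. \<forall>n. x n \<in> C \<and> y n = f (x n)" using y by (intro choice) blast
  then obtain x where x: "\<And>n. x n \<in> C" "\<And>n. y n = f (x n)" by blast
  have "bounded (range y)" using lim convergent_imp_bounded by blast
  hence "bounded {a \<in> C. f a \<in> range y}" by (rule bdd)
  moreover have "range x \<subseteq> {a \<in> C. f a \<in> range y}" using x by (auto intro: rangeI)
  ultimately have "bounded (range x)" by (rule bounded_subset)
  then obtain a r where r: "strict_mono (r :: nat \<Rightarrow> nat)" "(x \<circ> r) \<longlonglongrightarrow> a"
    using bounded_imp_convergent_subsequence by blast
  have a: "a \<in> C" using assms(1) r x unfolding closed_sequential_limits by (metis comp_apply)
  have "(\<lambda>n. f ((x \<circ> r) n)) \<longlonglongrightarrow> f a"
    using x by (intro continuous_on_tendsto_compose[OF assms(2) r(2) a]) auto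
  moreover have "(\<lambda>n. f ((x \<circ> r) n)) = y \<circ> r" using x by (auto simp: fun_eq_iff)
  ultimately have "f a = l" using lim r by (metis LIMSEQ_subseq_LIMSEQ LIMSEQ_unique)
  thus "l \<in> f ` C" using a by auto
qed

text \<open>Each of the three linear factors of the cubic has norm within \<open>2 * e\<close> of
  that of \<zeta>. No branch enters, so one estimate controls the slit map at infinity and, in the
  other direction, its inverse.\<close>

lemma slit_cubic_norm_bounds:
  assumes "e \<ge> 0" "w ^ 3 = slit_cubic e \<zeta>"
  shows "norm w \<le> norm \<zeta> + 2 * e" "norm \<zeta> \<le> norm w + 2 * e"
proof -
  have e: "norm (2 * complex_of_real e) = 2 * e" using assms(1) by (simp add: norm_mult)
  have n: "norm w ^ 3 = norm (\<zeta> + 2 * of_real e) ^ 2 * norm (\<zeta> - 2 * of_real e)"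
    using assms(2) by (metis norm_mult norm_power slit_cubic_def)
  have up: "norm (\<zeta> + 2 * of_real e) \<le> norm \<zeta> + 2 * e" "norm (\<zeta> - 2 * of_real e) \<le> norm \<zeta> + 2 * e"
    using norm_triangle_ineq[of \<zeta> "2 * of_real e"] norm_triangle_ineq4[of \<zeta> "2 * of_real e"] e by simp_all
  have lo: "norm \<zeta> - 2 * e \<le> norm (\<zeta> + 2 * of_real e)" "norm \<zeta> - 2 * e \<le> norm (\<zeta> - 2 * of_real e)"
    using norm_diff_ineq[of \<zeta> "2 * of_real e"] norm_triangle_ineq2[of \<zeta> "2 * of_real e"] e by simp_all
  have "norm w ^ 3 \<le> (norm \<zeta> + 2 * e) ^ 2 * (norm \<zeta> + 2 * e)"
    unfolding n using up assms(1) by (intro mult_mono power_mono) auto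
  hence "norm w ^ 3 \<le> (norm \<zeta> + 2 * e) ^ 3" by (simp add: power3_eq_cube power2_eq_square)
  thus "norm w \<le> norm \<zeta> + 2 * e" using assms(1) by (simp add: power_mono_iff)
  show "norm \<zeta> \<le> norm w + 2 * e"
  proof (cases "norm \<zeta> - 2 * e \<ge> 0")
    case True
    have "(norm \<zeta> - 2 * e) ^ 2 * (norm \<zeta> - 2 * e) \<le> norm w ^ 3"
      unfolding n using lo True by (intro mult_mono power_mono) auto
    hence "(norm \<zeta> - 2 * e) ^ 3 \<le> norm w ^ 3" by (simp add: power3_eq_cube power2_eq_square)
    hence "norm \<zeta> - 2 * e \<le> norm w" using True by (simp add: power_mono_iff)
    thus ?thesis by simp
  qed (use norm_ge_zero[of w] in linarith)
qed

section \<open>The image of P\<close>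

text \<open>The two slits lie in opposite closed half planes and meet only at 0, so together they
  form an arc, and an arc does not separate the plane.\<close>

lemma connected_compl_slits: "connected (- slits 1)"
proof -
  have nz: "upper_tip 1 \<noteq> 0" "lower_tip 1 \<noteq> 0"
    using slit_length_cube by (auto simp: upper_tip_def lower_tip_def)
  have l: "slit_length > 0" using slit_length_cube by simp
  have "arc (linepath (upper_tip 1) 0 +++ linepath 0 (lower_tip 1))"
  proof (rule arc_join)
    show "path_image (linepath (upper_tip 1) 0) \<inter> path_image (linepath 0 (lower_tip 1))
        \<subseteq> {pathstart (linepath 0 (lower_tip 1))}"
    proof
      fix x assume "x \<in> path_image (linepath (upper_tip 1) 0) \<inter> path_image (linepath 0 (lower_tip 1))"
      hence "x \<in> closed_segment 0 (upper_tip 1)" "x \<in> closed_segment 0 (lower_tip 1)"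
        by (auto simp: closed_segment_commute)
      then obtain u v where uv: "0 \<le> u" "0 \<le> v" "x = u *\<^sub>R upper_tip 1" "x = v *\<^sub>R lower_tip 1"
        by (auto simp: in_segment)
      have "Im x \<ge> 0" unfolding uv(3) using uv(1) l by (simp add: upper_tip_def sin_60)
      moreover have "Im x = - (v * (slit_length * (sqrt 3 / 2)))"
        unfolding uv(4) by (simp add: lower_tip_def sin_60)
      ultimately have "v * (slit_length * (sqrt 3 / 2)) \<le> 0" by simp
      hence "v = 0" using uv(2) l by (simp add: mult_le_0_iff)
      thus "x \<in> {pathstart (linepath 0 (lower_tip 1))}" using uv by simp
    qed
  qed (use nz in auto)
  hence "connected (- path_image (linepath (upper_tip 1) 0 +++ linepath 0 (lower_tip 1)))"
    by (rule connected_arc_complement) simp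
  moreover have "path_image (linepath (upper_tip 1) 0 +++ linepath 0 (lower_tip 1)) = slits 1"
    by (simp add: path_image_join slits_def closed_segment_commute)
  ultimately show ?thesis by simp
qed

lemma image_slit_cubic:
  assumes "\<zeta> \<in> image_slit 1"
  obtains s where "0 \<le> s" "s \<le> 256 / 27" "slit_cubic 1 \<zeta> = - of_real s"
proof -
  define x where "x = Re \<zeta>"
  have x: "\<zeta> = of_real x" "- 2 \<le> x" "x \<le> 2"
    using assms by (auto simp: image_slit_def x_def complex_eq_iff)
  define s where "s = (x + 2)\<^sup>2 * (2 - x)"
  \<comment> \<open>This product is 256/27 - s. The maximum of \<open>s\<close> at x = 2/3 is the
    double root, and -10/3 is the remaining one.\<close>
  have "(x - 2 / 3)\<^sup>2 * (x + 10 / 3) \<ge> 0" using x by simp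
  hence "s \<le> 256 / 27" by (simp add: s_def power2_eq_square algebra_simps)
  moreover have "s \<ge> 0" using x by (simp add: s_def)
  moreover have "slit_cubic 1 \<zeta> = - of_real s"
    unfolding x(1) s_def slit_cubic_def by (simp add: algebra_simps)
  ultimately show thesis using that by blast
qed

lemma isCont_slit_cubic: "isCont (slit_cubic e) \<zeta>"
  unfolding slit_cubic_def by (intro continuous_intros)

lemma holomorphic_isCont: "f holomorphic_on S \<Longrightarrow> open S \<Longrightarrow> x \<in> S \<Longrightarrow> isCont f x"
  by (meson continuous_on_eq_continuous_at holomorphic_on_imp_continuous_on)

text \<open>The image is open and closed in the connected complement of the slits. By the cubic relation, a
  limit of boundary values off the slits can only be a negative real number, and those are values of
  \<open>Pmap\<close> on the real axis.\<close>

lemma Pmap_image: "Pmap ` exterior 1 = - slits 1"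
proof -
  let ?I = "Pmap ` exterior 1"
  obtain Sinv where Sinv: "Sinv holomorphic_on Smap ` exterior 1"
    "\<And>z. z \<in> exterior 1 \<Longrightarrow> Sinv (Smap z) = z"
    using holomorphic_has_inverse[OF holomorphic_Smap open_exterior inj_on_Smap] by metis
  have SI: "Smap ` exterior 1 = - image_slit 1" using bij_betw_Smap by (simp add: bij_betw_def)
  have oS: "open (- image_slit 1)" 
    unfolding SI[symmetric] by (rule open_mapping_thm3[OF holomorphic_Smap open_exterior inj_on_Smap])
  have oI: "open ?I" by (rule open_mapping_thm3[OF holomorphic_Pmap open_exterior inj_on_Pmap])
  have sub: "?I \<subseteq> - slits 1" using Pmap_notin_slits by auto
  have "closedin (top_of_set (- slits 1)) ?I"
    unfolding closedin_limpt
  proof (intro conjI sub allI impI, elim conjE)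
    fix l assume "l islimpt ?I" and l: "l \<in> - slits 1"
    then obtain w where w: "\<forall>n. w n \<in> ?I" and lim: "w \<longlonglongrightarrow> l"
      unfolding islimpt_sequential by auto
    have "\<exists>z. \<forall>n. z n \<in> exterior 1 \<and> w n = Pmap (z n)" using w by (intro choice) blast
    then obtain z where z: "\<And>n. z n \<in> exterior 1" "\<And>n. w n = Pmap (z n)" by blast
    \<comment> \<open>Limits are taken of the points \<open>Smap (z n)\<close> and not of
      \<open>z n\<close>. The cubic is continuous on the whole plane, so the limit may fall on the
      image slit without any boundary value of \<open>Pmap\<close> being needed.\<close>
    define \<zeta> where "\<zeta> n = Smap (z n)" for n
    have cub: "w n ^ 3 = slit_cubic 1 (\<zeta> n)" for n using Pmap_cube z by (simp add: \<zeta>_def)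
    obtain B where B: "\<And>n. norm (w n) \<le> B"
      using lim convergent_imp_bounded[of w] by (auto simp: bounded_iff)
    have "norm (\<zeta> n) \<le> B + 2" for n
      using slit_cubic_norm_bounds(2)[of 1 "w n" "\<zeta> n"] cub[of n] B[of n] by simp
    hence "bounded (range \<zeta>)" by (auto simp: bounded_iff)
    then obtain \<xi> r where r: "strict_mono (r :: nat \<Rightarrow> nat)" "(\<zeta> \<circ> r) \<longlonglongrightarrow> \<xi>"
      using bounded_imp_convergent_subsequence by blast
    have wr: "(\<lambda>n. w (r n)) \<longlonglongrightarrow> l" using LIMSEQ_subseq_LIMSEQ[OF lim r(1)] by (simp add: o_def)
    have "(\<lambda>n. slit_cubic 1 (\<zeta> (r n))) \<longlonglongrightarrow> slit_cubic 1 \<xi>"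
      using isCont_tendsto_compose[OF isCont_slit_cubic r(2)] by (simp add: o_def)
    moreover have "(\<lambda>n. w (r n) ^ 3) \<longlonglongrightarrow> l ^ 3" by (intro tendsto_intros wr)
    ultimately have l3: "l ^ 3 = slit_cubic 1 \<xi>" unfolding cub by (rule LIMSEQ_unique[rotated])
    show "l \<in> ?I"
    proof (cases "\<xi> \<in> image_slit 1")
      case True
      obtain s where "0 \<le> s" "s \<le> 256 / 27" "slit_cubic 1 \<xi> = - of_real s" using image_slit_cubic[OF True] .
      then obtain t where t: "t > 0" "l = - of_real t" using cube_nonpos_cases[of l s] l3 l by auto
      obtain x where "\<bar>x\<bar> > 1" "Pmap (of_real x) = of_real (- t)"
        using Pmap_real_surj[of "- t"] t by auto
      thus ?thesis using t by (intro image_eqI[of _ _ "of_real x"]) (auto simp: exterior_def)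
    next
      case False
      then obtain y where y: "y \<in> exterior 1" "Smap y = \<xi>" by (rule Smap_surj)
      have "isCont Sinv \<xi>" using Sinv(1) False oS unfolding SI by (auto intro: holomorphic_isCont)
      hence "(\<lambda>n. Sinv ((\<zeta> \<circ> r) n)) \<longlonglongrightarrow> Sinv \<xi>" using r(2) by (rule isCont_tendsto_compose)
      hence zy: "(\<lambda>n. z (r n)) \<longlonglongrightarrow> y" using Sinv(2) z y by (auto simp: \<zeta>_def)
      have "isCont Pmap y" using holomorphic_Pmap open_exterior y(1) by (rule holomorphic_isCont)
      hence "(\<lambda>n. w (r n)) \<longlonglongrightarrow> Pmap y" unfolding z(2) using zy by (rule isCont_tendsto_compose)
      hence "l = Pmap y" using wr LIMSEQ_unique by blast
      thus ?thesis using y by blast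
    qed
  qed
  moreover have "openin (top_of_set (- slits 1)) ?I" using oI sub by (simp add: openin_open_eq open_subset)
  moreover have "?I \<noteq> {}" by (auto simp: exterior_def intro!: exI[of _ 2])
  ultimately show ?thesis using connected_compl_slits unfolding connected_clopen by blast
qed

lemma bij_betw_Pmap: "bij_betw Pmap (exterior 1) (- slits 1)"
  using Pmap_image inj_on_Pmap by (simp add: bij_betw_def)

section \<open>Scaling to general \<epsilon>\<close>

lemma rescale_eq: "rescale e f = (\<lambda>z. of_real e * z) \<circ> f \<circ> (\<lambda>z. z / of_real e)"
  by (simp add: rescale_def fun_eq_iff)

lemma exterior_rescale_iff: "e > 0 \<Longrightarrow> z / of_real e \<in> exterior 1 \<longleftrightarrow> z \<in> exterior e"
  by (simp add: exterior_def norm_divide less_divide_eq)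

lemma slits_rescale_iff: "e > 0 \<Longrightarrow> z / of_real e \<in> slits 1 \<longleftrightarrow> z \<in> slits e"
proof -
  assume e: "e > 0"
  have "z / of_real e = of_real r * c \<longleftrightarrow> z = of_real (e * r) * c" for r c
    using e by (auto simp: field_simps)
  moreover
  have "(\<exists>r\<in>{0..1 * slit_length}. P (e * r)) \<longleftrightarrow> (\<exists>r\<in>{0..e * slit_length}. P r)" for P
  proof
    assume "\<exists>r\<in>{0..e * slit_length}. P r"
    then obtain r where "0 \<le> r" "r \<le> e * slit_length" "P r" by auto
    thus "\<exists>r\<in>{0..1 * slit_length}. P (e * r)" using e
      by (intro bexI[of _ "r / e"]) (auto simp: field_simps)
  qed (use e in force)
  note this[of "\<lambda>r. z = of_real r * cis (pi / 3) \<or> z = of_real r * cis (- (pi / 3))"]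
  ultimately show ?thesis unfolding mem_slits_iff[OF e] mem_slits_iff[OF zero_less_one] by simp
qed

lemma image_slit_rescale_iff: "e > 0 \<Longrightarrow> z / of_real e \<in> image_slit 1 \<longleftrightarrow> z \<in> image_slit e"
  by (auto simp: image_slit_def field_simps)

lemma bij_betw_rescale:
  assumes e: "e > 0" and f: "bij_betw f (exterior 1) (- T)"
    and T: "\<And>z. z / of_real e \<in> T \<longleftrightarrow> z \<in> T'"
  shows "bij_betw (rescale e f) (exterior e) (- T')"
  unfolding rescale_eq
proof (intro bij_betw_trans)
  show "bij_betw (\<lambda>z. z / of_real e) (exterior e) (exterior 1)"
    by (rule bij_betwI[where g = "\<lambda>z. z * of_real e"])
      (use e exterior_rescale_iff[OF e] in \<open>auto simp: exterior_def norm_mult\<close>)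
  show "bij_betw f (exterior 1) (- T)" by fact
  show "bij_betw ((*) (of_real e)) (- T) (- T')"
    by (rule bij_betwI[where g = "\<lambda>z. z / of_real e"])
      (use e in \<open>auto simp flip: T\<close>)
qed

lemma holomorphic_rescale:
  assumes "e > 0" "f holomorphic_on exterior 1"
  shows "rescale e f holomorphic_on exterior e"
proof -
  have "f \<circ> (\<lambda>z. z / of_real e) holomorphic_on exterior e"
    using assms exterior_rescale_iff
    by (intro holomorphic_on_compose_gen[of _ _ _ "exterior 1"] holomorphic_intros) auto
  thus ?thesis unfolding rescale_def o_def by (intro holomorphic_intros)
qed

lemma slit_maps_riemann:
  assumes "e > 0"
  shows "rescale e Smap holomorphic_on exterior e"
    "bij_betw (rescale e Smap) (exterior e) (- image_slit e)"
    "rescale e Pmap holomorphic_on exterior e"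
    "bij_betw (rescale e Pmap) (exterior e) (- slits e)"
  using assms
  by (intro holomorphic_rescale bij_betw_rescale[OF assms bij_betw_Smap]
      bij_betw_rescale[OF assms bij_betw_Pmap] holomorphic_Smap holomorphic_Pmap
      slits_rescale_iff image_slit_rescale_iff; simp)+

lemma rescale_Pmap_cube:
  assumes "e > 0" "z \<in> exterior e"
  shows "rescale e Pmap z ^ 3 = slit_cubic e (rescale e Smap z)"
proof -
  have "rescale e Pmap z ^ 3 = of_real e ^ 3 * slit_cubic 1 (Smap (z / of_real e))"
    using Pmap_cube exterior_rescale_iff assms by (simp add: rescale_def power_mult_distrib)
  also have "\<dots> = slit_cubic e (rescale e Smap z)"
    by (simp add: slit_cubic_def rescale_def power2_eq_square power3_eq_cube algebra_simps)
  finally show ?thesis .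
qed

section \<open>The composed map and its inverse\<close>

definition unslit_map :: "real \<Rightarrow> complex \<Rightarrow> complex" where
  "unslit_map e \<zeta> = inv_into (- slits e) (slit_map e) \<zeta>"

lemma slit_map_eq: "e > 0 \<Longrightarrow> slit_map e w = rescale e Smap (inv_into (exterior e) (rescale e Pmap) w)"
  by (simp add: slit_map_def)

lemma slit_map_rescale_Pmap:
  assumes "e > 0" "z \<in> exterior e"
  shows "slit_map e (rescale e Pmap z) = rescale e Smap z"
  using assms slit_maps_riemann(4)[OF assms(1)] by (simp add: slit_map_eq bij_betw_def)

lemma holomorphic_inv_into:
  assumes f: "f holomorphic_on S" and S: "open S" and b: "bij_betw f S T"
  shows "inv_into S f holomorphic_on T" "open T"
proof -
  have inj: "inj_on f S" and im: "f ` S = T" using b by (auto simp: bij_betw_def)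
  obtain g where g: "g holomorphic_on f ` S" "\<And>z. z \<in> S \<Longrightarrow> g (f z) = z"
    using holomorphic_has_inverse[OF f S inj] by metis
  have "inv_into S f y = g y" if "y \<in> T" for y using that g(2) inj im by (auto simp: inv_into_f_f)
  thus "inv_into S f holomorphic_on T" using g(1) im by (metis holomorphic_cong)
  show "open T" using open_mapping_thm3[OF f S inj] im by simp
qed

lemma
  assumes e: "e > 0"
  shows bij_betw_slit_map: "bij_betw (slit_map e) (- slits e) (- image_slit e)"
    and holomorphic_slit_map: "slit_map e holomorphic_on - slits e"
    and open_compl_slits: "open (- slits e)"
    and holomorphic_unslit_map: "unslit_map e holomorphic_on - image_slit e"
    and open_compl_image_slit: "open (- image_slit e)"
proof -
  note r = slit_maps_riemann[OF e]
  have eq: "slit_map e = rescale e Smap \<circ> inv_into (exterior e) (rescale e Pmap)"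
    using slit_map_eq[OF e] by (auto simp: fun_eq_iff)
  note i = holomorphic_inv_into[OF r(3) open_exterior r(4)]
  show b: "bij_betw (slit_map e) (- slits e) (- image_slit e)"
    unfolding eq by (rule bij_betw_trans[OF bij_betw_inv_into[OF r(4)] r(2)])
  show h: "slit_map e holomorphic_on - slits e" unfolding eq
    by (rule holomorphic_on_compose_gen[OF i(1) r(1)]) (use bij_betw_inv_into[OF r(4)] in \<open>auto simp: bij_betw_def\<close>)
  show o: "open (- slits e)" by (rule i(2))
  show "unslit_map e holomorphic_on - image_slit e" "open (- image_slit e)"
    using holomorphic_inv_into[OF h o b] by (simp_all add: unslit_map_def[abs_def])
qed

context
  fixes e :: real assumes e: "e > 0"
begin

lemma unslit_slit [simp]: "w \<notin> slits e \<Longrightarrow> unslit_map e (slit_map e w) = w"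
  using bij_betw_slit_map[OF e] by (simp add: unslit_map_def bij_betw_def)

lemma slit_unslit [simp]: "\<zeta> \<notin> image_slit e \<Longrightarrow> slit_map e (unslit_map e \<zeta>) = \<zeta>"
  using bij_betw_slit_map[OF e] by (simp add: unslit_map_def bij_betw_def f_inv_into_f)

lemma slit_map_notin [simp]: "w \<notin> slits e \<Longrightarrow> slit_map e w \<notin> image_slit e"
  using bij_betw_slit_map[OF e] by (auto simp: bij_betw_def)

lemma unslit_map_notin [simp]: "\<zeta> \<notin> image_slit e \<Longrightarrow> unslit_map e \<zeta> \<notin> slits e"
  using bij_betw_slit_map[OF e] inv_into_into[of \<zeta> "slit_map e" "- slits e"]
  by (auto simp: bij_betw_def unslit_map_def)

lemma slit_map_cubic: 
  assumes "w \<notin> slits e"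
  shows "w ^ 3 = slit_cubic e (slit_map e w)"
proof -
  obtain z where "z \<in> exterior e" "w = rescale e Pmap z"
    using slit_maps_riemann(4)[OF e] assms by (auto simp: bij_betw_def)
  thus ?thesis using rescale_Pmap_cube slit_map_rescale_Pmap e by simp
qed

lemma unslit_map_cubic: 
  assumes "\<zeta> \<notin> image_slit e"
  shows "unslit_map e \<zeta> ^ 3 = slit_cubic e \<zeta>"
  using slit_map_cubic[of "unslit_map e \<zeta>"] assms by simp

lemma closed_image_slit_map:
  assumes "closed C" "C \<inter> slits e = {}"
  shows "closed (slit_map e ` C)"
proof (rule closed_image_proper[OF assms(1)])
  show "continuous_on C (slit_map e)"
    by (rule continuous_on_subset[OF holomorphic_on_imp_continuous_on[OF holomorphic_slit_map[OF e]]])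
      (use assms in auto)
next
  fix B :: "complex set" assume "bounded B"
  then obtain b where b: "\<And>x. x \<in> B \<Longrightarrow> norm x \<le> b" by (auto simp: bounded_iff)
  have "norm x \<le> b + 2 * e" if "x \<in> C" "slit_map e x \<in> B" for x
    using slit_cubic_norm_bounds(1)[of e x "slit_map e x"] slit_map_cubic[of x] that b[of "slit_map e x"] assms(2) e
    by force
  thus "bounded {x \<in> C. slit_map e x \<in> B}" by (auto simp: bounded_iff)
qed

lemma closed_image_unslit_map:
  assumes "closed C" "C \<inter> image_slit e = {}"
  shows "closed (unslit_map e ` C)"
proof (rule closed_image_proper[OF assms(1)])
  show "continuous_on C (unslit_map e)"
    by (rule continuous_on_subset[OF holomorphic_on_imp_continuous_on[OF holomorphic_unslit_map[OF e]]])
      (use assms in auto)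
next
  fix B :: "complex set" assume "bounded B"
  then obtain b where b: "\<And>x. x \<in> B \<Longrightarrow> norm x \<le> b" by (auto simp: bounded_iff)
  have "norm x \<le> b + 2 * e" if "x \<in> C" "unslit_map e x \<in> B" for x
    using slit_cubic_norm_bounds(2)[of e "unslit_map e x" x] unslit_map_cubic[of x] that b[of "unslit_map e x"] assms(2) e
    by force
  thus "bounded {x \<in> C. unslit_map e x \<in> B}" by (auto simp: bounded_iff)
qed

end

section \<open>Splitting the double zero\<close>

text \<open>This is minus one third of the derivative of the cubic, factored at its critical points
  so that the zeros can be read off.\<close>

definition pushed_differential :: "real \<Rightarrow> complex \<Rightarrow> complex" where
  "pushed_differential e \<zeta> = - ((\<zeta> - of_real (2 / 3 * e)) * (\<zeta> - of_real (- 2 * e)))"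

lemma holomorphic_pushed_differential: "pushed_differential e holomorphic_on S"
  unfolding pushed_differential_def by (intro holomorphic_intros)

lemma slit_cubic_has_derivative:
  "(slit_cubic e has_field_derivative - 3 * pushed_differential e \<zeta>) (at \<zeta>)"
proof -
  have "(slit_cubic e has_field_derivative
      2 * (\<zeta> + 2 * of_real e) * (\<zeta> - 2 * of_real e) + (\<zeta> + 2 * of_real e)\<^sup>2) (at \<zeta>)"
    unfolding slit_cubic_def by (rule derivative_eq_intros refl | simp)+
  moreover have "2 * (\<zeta> + 2 * of_real e) * (\<zeta> - 2 * of_real e) + (\<zeta> + 2 * of_real e)\<^sup>2
      = - 3 * pushed_differential e \<zeta>"
    by (simp add: pushed_differential_def power2_eq_square field_simps)
  ultimately show ?thesis by simp
qed

text \<open>The function w^3 is differentiated once by the power rule and once through the cubic,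
  and the results are compared. The identity is kept in product form, as the transformation law and
  the substitution in the norm integral need it.\<close>

lemma slit_map_pullback:
  assumes e: "e > 0" and w: "w \<notin> slits e"
  shows "pushed_differential e (slit_map e w) * deriv (slit_map e) w = - w\<^sup>2"
proof -
  have d: "(slit_map e has_field_derivative deriv (slit_map e) w) (at w)"
    using holomorphic_derivI[OF holomorphic_slit_map[OF e] open_compl_slits[OF e]] w by simp
  have "((\<lambda>w. w ^ 3) has_field_derivative - 3 * pushed_differential e (slit_map e w) * deriv (slit_map e) w) (at w)"
    by (rule has_field_derivative_transform_within_open[OF DERIV_chain2[OF slit_cubic_has_derivative d]
          open_compl_slits[OF e]])
      (use w slit_map_cubic[OF e] in auto)
  moreover have "((\<lambda>w. w ^ 3) has_field_derivative 3 * w\<^sup>2) (at w)"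
    by (rule derivative_eq_intros refl | simp)+
  ultimately have "- 3 * pushed_differential e (slit_map e w) * deriv (slit_map e) w = 3 * w\<^sup>2"
    by (rule DERIV_unique)
  hence "- 3 * (pushed_differential e (slit_map e w) * deriv (slit_map e) w) = - 3 * - w\<^sup>2" by simp
  thus ?thesis by (simp only: mult_cancel_left) simp
qed

text \<open>The same comparison in the variable \<zeta>. This is literally the pushforward of
  \<open>- w\<^sup>2\<close> by the slit map, and it determines the deformed differential in the
  filled chart.\<close>

lemma unslit_map_pullback:
  assumes e: "e > 0" and \<zeta>: "\<zeta> \<notin> image_slit e"
  shows "- (unslit_map e \<zeta>)\<^sup>2 * deriv (unslit_map e) \<zeta> = pushed_differential e \<zeta>"
proof -
  have d: "(unslit_map e has_field_derivative deriv (unslit_map e) \<zeta>) (at \<zeta>)"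
    using holomorphic_derivI[OF holomorphic_unslit_map[OF e] open_compl_image_slit[OF e]] \<zeta> by simp
  have "((\<lambda>\<zeta>. unslit_map e \<zeta> ^ 3) has_field_derivative 3 * (unslit_map e \<zeta>)\<^sup>2 * deriv (unslit_map e) \<zeta>) (at \<zeta>)"
    by (rule derivative_eq_intros d refl | simp)+
  hence "(slit_cubic e has_field_derivative 3 * (unslit_map e \<zeta>)\<^sup>2 * deriv (unslit_map e) \<zeta>) (at \<zeta>)"
    by (rule has_field_derivative_transform_within_open[OF _ open_compl_image_slit[OF e]])
      (use \<zeta> unslit_map_cubic[OF e] in auto)
  from DERIV_unique[OF this slit_cubic_has_derivative]
  have "- 3 * (- (unslit_map e \<zeta>)\<^sup>2 * deriv (unslit_map e) \<zeta>) = - 3 * pushed_differential e \<zeta>" by simp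
  thus ?thesis by (simp only: mult_cancel_left) simp
qed

section \<open>Limits at the slit tips and at the two vertices\<close>

lemma simple_zero_quadratic:
  assumes "a \<noteq> b"
  shows "simple_zero (\<lambda>\<zeta>. - ((\<zeta> - a) * (\<zeta> - b))) a"
proof -
  have "((\<lambda>\<zeta>. - ((\<zeta> - a) * (\<zeta> - b))) \<longlongrightarrow> - ((a - a) * (a - b))) (at a)"
    by (intro tendsto_intros)
  moreover have "eventually (\<lambda>\<zeta>. - ((\<zeta> - a) * (\<zeta> - b)) \<noteq> 0) (at a)"
    unfolding eventually_at using assms
    by (intro exI[of _ "dist a b"]) (auto simp: dist_commute)
  moreover have "zorder (\<lambda>\<zeta>. - ((\<zeta> - a) * (\<zeta> - b))) a = 1"
    by (rule zorder_eqI[where S = UNIV and g = "\<lambda>\<zeta>. - (\<zeta> - b)"])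
      (use assms in \<open>auto intro!: holomorphic_intros simp: algebra_simps\<close>)
  ultimately show ?thesis by (simp add: simple_zero_def isolated_zero_def)
qed

text \<open>At a tip, 2/3 e is a double root of the cubic equation, so w^3 - t^3 = (\<zeta> - a)^2
  (\<zeta> - c). Once \<zeta> stays away from \<open>c\<close>, this bounds the square of the
  distance from \<zeta> to \<open>a\<close>. Only the cube of \<open>t\<close> enters, hence both
  tips are covered at once and share the limit.\<close>

lemma slit_map_tendsto_tip:
  assumes e: "e > 0" and t: "t \<in> slits e" "t ^ 3 = - of_real (256 / 27 * e ^ 3)"
  shows "(slit_map e \<longlongrightarrow> of_real (2 / 3 * e)) (at t within - slits e)"
proof -
  define a where "a = complex_of_real (2 / 3 * e)"
  \<comment> \<open>\<open>c\<close> is the other root of \<open>slit_cubic e \<zeta> = t ^ 3\<close>; lying off the image slit, it is not a limit value at \<open>t\<close>.\<close>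
  define c where "c = complex_of_real (- (10 / 3) * e)"
  have c: "c \<notin> image_slit e" using e by (simp add: c_def image_slit_def)
  define w0 where "w0 = unslit_map e c"
  define d where "d = dist w0 t"
  have d: "d > 0" using unslit_map_notin[OF e c] t(1) by (auto simp: d_def w0_def)
  have factor: "(\<zeta> - a)\<^sup>2 * (\<zeta> - c) = slit_cubic e \<zeta> - t ^ 3" for \<zeta>
  proof -
    have "(\<zeta> - 2 / 3 * E)\<^sup>2 * (\<zeta> + 10 / 3 * E) = (\<zeta> + 2 * E)\<^sup>2 * (\<zeta> - 2 * E) + 256 / 27 * E ^ 3" for E :: complex
      by (simp add: power2_eq_square power3_eq_cube field_simps)
    from this[of "of_real e"] show ?thesis by (simp add: a_def c_def t(2) slit_cubic_def)
  qed
  \<comment> \<open>The root \<open>c\<close> has its own preimage \<open>w0\<close>, distinct from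
    \<open>t\<close>. Values near \<open>c\<close> come only from points near \<open>w0\<close>, and
    those are not near \<open>t\<close>.\<close>
  have "isCont (unslit_map e) c"
    using holomorphic_isCont[OF holomorphic_unslit_map[OF e] open_compl_image_slit[OF e]] c by simp
  then obtain \<eta> where \<eta>: "\<eta> > 0" "\<And>\<zeta>. dist \<zeta> c < \<eta> \<Longrightarrow> dist (unslit_map e \<zeta>) w0 < d / 2"
    unfolding continuous_at_eps_delta w0_def using d half_gt_zero by blast
  have far: "\<eta> \<le> norm (slit_map e w - c)" if "w \<notin> slits e" "dist w t < d / 2" for w
  proof (rule ccontr)
    assume "\<not> \<eta> \<le> norm (slit_map e w - c)"
    hence "dist (unslit_map e (slit_map e w)) w0 < d / 2" using \<eta>(2) by (simp add: dist_norm)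
    hence "dist w w0 < d / 2" using unslit_slit[OF e that(1)] by simp
    thus False using that(2) dist_triangle2[of w0 t w] dist_commute[of w0 w] dist_commute[of t w] d_def by linarith
  qed
  have bound: "norm (slit_map e w - a) \<le> sqrt (norm (w ^ 3 - t ^ 3) / \<eta>)"
    if "w \<notin> slits e" "dist w t < d / 2" for w
  proof -
    have "norm (slit_map e w - a) ^ 2 * \<eta> \<le> norm (slit_map e w - a) ^ 2 * norm (slit_map e w - c)"
      using far[OF that] by (intro mult_left_mono) auto
    also have "\<dots> = norm (w ^ 3 - t ^ 3)"
      using factor[of "slit_map e w"] slit_map_cubic[OF e that(1)] by (simp add: norm_mult[symmetric] norm_power[symmetric])
    finally show ?thesis using \<eta>(1) by (intro real_le_rsqrt) (simp add: field_simps)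
  qed
  have "((\<lambda>w. slit_map e w - a) \<longlongrightarrow> 0) (at t within - slits e)"
  proof (rule Lim_null_comparison)
    show "\<forall>\<^sub>F w in at t within - slits e. norm (slit_map e w - a) \<le> sqrt (norm (w ^ 3 - t ^ 3) / \<eta>)"
      unfolding eventually_at using bound d by (intro exI[of _ "d / 2"]) auto
    have "((\<lambda>w. sqrt (norm (w ^ 3 - t ^ 3) / \<eta>)) \<longlongrightarrow> sqrt (norm (t ^ 3 - t ^ 3) / \<eta>)) (at t within - slits e)"
      using \<eta>(1) by (intro tendsto_intros) auto
    thus "((\<lambda>w. sqrt (norm (w ^ 3 - t ^ 3) / \<eta>)) \<longlongrightarrow> 0) (at t within - slits e)" by simp
  qed
  thus ?thesis unfolding a_def using LIM_zero_iff by blast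
qed

lemma slit_map_of_real:
  assumes e: "e > 0" and y: "y \<noteq> 0"
  obtains \<xi> where "slit_map e (of_real y) = of_real \<xi>" "\<xi> * y > 0" "of_real y \<notin> slits e"
proof -
  obtain x where x: "\<bar>x\<bar> > 1" "x * (y / e) > 0" "Pmap (of_real x) = of_real (y / e)"
    using Pmap_real_surj[of "y / e"] e y by auto
  have z: "complex_of_real (e * x) \<in> exterior e" using x(1) e by (simp add: exterior_def abs_mult norm_mult)
  have P: "rescale e Pmap (of_real (e * x)) = of_real y" using x e by (simp add: rescale_def)
  have "rescale e Smap (of_real (e * x)) = of_real (e * (x + 1 / x))"
    using e by (simp add: rescale_def Smap_def)
  hence "slit_map e (of_real y) = of_real (e * (x + 1 / x))"
    using slit_map_rescale_Pmap[OF e z] P by simp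
  moreover have "e * (x + 1 / x) * y > 0"
    using x(2) e by (auto simp: zero_less_mult_iff zero_less_divide_iff mult_less_0_iff divide_less_0_iff add_pos_pos add_neg_neg)
  moreover have "rescale e Pmap (of_real (e * x)) \<notin> slits e"
    using bij_betwE[OF slit_maps_riemann(4)[OF e]] z by blast
  hence "of_real y \<notin> slits e" unfolding P .
  ultimately show thesis using that by blast
qed

text \<open>Near \<open>0\<close> the cubic confines the values to small discs around the two vertices \<open>\<plusminus>2 * e\<close>;
  connectedness of \<open>U\<close> near \<open>0\<close> and one real point select the disc.\<close>

lemma slit_map_tendsto_vertex:
  assumes e: "e > 0" and U: "convex U" "U \<inter> slits e = {}"
    and \<sigma>: "\<sigma> = 1 \<or> \<sigma> = - 1" "\<And>r. r > 0 \<Longrightarrow> complex_of_real (\<sigma> * r) \<in> U"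
  shows "(slit_map e \<longlongrightarrow> of_real (\<sigma> * (2 * e))) (at 0 within U)"
  unfolding tendsto_iff
proof (intro allI impI)
  fix \<eta>0 :: real assume "\<eta>0 > 0"
  \<comment> \<open>Capping the radius at \<open>2 * e\<close> keeps the two discs disjoint and puts
    their real points on opposite sides of 0, so the sign of \<xi> tells in which disc it
    lies.\<close>
  define \<eta> where "\<eta> = min \<eta>0 (2 * e)"
  have \<eta>: "\<eta> > 0" "\<eta> \<le> \<eta>0" "\<eta> \<le> 2 * e" using e \<open>\<eta>0 > 0\<close> by (auto simp: \<eta>_def)
  let ?B = "ball (of_real (2 * e)) \<eta> :: complex set" and ?B' = "ball (of_real (- (2 * e))) \<eta> :: complex set"
  let ?U = "U \<inter> ball 0 \<eta>"
  \<comment> \<open>Outside both discs each of the three factors of the cubic has norm at least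
    \<eta>, while the norm of w^3 is less than \<eta>^3.\<close>
  have sub: "slit_map e w \<in> ?B \<union> ?B'" if "w \<in> ?U" for w
  proof (rule ccontr)
    assume "slit_map e w \<notin> ?B \<union> ?B'"
    hence "\<eta> \<le> norm (slit_map e w - 2 * of_real e)" "\<eta> \<le> norm (slit_map e w + 2 * of_real e)"
      by (auto simp: dist_norm norm_minus_commute)
    hence "\<eta>\<^sup>2 * \<eta> \<le> norm (slit_map e w + 2 * of_real e) ^ 2 * norm (slit_map e w - 2 * of_real e)"
      using \<eta>(1) by (intro mult_mono power_mono) auto
    also have "\<dots> = norm (w ^ 3)"
    proof -
      have "w \<notin> slits e" using U(2) that by blast
      from slit_map_cubic[OF e this] show ?thesis unfolding slit_cubic_def norm_mult norm_power by (metis norm_mult norm_power)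
    qed
    also have "\<dots> < \<eta> ^ 3" using that \<eta>(1) by (simp add: norm_power power_strict_mono)
    finally show False by (simp add: power2_eq_square power3_eq_cube)
  qed
  have conn: "connected (slit_map e ` ?U)"
  proof (rule connected_continuous_image)
    show "connected ?U" using U by (intro convex_connected convex_Int) auto
    show "continuous_on ?U (slit_map e)"
      by (rule continuous_on_subset[OF holomorphic_on_imp_continuous_on[OF holomorphic_slit_map[OF e]]]) (use U in auto)
  qed
  define y where "y = \<sigma> * (\<eta> / 2)"
  have "complex_of_real y \<in> U" unfolding y_def by (rule \<sigma>(2)) (use \<eta> in simp)
  moreover have y: "y \<noteq> 0" "\<bar>y\<bar> < \<eta>" using \<sigma>(1) \<eta> by (auto simp: y_def abs_mult)
  ultimately have yU: "complex_of_real y \<in> ?U" by simp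
  obtain \<xi> where \<xi>: "slit_map e (of_real y) = of_real \<xi>" "\<xi> * y > 0" using slit_map_of_real[OF e y(1)] by metis
  have disj: "?B \<inter> ?B' = {}"
  proof (rule ccontr)
    assume "?B \<inter> ?B' \<noteq> {}"
    then obtain p where "dist (complex_of_real (2 * e)) p < \<eta>" "dist (of_real (- (2 * e))) p < \<eta>" by auto
    hence "dist (complex_of_real (2 * e)) (of_real (- (2 * e))) < 2 * \<eta>"
      using dist_triangle2[of "complex_of_real (2 * e)" "of_real (- (2 * e))" p] by linarith
    moreover have "dist (complex_of_real (2 * e)) (of_real (- (2 * e))) = 4 * e"
      unfolding dist_of_real using e by (simp add: dist_real_def)
    ultimately show False using \<eta>(3) by simp
  qed
  have \<sigma>\<xi>: "\<sigma> * \<xi> > 0" using \<xi>(2) \<sigma>(1) \<eta>(1) by (auto simp: y_def mult_less_0_iff zero_less_mult_iff)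
  have pt: "of_real \<xi> \<in> ball (complex_of_real (\<sigma> * (2 * e))) \<eta>"
  proof -
    have "complex_of_real \<xi> \<in> ?B \<union> ?B'" using sub[OF yU] \<xi>(1) by simp
    hence "dist (2 * e) \<xi> < \<eta> \<or> dist (- (2 * e)) \<xi> < \<eta>" by (simp only: Un_iff mem_ball dist_of_real)
    hence "dist (\<sigma> * (2 * e)) \<xi> < \<eta>" using \<sigma>(1) \<sigma>\<xi> \<eta>(3) by (auto simp: dist_real_def)
    thus ?thesis by (simp only: mem_ball dist_of_real)
  qed
  have "slit_map e ` ?U \<subseteq> ball (complex_of_real (\<sigma> * (2 * e))) \<eta>"
  proof (rule ccontr)
    assume n: "\<not> ?thesis"
    have "?B \<inter> ?B' \<inter> slit_map e ` ?U = {}" using disj by blast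
    moreover have s: "slit_map e ` ?U \<subseteq> ?B \<union> ?B'" using sub by blast
    ultimately have d:  "?B \<inter> slit_map e ` ?U = {} \<or> ?B' \<inter> slit_map e ` ?U = {}"
      by (rule connectedD[OF conn open_ball open_ball])
    have p: "of_real \<xi> \<in> slit_map e ` ?U" using \<xi>(1) yU by (metis imageI)
    have "ball (complex_of_real (\<sigma> * (2 * e))) \<eta> = ?B \<or> ball (complex_of_real (\<sigma> * (2 * e))) \<eta> = ?B'"
      using \<sigma>(1) by auto
    thus False using d n pt p s by blast
  qed
  hence "dist (slit_map e w) (of_real (\<sigma> * (2 * e))) < \<eta>" if "w \<in> ?U" for w
    using that by (metis dist_commute image_subset_iff mem_ball)
  thus "\<forall>\<^sub>F x in at 0 within U. dist (slit_map e x) (of_real (\<sigma> * (2 * e))) < \<eta>0"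
    unfolding eventually_at using \<eta> by (intro exI[of _ \<eta>]) (fastforce simp: dist_commute)
qed

text \<open>The two linear forms vanish on the lines carrying the slits. Their signs replace
  conditions on \<open>Arg\<close> by half planes, which supply the convex sets required by
  \<open>slit_map_tendsto_vertex\<close>.\<close>

lemma sector_coordinates:
  "sqrt 3 * Re w - Im w = 2 * norm w * sin (pi / 3 - Arg w)"
  "sqrt 3 * Re w + Im w = 2 * norm w * sin (pi / 3 + Arg w)"
proof -
  have w: "w = of_real (norm w) * cis (Arg w)" using rcis_cmod_Arg[of w] by (simp add: rcis_def)
  have "Re w = norm w * cos (Arg w)" "Im w = norm w * sin (Arg w)"
    by (subst (1) w; simp)+
  thus "sqrt 3 * Re w - Im w = 2 * norm w * sin (pi / 3 - Arg w)"
    "sqrt 3 * Re w + Im w = 2 * norm w * sin (pi / 3 + Arg w)"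
    by (simp_all add: sin_diff sin_add sin_60 cos_60 algebra_simps)
qed

lemma convex_sector_halfplanes:
  "convex {w. sqrt 3 * Re w - Im w > 0}" "convex {w. sqrt 3 * Re w + Im w > 0}"
  "convex {w. sqrt 3 * Re w - Im w < 0}" "convex {w. sqrt 3 * Re w + Im w < 0}"
  using convex_halfspace_gt[of 0 "Complex (sqrt 3) (- 1)"] convex_halfspace_gt[of 0 "Complex (sqrt 3) 1"]
    convex_halfspace_lt[of "Complex (sqrt 3) (- 1)" 0] convex_halfspace_lt[of "Complex (sqrt 3) 1" 0]
  by (simp_all add: inner_complex_def)

lemma slits_coordinates:
  assumes "e > 0" "w \<in> slits e"
  shows "sqrt 3 * Re w - Im w \<ge> 0" "sqrt 3 * Re w + Im w \<ge> 0"
    "sqrt 3 * Re w - Im w = 0 \<or> sqrt 3 * Re w + Im w = 0"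
proof -
  obtain r where "r \<ge> 0" "w = of_real r * cis (pi / 3) \<or> w = of_real r * cis (- (pi / 3))"
    using assms mem_slits_iff by auto
  thus "sqrt 3 * Re w - Im w \<ge> 0" "sqrt 3 * Re w + Im w \<ge> 0"
    "sqrt 3 * Re w - Im w = 0 \<or> sqrt 3 * Re w + Im w = 0"
    by (auto simp: sin_60 cos_60)
qed

lemma slit_map_tendsto_narrow:
  assumes e: "e > 0"
  shows "(slit_map e \<longlongrightarrow> of_real (2 * e)) (at 0 within narrow_sector)"
proof -
  let ?U = "{w. sqrt 3 * Re w - Im w > 0} \<inter> {w. sqrt 3 * Re w + Im w > 0}"
  have "(slit_map e \<longlongrightarrow> of_real (1 * (2 * e))) (at 0 within ?U)"
  proof (rule slit_map_tendsto_vertex[OF e])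
    show "convex ?U" by (intro convex_Int convex_sector_halfplanes)
    show "?U \<inter> slits e = {}" using slits_coordinates(3)[OF e] by fastforce
  qed auto
  moreover have "narrow_sector \<subseteq> ?U"
    by (auto simp: narrow_sector_def sector_coordinates intro!: mult_pos_pos sin_gt_zero)
  ultimately have "(slit_map e \<longlongrightarrow> of_real (1 * (2 * e))) (at 0 within narrow_sector)"
    by (rule tendsto_within_subset)
  thus ?thesis by simp
qed

text \<open>The wide sector is not convex, but it is covered by two open half planes. Each of them
  avoids the slits and contains the negative axis, so both give the same limit.\<close>

lemma slit_map_tendsto_wide:
  assumes e: "e > 0"
  shows "(slit_map e \<longlongrightarrow> of_real (- 2 * e)) (at 0 within wide_sector)"
proof -
  let ?U = "{w. sqrt 3 * Re w - Im w < 0}" and ?V = "{w. sqrt 3 * Re w + Im w < 0}"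
  have 1: "(slit_map e \<longlongrightarrow> of_real (- 1 * (2 * e))) (at 0 within ?U)"
  proof (rule slit_map_tendsto_vertex[OF e])
    show "convex ?U" by (rule convex_sector_halfplanes)
    show "?U \<inter> slits e = {}" using slits_coordinates(1,2)[OF e] by fastforce
  qed auto
  have 2: "(slit_map e \<longlongrightarrow> of_real (- 1 * (2 * e))) (at 0 within ?V)"
  proof (rule slit_map_tendsto_vertex[OF e])
    show "convex ?V" by (rule convex_sector_halfplanes)
    show "?V \<inter> slits e = {}" using slits_coordinates(1,2)[OF e] by fastforce
  qed auto
  have 3: "wide_sector \<subseteq> ?U \<union> ?V"
  proof
    fix w assume "w \<in> wide_sector"
    hence w: "norm w > 0" "Arg w > pi / 3 \<or> Arg w < - (pi / 3)" by (auto simp: wide_sector_def)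
    have a: "- pi < Arg w" "Arg w \<le> pi" using Arg_bounded by auto
    from w(2) show "w \<in> ?U \<union> ?V"
    proof
      assume "Arg w > pi / 3"
      hence "sin (- (pi / 3 - Arg w)) > 0" using a by (intro sin_gt_zero) auto
      hence "sin (pi / 3 - Arg w) < 0" by (simp only: sin_minus)
      thus ?thesis using w(1) by (simp add: sector_coordinates mult_less_0_iff)
    next
      assume "Arg w < - (pi / 3)"
      hence "sin (- (pi / 3 + Arg w)) > 0" using a by (intro sin_gt_zero) auto
      hence "sin (pi / 3 + Arg w) < 0" by (simp only: sin_minus)
      thus ?thesis using w(1) by (simp add: sector_coordinates mult_less_0_iff)
    qed
  qed
  have "(slit_map e \<longlongrightarrow> of_real (- 1 * (2 * e))) (at 0 within wide_sector)"
    by (rule tendsto_within_subset[OF iffD2[OF Lim_within_Un conjI[OF 1 2]] 3])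
  thus ?thesis by simp
qed

lemma slit_tips:
  assumes "e > 0"
  shows "upper_tip e \<in> slits e" "lower_tip e \<in> slits e"
    "upper_tip e ^ 3 = - of_real (256 / 27 * e ^ 3)" "lower_tip e ^ 3 = - of_real (256 / 27 * e ^ 3)"
proof -
  show "upper_tip e \<in> slits e" "lower_tip e \<in> slits e" by (auto simp: slits_def)
  have "complex_of_real (e * slit_length) ^ 3 = of_real (256 / 27 * e ^ 3)"
    unfolding of_real_power[symmetric] power_mult_distrib slit_length_cube by (simp add: mult.commute)
  thus "upper_tip e ^ 3 = - of_real (256 / 27 * e ^ 3)" "lower_tip e ^ 3 = - of_real (256 / 27 * e ^ 3)"
    unfolding upper_tip_def lower_tip_def power_mult_distrib cis_third_cube by simp_all
qed

theorem slit_map_splits_zero: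
  assumes e: "e > 0"
  shows "\<exists>g a b c. g holomorphic_on UNIV \<and>
        (\<forall>\<zeta>\<in>- image_slit e. g \<zeta> = pushforward (- slits e) (slit_map e) (\<lambda>w. - w\<^sup>2) \<zeta>) \<and>
        (slit_map e \<longlongrightarrow> a) (at 0 within narrow_sector) \<and> g a \<noteq> 0 \<and>
        (slit_map e \<longlongrightarrow> b) (at (upper_tip e) within - slits e) \<and>
        (slit_map e \<longlongrightarrow> b) (at (lower_tip e) within - slits e) \<and> simple_zero g b \<and>
        (slit_map e \<longlongrightarrow> c) (at 0 within wide_sector) \<and> simple_zero g c \<and>
        {\<zeta>. g \<zeta> = 0} = {b, c} \<and> dist b c = 8 / 3 * e"
proof (intro exI conjI)
  let ?b = "complex_of_real (2 / 3 * e)" and ?c = "complex_of_real (- 2 * e)"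
  have bc: "?b \<noteq> ?c" using e unfolding of_real_eq_iff by simp
  show "pushed_differential e holomorphic_on UNIV" by (rule holomorphic_pushed_differential)
  show "\<forall>\<zeta>\<in>- image_slit e. pushed_differential e \<zeta> = pushforward (- slits e) (slit_map e) (\<lambda>w. - w\<^sup>2) \<zeta>"
    using unslit_map_pullback[OF e] by (simp add: pushforward_def unslit_map_def[abs_def])
  show "(slit_map e \<longlongrightarrow> of_real (2 * e)) (at 0 within narrow_sector)" by (rule slit_map_tendsto_narrow[OF e])
  show "pushed_differential e (of_real (2 * e)) \<noteq> 0" using e
    unfolding pushed_differential_def of_real_diff[symmetric] by simp
  show "(slit_map e \<longlongrightarrow> ?b) (at (upper_tip e) within - slits e)"
    "(slit_map e \<longlongrightarrow> ?b) (at (lower_tip e) within - slits e)"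
    using slit_map_tendsto_tip[OF e] slit_tips[OF e] by blast+
  show "simple_zero (pushed_differential e) ?b"
    using simple_zero_quadratic[OF bc] by (simp only: pushed_differential_def[abs_def])
  show "(slit_map e \<longlongrightarrow> ?c) (at 0 within wide_sector)" by (rule slit_map_tendsto_wide[OF e])
  show "simple_zero (pushed_differential e) ?c"
    using simple_zero_quadratic[OF bc[symmetric]]
    by (simp only: pushed_differential_def[abs_def] mult.commute[of "_ - ?c"])
  show "{\<zeta>. pushed_differential e \<zeta> = 0} = {?b, ?c}"
    by (simp only: pushed_differential_def neg_equal_0_iff_equal mult_eq_0_iff right_minus_eq) blast
  show "dist ?b ?c = 8 / 3 * e" unfolding dist_of_real using e by (simp add: dist_real_def)
qed

section \<open>The variation cocycles\<close>

text \<open>Homogeneity reduces the whole family to the single map with parameter 1: letting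
  \<epsilon> tend to 0 at fixed \<open>w\<close> means approaching infinity for
  \<open>slit_map 1\<close>.\<close>

lemma slit_map_scaling:
  assumes e: "\<epsilon> > 0" and w: "w \<notin> slits \<epsilon>"
  shows "slit_map \<epsilon> w = of_real \<epsilon> * slit_map 1 (w / of_real \<epsilon>)"
proof -
  obtain z where z: "z \<in> exterior \<epsilon>" "w = rescale \<epsilon> Pmap z"
    using slit_maps_riemann(4)[OF e] w by (auto simp: bij_betw_def)
  have z1: "z / of_real \<epsilon> \<in> exterior 1" using exterior_rescale_iff[OF e] z(1) by simp
  have r1: "rescale 1 f = f" for f by (simp add: rescale_def fun_eq_iff)
  have "slit_map 1 (Pmap (z / of_real \<epsilon>)) = Smap (z / of_real \<epsilon>)"
    using slit_map_rescale_Pmap[OF zero_less_one z1] unfolding r1 .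
  moreover have "w / of_real \<epsilon> = Pmap (z / of_real \<epsilon>)" using z(2) e by (simp add: rescale_def)
  moreover have "slit_map \<epsilon> w = rescale \<epsilon> Smap z" using slit_map_rescale_Pmap[OF e z(1)] z(2) by simp
  ultimately show ?thesis by (simp add: rescale_def)
qed

lemma slits_norm_le:
  assumes "\<epsilon> > 0" "w \<in> slits \<epsilon>"
  shows "norm w \<le> \<epsilon> * slit_length"
  using assms mem_slits_iff by (auto simp: norm_mult)

text \<open>In the coordinate \<open>u = \<epsilon> / w\<close> the family is \<open>w * h u\<close> for a single holomorphic germ \<open>h\<close>.\<close>

lemma slit_map_germ:
  obtains s h where "s > 0" "h holomorphic_on ball 0 s" "h 0 = 1"
    "\<And>u. u \<in> ball 0 s \<Longrightarrow> (h u + 2 * u)\<^sup>2 * (h u - 2 * u) = 1"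
    "\<And>\<epsilon> w. 0 \<le> \<epsilon> \<Longrightarrow> \<epsilon> < s * norm w \<Longrightarrow> slit_map \<epsilon> w = w * h (of_real \<epsilon> / w)"
proof -
  \<comment> \<open>For 0 < norm u < s the point \<open>1 / u\<close> is farther from 0 than the
    slit tips, so \<open>slit_map 1\<close> is holomorphic there.\<close>
  define s where "s = 1 / slit_length"
  have s: "s > 0" using slit_length_cube by (simp add: s_def)
  define k where "k u = u * slit_map 1 (1 / u)" for u
  have off: "1 / u \<notin> slits 1" if "u \<in> ball 0 s - {0}" for u
  proof
    assume "1 / u \<in> slits 1"
    hence "1 / norm u \<le> slit_length" using slits_norm_le[of 1 "1 / u"] by (simp add: norm_divide)
    moreover have "norm u < 1 / slit_length" "norm u > 0" using that by (auto simp: s_def)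
    hence "1 / norm u > slit_length" using slit_length_cube(2) by (simp add: field_simps)
    ultimately show False by simp
  qed
  have hol: "k holomorphic_on ball 0 s - {0}"
  proof -
    have "slit_map 1 \<circ> (\<lambda>u. 1 / u) holomorphic_on ball 0 s - {0}"
      by (rule holomorphic_on_compose_gen[OF _ holomorphic_slit_map[OF zero_less_one]])
        (use off in \<open>auto intro!: holomorphic_intros\<close>)
    thus ?thesis unfolding k_def o_def by (intro holomorphic_intros)
  qed
  have cub: "(k u + 2 * u)\<^sup>2 * (k u - 2 * u) = 1" if "u \<in> ball 0 s - {0}" for u
  proof -
    have "(k u + 2 * u)\<^sup>2 * (k u - 2 * u) = u ^ 3 * slit_cubic 1 (slit_map 1 (1 / u))"
      by (simp add: k_def slit_cubic_def power2_eq_square power3_eq_cube algebra_simps)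
    also have "\<dots> = u ^ 3 * (1 / u) ^ 3" using slit_map_cubic[OF zero_less_one off[OF that]] by simp
    also have "\<dots> = 1" using that by (simp add: power_divide)
    finally show ?thesis .
  qed
  have bound: "norm (k u) \<le> 1 + 2 * s" if "u \<in> ball 0 s - {0}" for u
  proof -
    have "norm (slit_map 1 (1 / u)) \<le> norm (1 / u) + 2"
      using slit_cubic_norm_bounds(2)[of 1 "1 / u" "slit_map 1 (1 / u)"]
        slit_map_cubic[OF zero_less_one off[OF that]] by simp
    hence "norm u * norm (slit_map 1 (1 / u)) \<le> norm u * (norm (1 / u) + 2)" by (intro mult_left_mono) auto
    also have "\<dots> = 1 + 2 * norm u" using that by (simp add: norm_divide field_simps)
    finally show ?thesis using that by (simp add: k_def norm_mult)
  qed
  \<comment> \<open>The norm bound from the cubic makes the singularity of \<open>k\<close> at 0,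
    that is the behaviour of the map at infinity, removable.\<close>
  have "eventually (\<lambda>u. norm (k u) \<le> 1 + 2 * s) (at 0)"
    unfolding eventually_at using bound s by (intro exI[of _ s]) auto
  hence "\<exists>h. h holomorphic_on ball 0 s \<and> (\<forall>u\<in>ball 0 s - {0}. h u = k u)"
    using s by (subst holomorphic_on_extend_bounded[OF hol]) auto
  then obtain h where h: "h holomorphic_on ball 0 s" "\<And>u. u \<in> ball 0 s - {0} \<Longrightarrow> h u = k u" by blast
  have c0: "isCont h 0" using holomorphic_isCont[OF h(1) open_ball] s by simp
  \<comment> \<open>By continuity the cubic gives only (h 0)^3 = 1. Along this positive sequence the
    values are nonnegative reals, which singles out the root 1 and makes the family start at the
    identity.\<close>
  define u where "u n = complex_of_real (s / (real n + 2))" for n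
  have us: "u n \<in> ball 0 s - {0}" for n using s
    by (auto simp: u_def norm_divide field_simps abs_mult norm_mult add_pos_nonneg simp del: of_real_divide)
  have u0: "u \<longlonglongrightarrow> 0"
  proof -
    have "(\<lambda>n. s / (real n + 2)) \<longlonglongrightarrow> 0" by real_asymp
    hence "u \<longlonglongrightarrow> complex_of_real 0" unfolding u_def by (rule tendsto_of_real)
    thus ?thesis by simp
  qed
  have hu: "(\<lambda>n. h (u n)) \<longlonglongrightarrow> h 0" using isCont_tendsto_compose[OF c0 u0] .
  have "h (u n) \<in> \<real>\<^sub>\<ge>\<^sub>0" for n
  proof -
    define r where "r = s / (real n + 2)"
    have r: "r > 0" "u n = of_real r" using s by (auto simp: r_def u_def)
    obtain \<xi> where \<xi>: "slit_map 1 (of_real (1 / r)) = of_real \<xi>" "\<xi> * (1 / r) > 0"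
      using slit_map_of_real[of 1 "1 / r"] r by (metis divide_eq_0_iff less_irrefl zero_less_one)
    have "h (u n) = of_real (r * \<xi>)" using h(2)[OF us[of n]] \<xi>(1) r(2) by (simp add: k_def)
    moreover have "r * \<xi> \<ge> 0" using \<xi>(2) r(1) by (simp add: zero_less_divide_iff)
    ultimately show ?thesis by (simp only: nonneg_Reals_of_real_iff)
  qed
  hence "h 0 \<in> \<real>\<^sub>\<ge>\<^sub>0" using closed_sequentially[OF closed_nonneg_Reals_complex _ hu] by blast
  then obtain x where x: "h 0 = of_real x" "x \<ge> 0" by (metis nonneg_Reals_cases)
  have "(\<lambda>n. (h (u n) + 2 * u n)\<^sup>2 * (h (u n) - 2 * u n)) \<longlonglongrightarrow> (h 0 + 2 * 0)\<^sup>2 * (h 0 - 2 * 0)"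
    by (intro tendsto_intros hu u0)
  moreover have "(\<lambda>n. (h (u n) + 2 * u n)\<^sup>2 * (h (u n) - 2 * u n)) = (\<lambda>n. 1)"
    by (simp only: cub[OF us] h(2)[OF us])
  ultimately have "(\<lambda>n :: nat. 1) \<longlonglongrightarrow> (h 0 + 2 * 0)\<^sup>2 * (h 0 - 2 * 0)" by simp
  hence "(h 0 + 2 * 0)\<^sup>2 * (h 0 - 2 * 0) = 1" by (rule LIMSEQ_unique[OF _ tendsto_const])
  hence "(h 0)\<^sup>2 * h 0 = 1" by simp
  hence "complex_of_real (x ^ 3) = of_real 1" using x(1) by (simp add: power2_eq_square power3_eq_cube)
  hence "x ^ 3 = 1" unfolding of_real_eq_iff .
  hence "x = 1" using x(2) by (metis odd_numeral odd_real_root_power_cancel power_one)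
  hence h0: "h 0 = 1" using x by simp
  show thesis
  proof (rule that[OF s h(1) h0])
    fix v :: complex assume v: "v \<in> ball 0 s"
    show "(h v + 2 * v)\<^sup>2 * (h v - 2 * v) = 1"
      by (cases "v = 0") (use v cub h h0 in auto)
  next
    fix \<epsilon> and w :: complex assume e: "0 \<le> \<epsilon>" "\<epsilon> < s * norm w"
    hence w: "w \<noteq> 0" by auto
    show "slit_map \<epsilon> w = w * h (of_real \<epsilon> / w)"
    proof (cases "\<epsilon> = 0")
      case True
      thus ?thesis by (simp add: slit_map_def h0)
    next
      case False
      hence e0: "\<epsilon> > 0" using e by simp
      have "\<epsilon> * slit_length < norm w" using e slit_length_cube(2) by (simp add: s_def field_simps)
      hence "w \<notin> slits \<epsilon>" using slits_norm_le[OF e0] by force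
      hence "slit_map \<epsilon> w = of_real \<epsilon> * slit_map 1 (w / of_real \<epsilon>)" by (rule slit_map_scaling[OF e0])
      also have "\<dots> = w * k (of_real \<epsilon> / w)" using w by (simp add: k_def)
      also have "of_real \<epsilon> / w \<in> ball 0 s - {0}" using e e0 w by (simp add: norm_divide divide_less_eq)
      hence "k (of_real \<epsilon> / w) = h (of_real \<epsilon> / w)" using h(2) by simp
      finally show ?thesis .
    qed
  qed
qed

text \<open>The constant relation is differentiated twice at u = 0, where h = 1. The first
  derivative gives 3 h' + 2 = 0; with h' = -2/3 the second gives 3 h'' = 32/3.\<close>

lemma germ_derivatives:
  assumes s: "s > 0" and h: "h holomorphic_on ball 0 s" "h 0 = 1"
    "\<And>u. u \<in> ball 0 s \<Longrightarrow> (h u + 2 * u)\<^sup>2 * (h u - 2 * u) = 1"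
  shows "deriv h 0 = - (2 / 3)" "deriv (deriv h) 0 = 32 / 9"
proof -
  define h1 where "h1 = deriv h"
  define h2 where "h2 = deriv h1"
  have d1: "(h has_field_derivative h1 u) (at u)" if "u \<in> ball 0 s" for u
    unfolding h1_def by (rule holomorphic_derivI[OF h(1) open_ball that])
  have "h1 holomorphic_on ball 0 s" unfolding h1_def by (rule holomorphic_deriv[OF h(1) open_ball])
  hence d2: "(h1 has_field_derivative h2 u) (at u)" if "u \<in> ball 0 s" for u
    unfolding h2_def by (rule holomorphic_derivI[OF _ open_ball that])
  have const: "D = 0" if "(F has_field_derivative D) (at u)" "\<And>v. v \<in> ball 0 s \<Longrightarrow> F v = c" "u \<in> ball 0 s" for F D u c
    using has_field_derivative_transform_within_open[OF that(1) open_ball that(3), of "\<lambda>_. c"] that(2)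
      DERIV_unique[OF _ DERIV_const] by blast
  define F1 where "F1 u = 2 * (h u + 2 * u) * (h1 u + 2) * (h u - 2 * u) + (h u + 2 * u)\<^sup>2 * (h1 u - 2)" for u
  have F1: "F1 u = 0" if u: "u \<in> ball 0 s" for u
  proof (rule const[OF _ h(3) u])
    show "((\<lambda>u. (h u + 2 * u)\<^sup>2 * (h u - 2 * u)) has_field_derivative F1 u) (at u)"
      unfolding F1_def by (rule derivative_eq_intros d1[OF u] refl | simp)+
  qed
  have z: "0 \<in> ball (0 :: complex) s" using s by simp
  have "2 * (h1 0 + 2) + (h1 0 - 2) = 0" using F1[OF z] by (simp add: F1_def h(2))
  hence "3 * h1 0 = - 2" by (simp add: algebra_simps add_eq_0_iff)
  thus h10: "deriv h 0 = - (2 / 3)" by (simp add: h1_def field_simps)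
  define D where "D = 2 * (h1 0 + 2) * (h1 0 + 2) + 2 * h2 0 + 2 * (h1 0 + 2) * (h1 0 - 2)
    + 2 * (h1 0 + 2) * (h1 0 - 2) + h2 0"
  have "(F1 has_field_derivative D) (at 0)"
    unfolding F1_def[abs_def] D_def
    by (rule derivative_eq_intros d1[OF z] d2[OF z] refl | simp add: h(2) algebra_simps)+
  hence "D = 0" by (rule const[OF _ F1 z])
  hence "3 * h2 0 = 32 / 3" using h10 unfolding D_def h1_def[symmetric] by (simp add: field_simps)
  thus "deriv (deriv h) 0 = 32 / 9" by (simp add: h2_def h1_def field_simps)
qed

lemma slit_map_holomorphic_family: "holomorphic_family_from_id slit_map"
proof -
  obtain s h where g: "s > 0" "h holomorphic_on ball 0 s" "h 0 = 1"
    "\<And>\<epsilon> w. 0 \<le> \<epsilon> \<Longrightarrow> \<epsilon> < s * norm w \<Longrightarrow> slit_map \<epsilon> w = w * h (of_real \<epsilon> / w)"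
    using slit_map_germ by metis
  show ?thesis unfolding holomorphic_family_from_id_def
  proof (intro conjI allI impI)
    fix w show "slit_map 0 w = w" by (simp add: slit_map_def)
  next
    fix r :: real assume r: "r > 0"
    \<comment> \<open>This formula makes sense for complex parameters. On \<open>exterior r\<close>
      the quotient \<open>e / w\<close> stays in the disc of the germ as soon as norm e < s *
      r.\<close>
    define B where "B e w = w * h (e / w)" for e w
    have small: "norm e < s * norm w" "w \<noteq> 0" "e / w \<in> ball 0 s" 
      if "e \<in> ball 0 (s * r)" "w \<in> exterior r" for e w :: complex
    proof -
      have "norm e < s * r" "s * r \<le> s * norm w" using that g(1) by (auto simp: exterior_def)
      thus 1: "norm e < s * norm w" by simp
      show 2: "w \<noteq> 0" using that r by (auto simp: exterior_def)
      show "e / w \<in> ball 0 s" using 1 2 by (simp add: norm_divide divide_less_eq)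
    qed
    have "\<forall>\<epsilon>\<in>{0..<s * r}. \<forall>w\<in>exterior r. B (complex_of_real \<epsilon>) w = slit_map \<epsilon> w"
    proof (intro ballI)
      fix \<epsilon> w assume "\<epsilon> \<in> {0..<s * r}" "w \<in> exterior r"
      thus "B (complex_of_real \<epsilon>) w = slit_map \<epsilon> w" using small(1)[of "of_real \<epsilon>" w] by (auto simp: B_def g(4))
    qed
    moreover have "B e holomorphic_on exterior r" if "e \<in> ball 0 (s * r)" for e
    proof -
      have "h \<circ> (\<lambda>w. e / w) holomorphic_on exterior r"
        by (rule holomorphic_on_compose_gen[OF _ g(2)])
          (use small[OF that] in \<open>auto intro!: holomorphic_intros\<close>)
      thus ?thesis unfolding B_def o_def by (intro holomorphic_intros)
    qed
    moreover have "(\<lambda>e. B e w) holomorphic_on ball 0 (s * r)" if "w \<in> exterior r" for w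
    proof -
      have "h \<circ> (\<lambda>e. e / w) holomorphic_on ball 0 (s * r)"
        by (rule holomorphic_on_compose_gen[OF _ g(2)])
          (use small[OF _ that] in \<open>auto intro!: holomorphic_intros\<close>)
      thus ?thesis unfolding B_def o_def by (intro holomorphic_intros)
    qed
    ultimately show "\<exists>\<delta>>0. \<exists>B. (\<forall>\<epsilon>\<in>{0..<\<delta>}. \<forall>w\<in>exterior r. B (complex_of_real \<epsilon>) w = slit_map \<epsilon> w) \<and>
        (\<forall>e\<in>ball 0 \<delta>. B e holomorphic_on exterior r) \<and>
        (\<forall>w\<in>exterior r. (\<lambda>e. B e w) holomorphic_on ball 0 \<delta>)"
      using r g(1) by (intro exI[of _ "s * r"] exI[of _ B] conjI) auto
  qed
qed

text \<open>At fixed \<open>w\<close> the family w h(\<epsilon> / w) has the successive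
  \<epsilon>-derivatives h'(\<epsilon> / w) and h''(\<epsilon> / w) / w. This is why the first
  cocycle is constant and the second is a multiple of 1/w.\<close>

lemma slit_map_variation_cocycles:
  "has_variation_cocycles slit_map (\<lambda>w. - (2 / 3)) (\<lambda>w. 32 / 9 * (1 / w))"
  unfolding has_variation_cocycles_def
proof (intro allI impI)
  fix w :: complex assume w: "w \<noteq> 0"
  obtain s h where g: "s > 0" "h holomorphic_on ball 0 s" "h 0 = 1"
    "\<And>u. u \<in> ball 0 s \<Longrightarrow> (h u + 2 * u)\<^sup>2 * (h u - 2 * u) = 1"
    "\<And>\<epsilon> w. 0 \<le> \<epsilon> \<Longrightarrow> \<epsilon> < s * norm w \<Longrightarrow> slit_map \<epsilon> w = w * h (of_real \<epsilon> / w)"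
    using slit_map_germ by blast
  have d: "deriv h 0 = - (2 / 3)" "deriv (deriv h) 0 = 32 / 9"
    by (rule germ_derivatives[OF g(1-3)], rule g(4), assumption)+
  define \<delta> where "\<delta> = s * norm w"
  have \<delta>: "\<delta> > 0" using w g(1) by (simp add: \<delta>_def)
  have in_ball: "of_real \<epsilon> / w \<in> ball 0 s" if "\<epsilon> \<in> {0..<\<delta>}" for \<epsilon>
    using that w by (simp add: \<delta>_def norm_divide divide_less_eq)
  have quot: "((\<lambda>e. e / w) has_field_derivative 1 / w) (at e)" for e
    using w by (auto intro!: derivative_eq_intros)
  have 1: "((\<lambda>\<epsilon>. slit_map \<epsilon> w) has_vector_derivative deriv h (of_real \<epsilon> / w)) (at \<epsilon> within {0..})"
    if e: "\<epsilon> \<in> {0..<\<delta>}" for \<epsilon>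
  proof -
    have "((\<lambda>e. w * h (e / w)) has_field_derivative w * (deriv h (of_real \<epsilon> / w) * (1 / w))) (at (of_real \<epsilon>))"
      by (intro DERIV_cmult DERIV_chain2[OF _ quot] holomorphic_derivI[OF g(2) open_ball] in_ball e)
    hence "((\<lambda>\<epsilon>. w * h (of_real \<epsilon> / w)) has_vector_derivative w * (deriv h (of_real \<epsilon> / w) * (1 / w)))
        (at \<epsilon> within {0..})"
      by (rule has_vector_derivative_real_field)
    hence "((\<lambda>\<epsilon>. slit_map \<epsilon> w) has_vector_derivative w * (deriv h (of_real \<epsilon> / w) * (1 / w)))
        (at \<epsilon> within {0..})"
      by (rule has_vector_derivative_transform_within[where d = "\<delta> - \<epsilon>"])
        (use e g(5)[of _ w] in \<open>auto simp: \<delta>_def dist_real_def\<close>)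
    thus ?thesis using w by simp
  qed
  have 2: "((\<lambda>\<epsilon>. deriv h (of_real \<epsilon> / w)) has_vector_derivative 32 / 9 * (1 / w)) (at 0 within {0..})"
  proof -
    have "((\<lambda>e. deriv h (e / w)) has_field_derivative deriv (deriv h) (of_real 0 / w) * (1 / w)) (at (of_real 0))"
      by (intro DERIV_chain2[OF _ quot] holomorphic_derivI[OF holomorphic_deriv[OF g(2) open_ball] open_ball] in_ball)
        (use \<delta> in auto)
    hence "((\<lambda>\<epsilon>. deriv h (of_real \<epsilon> / w)) has_vector_derivative deriv (deriv h) (of_real 0 / w) * (1 / w)) (at 0 within {0..})"
      by (rule has_vector_derivative_real_field)
    moreover have "complex_of_real 0 / w = 0" by simp
    ultimately show ?thesis unfolding d(2) by (simp only: d(2))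
  qed
  have 3: "deriv h (of_real 0 / w) = - (2 / 3)" by (simp add: d(1))
  show "\<exists>\<delta>>0. \<exists>A'. (\<forall>\<epsilon>\<in>{0..<\<delta>}. ((\<lambda>e. slit_map e w) has_vector_derivative A' \<epsilon>) (at \<epsilon> within {0..})) \<and>
        A' 0 = - (2 / 3) \<and> (A' has_vector_derivative 32 / 9 * (1 / w)) (at 0 within {0..})"
    by (rule exI[of _ \<delta>], intro conjI \<delta> exI[of _ "\<lambda>\<epsilon>. deriv h (of_real \<epsilon> / w)"] ballI 1 2 3)
qed

section \<open>Holomorphic change of variables for nonnegative integrals\<close>

text \<open>The change of variables theorem used below concerns \<open>real ^ 2\<close> and Jacobian
  determinants. Plane integrals are carried there and back by this linear, measure preserving
  identification.\<close>

definition complex_of_vec :: "real ^ 2 \<Rightarrow> complex" where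
  "complex_of_vec x = Complex (vec_nth x 1) (vec_nth x 2)"

definition vec_of_complex :: "complex \<Rightarrow> real ^ 2" where
  "vec_of_complex z = (\<chi> i. if i = 1 then Re z else Im z)"

lemma vec_of_complex_nth [simp]: "vec_nth (vec_of_complex z) 1 = Re z" "vec_nth (vec_of_complex z) 2 = Im z"
  by (simp_all add: vec_of_complex_def)

lemma complex_of_vec_inverse [simp]:
  "complex_of_vec (vec_of_complex z) = z" "vec_of_complex (complex_of_vec x) = x"
  by (simp_all add: complex_of_vec_def vec_eq_iff forall_2)

lemma linear_complex_of_vec: "linear complex_of_vec"
  by (rule linearI) (simp_all add: complex_of_vec_def complex_eq_iff)

lemma linear_vec_of_complex: "linear vec_of_complex"
  by (rule linearI) (simp_all add: vec_eq_iff forall_2)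

lemma borel_complex_of_vec [measurable]: "complex_of_vec \<in> borel_measurable borel"
  by (intro borel_measurable_continuous_onI linear_continuous_on linear_conv_bounded_linear[THEN iffD1] linear_complex_of_vec)

lemma lborel_complex_of_vec: "distr lborel borel complex_of_vec = lborel"
proof (rule lborel_eqI[symmetric])
  fix l u :: complex assume le: "\<And>b. b \<in> Basis \<Longrightarrow> l \<bullet> b \<le> u \<bullet> b"
  have lu: "Re l \<le> Re u" "Im l \<le> Im u" using le[of 1] le[of \<i>] by (simp_all add: Basis_complex_def inner_complex_def)
  have B: "(Basis :: (real^2) set) = {axis 1 1, axis 2 1}"
    by (auto simp: Basis_vec_def UNIV_2)
  have box: "complex_of_vec -` box l u = box (vec_of_complex l) (vec_of_complex u)"
    by (auto simp: mem_box B Basis_complex_def complex_of_vec_def inner_axis)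
  have "emeasure (distr lborel borel complex_of_vec) (box l u)
      = emeasure lborel (box (vec_of_complex l) (vec_of_complex u))"
    by (simp add: emeasure_distr box)
  also have "\<dots> = (\<Prod>b\<in>Basis. (vec_of_complex u - vec_of_complex l) \<bullet> b)"
    by (rule emeasure_lborel_box) (use lu in \<open>auto simp: B inner_axis\<close>)
  also have "\<dots> = (\<Prod>b\<in>Basis. (u - l) \<bullet> b)"
    by (simp add: B Basis_complex_def inner_axis inner_complex_def axis_eq_axis)
  finally show "emeasure (distr lborel borel complex_of_vec) (box l u) = (\<Prod>b\<in>Basis. (u - l) \<bullet> b)" .
qed simp

text \<open>This translates between the absolute integrals of the change of variables theorem and
  nonnegative integrals. It speaks of one finite value \<open>b\<close> at a time, since an infinite
  integral has no counterpart on the other side.\<close>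

lemma absolutely_integrable_iff_nn_integral:
  fixes f :: "'a::euclidean_space \<Rightarrow> real"
  assumes B: "B \<in> sets borel" and f: "(\<lambda>x. indicator B x * f x) \<in> borel_measurable borel"
    and pos: "\<And>x. x \<in> B \<Longrightarrow> 0 \<le> f x" and b: "0 \<le> b"
  shows "f absolutely_integrable_on B \<and> integral B f = b
    \<longleftrightarrow> (\<integral>\<^sup>+x\<in>B. ennreal (f x) \<partial>lborel) = ennreal b"
proof -
  let ?g = "\<lambda>x. indicator B x * f x"
  have ind: "indicator B x *\<^sub>R f x = ?g x" for x by simp
  have nn: "(\<integral>\<^sup>+x\<in>B. ennreal (f x) \<partial>lborel) = (\<integral>\<^sup>+x. ennreal (?g x) \<partial>lborel)"
    by (intro nn_integral_cong) (auto simp: indicator_def)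
  have pos': "0 \<le> ?g x" for x using pos by (auto simp: indicator_def)
  have m: "?g \<in> borel_measurable lborel" using f by simp
  have ai: "f absolutely_integrable_on B \<longleftrightarrow> integrable lborel ?g"
    unfolding set_integrable_def ind using integrable_completion[OF m] .
  have int: "integral B f = integral\<^sup>L lborel ?g" if "f absolutely_integrable_on B"
  proof -
    have "integral B f = (LINT x:B|lebesgue. f x)" using set_lebesgue_integral_eq_integral(2)[OF that] by simp
    also have "\<dots> = integral\<^sup>L lborel ?g"
      unfolding set_lebesgue_integral_def ind using integral_completion[OF m] .
    finally show ?thesis .
  qed
  show ?thesis
  proof
    assume "f absolutely_integrable_on B \<and> integral B f = b"
    thus "(\<integral>\<^sup>+x\<in>B. ennreal (f x) \<partial>lborel) = ennreal b"
      unfolding nn using ai int pos' by (simp add: nn_integral_eq_integral)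
  next
    assume a: "(\<integral>\<^sup>+x\<in>B. ennreal (f x) \<partial>lborel) = ennreal b"
    have i: "integrable lborel ?g"
      by (rule integrableI_nn_integral_finite[OF m _ a[unfolded nn]]) (use pos' in auto)
    have "ennreal (integral\<^sup>L lborel ?g) = ennreal b"
      using nn_integral_eq_integral[OF i] pos' a nn by simp
    hence "integral\<^sup>L lborel ?g = b" using b pos' by (simp add: integral_nonneg_AE)
    thus "f absolutely_integrable_on B \<and> integral B f = b" using ai int i by simp
  qed
qed

text \<open>The theorem for absolute integrals is an equivalence for every finite value. Hence the
  two nonnegative integrals take the same finite values, and if one is infinite, so is the
  other.\<close>

lemma nn_integral_change_of_variables:
  fixes g :: "real ^ 2 \<Rightarrow> real ^ 2" and f :: "real ^ 2 \<Rightarrow> real"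
  assumes A: "A \<in> sets borel" and gA: "g ` A \<in> sets borel" and inj: "inj_on g A"
    and der: "\<And>x. x \<in> A \<Longrightarrow> (g has_derivative g' x) (at x within A)"
    and f: "f \<in> borel_measurable borel" "\<And>x. 0 \<le> f x"
    and m: "(\<lambda>x. indicator A x * (\<bar>det (matrix (g' x))\<bar> * f (g x))) \<in> borel_measurable borel"
  shows "(\<integral>\<^sup>+x\<in>g ` A. ennreal (f x) \<partial>lborel) = (\<integral>\<^sup>+x\<in>A. ennreal (\<bar>det (matrix (g' x))\<bar> * f (g x)) \<partial>lborel)"
proof -
  let ?h = "\<lambda>x. \<bar>det (matrix (g' x))\<bar> * f (g x)"
  \<comment> \<open>The theorem is stated for vector valued functions; the real integrand is passed
    to it as a vector of dimension 1.\<close>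
  have "(\<lambda>x. \<bar>det (matrix (g' x))\<bar> *\<^sub>R vec (f (g x)) :: real ^ 1) absolutely_integrable_on A \<and>
      integral A (\<lambda>x. \<bar>det (matrix (g' x))\<bar> *\<^sub>R vec (f (g x))) = (vec b :: real ^ 1)
    \<longleftrightarrow> (\<lambda>x. vec (f x) :: real ^ 1) absolutely_integrable_on (g ` A) \<and>
      integral (g ` A) (\<lambda>x. vec (f x)) = (vec b :: real ^ 1)" for b
    by (intro has_absolute_integral_change_of_variables der inj) (use A in auto)
  hence cov: "?h absolutely_integrable_on A \<and> integral A ?h = b
      \<longleftrightarrow> f absolutely_integrable_on (g ` A) \<and> integral (g ` A) f = b" for b
    by (simp add: absolutely_integrable_on_1_iff integral_on_1_eq)
  have iff: "(\<integral>\<^sup>+x\<in>A. ennreal (?h x) \<partial>lborel) = ennreal b \<longleftrightarrow> (\<integral>\<^sup>+x\<in>g ` A. ennreal (f x) \<partial>lborel) = ennreal b"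
    if b: "0 \<le> b" for b
  proof -
    have "(\<lambda>x. indicator (g ` A) x * f x) \<in> borel_measurable borel" using gA f(1) by measurable
    hence "f absolutely_integrable_on (g ` A) \<and> integral (g ` A) f = b \<longleftrightarrow>
        (\<integral>\<^sup>+x\<in>g ` A. ennreal (f x) \<partial>lborel) = ennreal b"
      by (intro absolutely_integrable_iff_nn_integral gA f(2) b)
    moreover have "?h absolutely_integrable_on A \<and> integral A ?h = b \<longleftrightarrow>
        (\<integral>\<^sup>+x\<in>A. ennreal (?h x) \<partial>lborel) = ennreal b"
      by (intro absolutely_integrable_iff_nn_integral A m b mult_nonneg_nonneg f(2)) auto
    ultimately show ?thesis using cov by blast
  qed
  show ?thesis
  proof (cases "\<integral>\<^sup>+x\<in>A. ennreal (?h x) \<partial>lborel" rule: ennreal_cases)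
    case (real b)
    with iff[OF real(1)] show ?thesis by simp
  next
    case top
    show ?thesis
    proof (cases "\<integral>\<^sup>+x\<in>g ` A. ennreal (f x) \<partial>lborel" rule: ennreal_cases)
      case (real b)
      with iff[OF real(1)] show ?thesis by simp
    qed (simp add: top)
  qed
qed

lemma det_complex_mult:
  "det (matrix (\<lambda>v. vec_of_complex (c * complex_of_vec v))) = (norm c)\<^sup>2"
  unfolding cmod_power2 by (simp add: det_2 matrix_def complex_of_vec_def axis_def power2_eq_square)

lemma borel_vimage_continuous_on:
  fixes f :: "'a::topological_space \<Rightarrow> 'b::topological_space"
  assumes "open U" "continuous_on U f" "A \<in> sets borel"
  shows "f -` A \<inter> U \<in> sets borel"
proof -
  have "f -` A \<inter> space (restrict_space borel U) \<in> sets (restrict_space borel U)"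
    by (rule measurable_sets[OF borel_measurable_continuous_on_restrict[OF assms(2)] assms(3)])
  thus ?thesis using assms(1) by (simp add: sets_restrict_space_iff space_restrict_space)
qed

lemma borel_image_holomorphic:
  assumes "open S" "G holomorphic_on S" "inj_on G S" "A \<in> sets borel" "A \<subseteq> S"
  shows "G ` A \<in> sets borel"
proof -
  obtain H where H: "H holomorphic_on G ` S" "\<And>z. z \<in> S \<Longrightarrow> H (G z) = z"
    using holomorphic_has_inverse[OF assms(2,1,3)] by metis
  have "G ` A = H -` A \<inter> G ` S" using H(2) assms(5) by force
  thus ?thesis
    using borel_vimage_continuous_on[OF open_mapping_thm3[OF assms(2,1,3)] holomorphic_on_imp_continuous_on[OF H(1)] assms(4)]
    by simp
qed

lemma nn_integral_complex_of_vec: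
  fixes f :: "complex \<Rightarrow> ennreal"
  assumes "(\<lambda>z. f z * indicator X z) \<in> borel_measurable borel"
  shows "(\<integral>\<^sup>+z\<in>X. f z \<partial>lborel) = (\<integral>\<^sup>+x\<in>vec_of_complex ` X. f (complex_of_vec x) \<partial>lborel)"
proof -
  have ind: "indicator X (complex_of_vec x) = (indicator (vec_of_complex ` X) x :: ennreal)" for x
    using complex_of_vec_inverse(2)[of x] by (auto simp: indicator_def image_iff)
  have "(\<integral>\<^sup>+z\<in>X. f z \<partial>lborel) = (\<integral>\<^sup>+z. f z * indicator X z \<partial>distr lborel borel complex_of_vec)"
    by (simp add: lborel_complex_of_vec)
  also have "\<dots> = (\<integral>\<^sup>+x. f (complex_of_vec x) * indicator X (complex_of_vec x) \<partial>lborel)"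
    using assms by (intro nn_integral_distr) auto
  finally show ?thesis unfolding ind .
qed

lemma nn_integral_holomorphic_substitution:
  fixes G :: "complex \<Rightarrow> complex" and f :: "complex \<Rightarrow> real"
  assumes S: "open S" "G holomorphic_on S" "inj_on G S"
    and A: "A \<in> sets borel" "A \<subseteq> S"
    and f: "f \<in> borel_measurable borel" "\<And>z. 0 \<le> f z"
  shows "(\<integral>\<^sup>+z\<in>G ` A. ennreal (f z) \<partial>lborel) = (\<integral>\<^sup>+w\<in>A. ennreal ((norm (deriv G w))\<^sup>2 * f (G w)) \<partial>lborel)"
proof -
  note [measurable] = A(1) f(1)
  let ?T = complex_of_vec and ?V = vec_of_complex
  define g where "g = ?V \<circ> (G \<circ> ?T)"
  define g' where "g' x = (\<lambda>v. ?V (deriv G (?T x) * ?T v))" for x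
  have GA [measurable]: "G ` A \<in> sets borel" by (rule borel_image_holomorphic[OF S A])
  have V: "?V ` X = ?T -` X" for X
    by (auto simp: image_iff) (metis complex_of_vec_inverse(2))
  have Vb: "?V ` X \<in> sets borel" if "X \<in> sets borel" for X
    unfolding V using measurable_sets_borel[OF borel_complex_of_vec that] .
  have gV: "g ` ?V ` A = ?V ` G ` A" by (simp add: g_def image_comp o_def)
  have der: "(g has_derivative g' x) (at x within ?V ` A)" if "x \<in> ?V ` A" for x
  proof -
    have x: "?T x \<in> S" using that A(2) by auto
    have "(G has_derivative (*) (deriv G (?T x))) (at (?T x))"
      using holomorphic_derivI[OF S(2,1) x] by (simp add: has_field_derivative_def)
    hence "(G \<circ> ?T has_derivative (*) (deriv G (?T x)) \<circ> ?T) (at x)"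
      by (rule diff_chain_at[OF linear_imp_has_derivative[OF linear_complex_of_vec]])
    hence "(g has_derivative ?V \<circ> ((*) (deriv G (?T x)) \<circ> ?T)) (at x)" unfolding g_def
      by (rule diff_chain_at[OF _ linear_imp_has_derivative[OF linear_vec_of_complex]])
    thus ?thesis unfolding g'_def o_def by (rule has_derivative_at_withinI)
  qed
  have det: "\<bar>det (matrix (g' x))\<bar> = (norm (deriv G (?T x)))\<^sup>2" for x
    unfolding g'_def det_complex_mult by simp
  have inj: "inj_on g (?V ` A)"
  proof (rule inj_onI)
    fix x y assume xy: "x \<in> ?V ` A" "y \<in> ?V ` A" "g x = g y"
    hence "G (?T x) = G (?T y)" by (simp add: g_def) (metis complex_of_vec_inverse(1))
    moreover have "?T x \<in> S" "?T y \<in> S" using xy A(2) by auto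
    ultimately have "?T x = ?T y" using S(3) by (simp add: inj_on_def)
    thus "x = y" by (metis complex_of_vec_inverse(2))
  qed
  have contG: "continuous_on S G" "continuous_on S (deriv G)"
    using S by (auto intro!: holomorphic_on_imp_continuous_on holomorphic_deriv)
  \<comment> \<open>\<open>G\<close> is controlled on \<open>S\<close> only. Cut off by the
    indicator of \<open>S\<close>, it and its derivative become Borel functions on the plane, and on
    \<open>A\<close> nothing changes.\<close>
  have [measurable]: "(\<lambda>z. indicator S z *\<^sub>R G z) \<in> borel_measurable borel"
    "(\<lambda>z. indicator S z *\<^sub>R deriv G z) \<in> borel_measurable borel"
    using S(1) contG by (auto intro!: borel_measurable_continuous_on_indicator)
  have k: "(\<lambda>z. indicator A z * ((norm (deriv G z))\<^sup>2 * f (G z))) \<in> borel_measurable borel"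
  proof -
    have "(\<lambda>z. indicator A z * ((norm (indicator S z *\<^sub>R deriv G z))\<^sup>2 * f (indicator S z *\<^sub>R G z)))
        \<in> borel_measurable borel" by measurable
    also have "(\<lambda>z. indicator A z * ((norm (indicator S z *\<^sub>R deriv G z))\<^sup>2 * f (indicator S z *\<^sub>R G z)))
        = (\<lambda>z. indicator A z * ((norm (deriv G z))\<^sup>2 * f (G z)))"
      using A(2) by (auto simp: fun_eq_iff indicator_def)
    finally show ?thesis .
  qed
  have "(\<integral>\<^sup>+z\<in>G ` A. ennreal (f z) \<partial>lborel) = (\<integral>\<^sup>+x\<in>g ` ?V ` A. ennreal (f (?T x)) \<partial>lborel)"
    unfolding gV by (rule nn_integral_complex_of_vec) measurable
  also have "\<dots> = (\<integral>\<^sup>+x\<in>?V ` A. ennreal (\<bar>det (matrix (g' x))\<bar> * f (?T (g x))) \<partial>lborel)"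
  proof (rule nn_integral_change_of_variables[OF Vb[OF A(1)] _ inj der])
    show "g ` ?V ` A \<in> sets borel" unfolding gV by (rule Vb[OF GA])
    show "(\<lambda>x. f (?T x)) \<in> borel_measurable borel" by measurable
    have "(\<lambda>x. indicator A (?T x) * ((norm (deriv G (?T x)))\<^sup>2 * f (G (?T x)))) \<in> borel_measurable borel"
      using measurable_compose[OF borel_complex_of_vec k] .
    moreover have "indicator A (?T x) = (indicator (?V ` A) x :: real)" for x unfolding V by (simp add: indicator_def)
    ultimately show "(\<lambda>x. indicator (?V ` A) x * (\<bar>det (matrix (g' x))\<bar> * f (?T (g x)))) \<in> borel_measurable borel"
      unfolding det by (simp add: g_def)
  qed (use f(2) in auto)
  also have "\<dots> = (\<integral>\<^sup>+w\<in>A. ennreal ((norm (deriv G w))\<^sup>2 * f (G w)) \<partial>lborel)"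
  proof -
    have "(\<lambda>z. ennreal (indicator A z * ((norm (deriv G z))\<^sup>2 * f (G z)))) \<in> borel_measurable borel"
      using k by measurable
    moreover have "(\<lambda>z. ennreal (indicator A z * ((norm (deriv G z))\<^sup>2 * f (G z))))
        = (\<lambda>z. ennreal ((norm (deriv G z))\<^sup>2 * f (G z)) * indicator A z)"
      by (auto simp: fun_eq_iff indicator_def)
    ultimately show ?thesis unfolding det by (subst nn_integral_complex_of_vec) (simp_all add: g_def)
  qed
  finally show ?thesis .
qed

section \<open>Surfaces glued from charts\<close>

lemma riemann_surfaceD:
  assumes R: "riemann_surface R" and c: "(U, \<phi>) \<in> atlas R"
  shows "openin (stop R) U" "open (\<phi> ` U)"
    "homeomorphic_map (subtopology (stop R) U) (top_of_set (\<phi> ` U)) \<phi>"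
    "inj_on \<phi> U" "U \<subseteq> topspace (stop R)"
proof -
  show U: "openin (stop R) U" and "open (\<phi> ` U)"
    and h: "homeomorphic_map (subtopology (stop R) U) (top_of_set (\<phi> ` U)) \<phi>"
    using assms unfolding riemann_surface_def by fastforce+
  show s: "U \<subseteq> topspace (stop R)" using U by (rule openin_subset)
  show "inj_on \<phi> U" using homeomorphic_imp_injective_map[OF h] s by (simp add: Int_absorb1)
qed

lemma chart_openin_iff:
  assumes R: "riemann_surface R" and c: "(U, \<phi>) \<in> atlas R" and W: "W \<subseteq> U"
  shows "openin (stop R) W \<longleftrightarrow> open (\<phi> ` W)"
proof -
  note r = riemann_surfaceD[OF R c]
  have "openin (stop R) W \<longleftrightarrow> openin (subtopology (stop R) U) W"
    using W by (simp add: openin_open_subtopology[OF r(1)])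
  also have "\<dots> \<longleftrightarrow> openin (top_of_set (\<phi> ` U)) (\<phi> ` W)"
    using homeomorphic_map_openness[OF r(3), of W] W r(5) by auto
  also have "\<dots> \<longleftrightarrow> open (\<phi> ` W)" using W by (auto simp: openin_open_eq[OF r(2)])
  finally show ?thesis .
qed

lemma chart_compactin_iff:
  assumes R: "riemann_surface R" and c: "(U, \<phi>) \<in> atlas R" and W: "W \<subseteq> U"
  shows "compactin (stop R) W \<longleftrightarrow> compact (\<phi> ` W)"
proof -
  note r = riemann_surfaceD[OF R c]
  have "compactin (stop R) W \<longleftrightarrow> compactin (subtopology (stop R) U) W"
    using W by (simp add: compactin_subtopology)
  also have "\<dots> \<longleftrightarrow> compactin (top_of_set (\<phi> ` U)) (\<phi> ` W)"
    using homeomorphic_map_compactness[OF r(3), of W] W r(5) by auto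
  also have "\<dots> \<longleftrightarrow> compact (\<phi> ` W)" using W by (auto simp: compactin_subtopology)
  finally show ?thesis .
qed

text \<open>The right-hand side is the recipe of \<open>atlas_topology\<close>. So the given
  topology and the one of the deformed surface are tested in the same way, chart by chart.\<close>

lemma openin_iff_charts:
  assumes R: "riemann_surface R"
  shows "openin (stop R) W \<longleftrightarrow> W \<subseteq> topspace (stop R) \<and> (\<forall>(U, \<phi>)\<in>atlas R. open (\<phi> ` (W \<inter> U)))"
proof
  assume W: "openin (stop R) W"
  have "open (\<phi> ` (W \<inter> U))" if "(U, \<phi>) \<in> atlas R" for U \<phi>
    using chart_openin_iff[OF R that, of "W \<inter> U"] W riemann_surfaceD(1)[OF R that] by auto
  thus "W \<subseteq> topspace (stop R) \<and> (\<forall>(U, \<phi>)\<in>atlas R. open (\<phi> ` (W \<inter> U)))"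
    using openin_subset[OF W] by auto
next
  assume a: "W \<subseteq> topspace (stop R) \<and> (\<forall>(U, \<phi>)\<in>atlas R. open (\<phi> ` (W \<inter> U)))"
  have "openin (stop R) (W \<inter> U)" if "(U, \<phi>) \<in> atlas R" for U \<phi>
    using chart_openin_iff[OF R that, of "W \<inter> U"] a that by auto
  hence "openin (stop R) (\<Union>(U, \<phi>)\<in>atlas R. W \<inter> U)" by (intro openin_Union) auto
  moreover have "(\<Union>(U, \<phi>)\<in>atlas R. W \<inter> U) = W \<inter> (\<Union>(U, \<phi>)\<in>atlas R. U)" by auto
  moreover have "(\<Union>(U, \<phi>)\<in>atlas R. U) = topspace (stop R)" using R by (simp add: riemann_surface_def)
  ultimately show "openin (stop R) W" using a by (simp add: Int_absorb2)
qed

lemma chart_at: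
  assumes R: "riemann_surface R" and x: "x \<in> topspace (stop R)"
  obtains U \<phi> where "(U, \<phi>) \<in> atlas R" "x \<in> U"
proof -
  have "x \<in> (\<Union>(U, \<phi>)\<in>atlas R. U)" using R x by (simp add: riemann_surface_def)
  thus thesis using that by auto
qed

lemma transition_holomorphic:
  assumes "riemann_surface R" "(U, \<phi>) \<in> atlas R" "(V, \<psi>) \<in> atlas R"
  shows "(\<psi> \<circ> inv_into U \<phi>) holomorphic_on \<phi> ` (U \<inter> V)"
  using assms unfolding riemann_surface_def by fastforce

text \<open>These conditions are local and let charts alone generate a topology. Connectedness and
  the Hausdorff property are global, may fail for a gluing, and are proved separately.\<close>

locale holomorphic_atlas =
  fixes \<A> :: "'b chart set"
  assumes inj: "(U, \<phi>) \<in> \<A> \<Longrightarrow> inj_on \<phi> U"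
    and overlap: "(U, \<phi>) \<in> \<A> \<Longrightarrow> (V, \<psi>) \<in> \<A> \<Longrightarrow> open (\<phi> ` (U \<inter> V))"
    and transition: "(U, \<phi>) \<in> \<A> \<Longrightarrow> (V, \<psi>) \<in> \<A> \<Longrightarrow> (\<psi> \<circ> inv_into U \<phi>) holomorphic_on \<phi> ` (U \<inter> V)"
begin

lemma istopology_atlas:
  "istopology (\<lambda>W. W \<subseteq> (\<Union>(U, \<phi>)\<in>\<A>. U) \<and> (\<forall>(U, \<phi>)\<in>\<A>. open (\<phi> ` (W \<inter> U))))"
  unfolding istopology_def
proof (intro conjI allI impI)
  fix S T
  assume S: "S \<subseteq> (\<Union>(U, \<phi>)\<in>\<A>. U) \<and> (\<forall>(U, \<phi>)\<in>\<A>. open (\<phi> ` (S \<inter> U)))"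
    and T: "T \<subseteq> (\<Union>(U, \<phi>)\<in>\<A>. U) \<and> (\<forall>(U, \<phi>)\<in>\<A>. open (\<phi> ` (T \<inter> U)))"
  show "S \<inter> T \<subseteq> (\<Union>(U, \<phi>)\<in>\<A>. U)" using S by blast
  show "\<forall>(U, \<phi>)\<in>\<A>. open (\<phi> ` (S \<inter> T \<inter> U))"
  proof (clarify)
    fix U \<phi> assume c: "(U, \<phi>) \<in> \<A>"
    have "\<phi> ` ((S \<inter> U) \<inter> (T \<inter> U)) = \<phi> ` (S \<inter> U) \<inter> \<phi> ` (T \<inter> U)"
      by (rule inj_on_image_Int[OF inj[OF c]]) auto
    moreover have "(S \<inter> U) \<inter> (T \<inter> U) = S \<inter> T \<inter> U" by auto
    ultimately show "open (\<phi> ` (S \<inter> T \<inter> U))" using S T c by auto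
  qed
next
  fix \<K> assume K: "\<forall>W\<in>\<K>. W \<subseteq> (\<Union>(U, \<phi>)\<in>\<A>. U) \<and> (\<forall>(U, \<phi>)\<in>\<A>. open (\<phi> ` (W \<inter> U)))"
  show "\<Union>\<K> \<subseteq> (\<Union>(U, \<phi>)\<in>\<A>. U)" using K by blast
  show "\<forall>(U, \<phi>)\<in>\<A>. open (\<phi> ` (\<Union>\<K> \<inter> U))"
  proof (clarify)
    fix U \<phi> assume c: "(U, \<phi>) \<in> \<A>"
    have "\<phi> ` (\<Union>\<K> \<inter> U) = (\<Union>W\<in>\<K>. \<phi> ` (W \<inter> U))" by auto
    moreover have "open (\<phi> ` (W \<inter> U))" if "W \<in> \<K>" for W using K c that by blast
    ultimately show "open (\<phi> ` (\<Union>\<K> \<inter> U))" by (simp add: open_UN)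
  qed
qed

lemma openin_atlas: "openin (atlas_topology \<A>) W
    \<longleftrightarrow> W \<subseteq> (\<Union>(U, \<phi>)\<in>\<A>. U) \<and> (\<forall>(U, \<phi>)\<in>\<A>. open (\<phi> ` (W \<inter> U)))"
  unfolding atlas_topology_def using istopology_atlas by simp

lemma topspace_atlas: "topspace (atlas_topology \<A>) = (\<Union>(U, \<phi>)\<in>\<A>. U)"
proof (rule antisym)
  show "topspace (atlas_topology \<A>) \<subseteq> (\<Union>(U, \<phi>)\<in>\<A>. U)"
    using openin_topspace[of "atlas_topology \<A>"] unfolding openin_atlas by blast
  have "\<phi> ` ((\<Union>(V, \<psi>)\<in>\<A>. V) \<inter> U) = (\<Union>(V, \<psi>)\<in>\<A>. \<phi> ` (U \<inter> V))" for U and \<phi> :: "'b \<Rightarrow> complex" by auto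
  moreover have "open (\<Union>(V, \<psi>)\<in>\<A>. \<phi> ` (U \<inter> V))" if "(U, \<phi>) \<in> \<A>" for U \<phi>
    using overlap[OF that] by (intro open_UN ballI) auto
  ultimately have "openin (atlas_topology \<A>) (\<Union>(U, \<phi>)\<in>\<A>. U)"
    unfolding openin_atlas by auto
  thus "(\<Union>(U, \<phi>)\<in>\<A>. U) \<subseteq> topspace (atlas_topology \<A>)" by (rule openin_subset)
qed

lemma openin_atlas_chart:
  assumes c: "(U, \<phi>) \<in> \<A>" and W: "W \<subseteq> U"
  shows "openin (atlas_topology \<A>) W \<longleftrightarrow> open (\<phi> ` W)"
proof
  assume "openin (atlas_topology \<A>) W"
  hence "open (\<phi> ` (W \<inter> U))" using c unfolding openin_atlas by auto
  thus "open (\<phi> ` W)" using W by (simp add: Int_absorb2)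
next
  assume o: "open (\<phi> ` W)"
  have "open (\<psi> ` (W \<inter> V))" if d: "(V, \<psi>) \<in> \<A>" for V \<psi>
  proof -
    have "\<psi> ` (W \<inter> V) = \<psi> ` (V \<inter> U) \<inter> (\<phi> \<circ> inv_into V \<psi>) -` (\<phi> ` W)"
    proof (intro equalityI subsetI)
      fix y assume "y \<in> \<psi> ` (W \<inter> V)"
      thus "y \<in> \<psi> ` (V \<inter> U) \<inter> (\<phi> \<circ> inv_into V \<psi>) -` (\<phi> ` W)"
        using W inv_into_f_f[OF inj[OF d]] by auto
    next
      fix y assume "y \<in> \<psi> ` (V \<inter> U) \<inter> (\<phi> \<circ> inv_into V \<psi>) -` (\<phi> ` W)"
      then obtain p q where p: "p \<in> V" "p \<in> U" "y = \<psi> p" "q \<in> W" "\<phi> p = \<phi> q"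
        using inv_into_f_f[OF inj[OF d]] by auto
      hence "p = q" using inj[OF c] W by (auto dest: inj_onD)
      thus "y \<in> \<psi> ` (W \<inter> V)" using p by auto
    qed
    thus ?thesis
      using continuous_open_preimage[OF holomorphic_on_imp_continuous_on[OF transition[OF d c]] overlap[OF d c] o]
      by simp
  qed
  thus "openin (atlas_topology \<A>) W" unfolding openin_atlas using c W by auto
qed

lemma homeomorphic_atlas_chart:
  assumes c: "(U, \<phi>) \<in> \<A>"
  shows "homeomorphic_map (subtopology (atlas_topology \<A>) U) (top_of_set (\<phi> ` U)) \<phi>"
proof -
  let ?T = "atlas_topology \<A>"
  have oU: "open (\<phi> ` U)" using overlap[OF c c] by simp
  hence U: "openin ?T U" using openin_atlas_chart[OF c] by simp
  hence top: "topspace (subtopology ?T U) = U" using openin_subset by auto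
  have "continuous_map (subtopology ?T U) (top_of_set (\<phi> ` U)) \<phi>"
    unfolding continuous_map_def
  proof (intro conjI allI impI)
    show "\<phi> \<in> topspace (subtopology ?T U) \<rightarrow> topspace (top_of_set (\<phi> ` U))" unfolding top by auto
    fix O' assume "openin (top_of_set (\<phi> ` U)) O'"
    hence O': "open O'" "O' \<subseteq> \<phi> ` U" using openin_open_eq[OF oU] by auto
    have "\<phi> ` {x \<in> U. \<phi> x \<in> O'} = O'" using O'(2) by auto
    hence "openin ?T {x \<in> U. \<phi> x \<in> O'}" using openin_atlas_chart[OF c, of "{x \<in> U. \<phi> x \<in> O'}"] O'(1) by simp
    thus "openin (subtopology ?T U) {x \<in> topspace (subtopology ?T U). \<phi> x \<in> O'}"
      unfolding openin_open_subtopology[OF U] top by blast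
  qed
  moreover have "open_map (subtopology ?T U) (top_of_set (\<phi> ` U)) \<phi>"
    unfolding open_map_def openin_open_subtopology[OF U] openin_open_eq[OF oU]
    using openin_atlas_chart[OF c] by auto
  ultimately show ?thesis using inj[OF c]
    by (intro bijective_open_imp_homeomorphic_map) (simp_all only: top topspace_euclidean_subtopology)
qed

lemma riemann_surface_atlas:
  assumes "connected_space (atlas_topology \<A>)" "Hausdorff_space (atlas_topology \<A>)"
  shows "riemann_surface \<lparr>stop = atlas_topology \<A>, atlas = \<A>\<rparr>"
proof -
  have "openin (atlas_topology \<A>) U \<and> open (\<phi> ` U)" if c: "(U, \<phi>) \<in> \<A>" for U \<phi>
    using openin_atlas_chart[OF c] overlap[OF c c] by simp
  thus ?thesis unfolding riemann_surface_def
    using assms homeomorphic_atlas_chart transition by (auto simp: topspace_atlas)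
qed

end

section \<open>The deformed surface\<close>

lemma open_slit_map_image:
  assumes "\<epsilon> > 0" "open W" "W \<inter> slits \<epsilon> = {}"
  shows "open (slit_map \<epsilon> ` W)"
proof (rule open_mapping_thm3[OF _ assms(2)])
  have sub: "W \<subseteq> - slits \<epsilon>" using assms by auto
  show "slit_map \<epsilon> holomorphic_on W" by (rule holomorphic_on_subset[OF holomorphic_slit_map[OF assms(1)] sub])
  show "inj_on (slit_map \<epsilon>) W"
    using bij_betw_slit_map[OF assms(1)] sub by (auto simp: bij_betw_def intro: inj_on_subset)
qed

text \<open>A neighbourhood of the image slit contains points where the inverse map is undefined,
  but its complement is the image of a set off the slits. Topological statements about the filled
  region thus become statements about images under the slit map.\<close>

lemma filled_image_compl:
  assumes e: "\<epsilon> > 0" and S: "slits \<epsilon> \<subseteq> S"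
  shows "image_slit \<epsilon> \<union> slit_map \<epsilon> ` (S - slits \<epsilon>) = - slit_map \<epsilon> ` (- S)"
proof (intro equalityI subsetI)
  fix \<zeta> assume "\<zeta> \<in> image_slit \<epsilon> \<union> slit_map \<epsilon> ` (S - slits \<epsilon>)"
  thus "\<zeta> \<in> - slit_map \<epsilon> ` (- S)"
  proof
    assume "\<zeta> \<in> image_slit \<epsilon>"
    thus ?thesis using slit_map_notin[OF e] S by blast
  next
    assume "\<zeta> \<in> slit_map \<epsilon> ` (S - slits \<epsilon>)"
    then obtain v where v: "v \<in> S" "v \<notin> slits \<epsilon>" "\<zeta> = slit_map \<epsilon> v" by auto
    have "v = u" if "u \<notin> S" "\<zeta> = slit_map \<epsilon> u" for u
      using v that S unslit_slit[OF e] by (metis subsetD)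
    thus ?thesis using v by blast
  qed
next
  fix \<zeta> assume "\<zeta> \<in> - slit_map \<epsilon> ` (- S)"
  thus "\<zeta> \<in> image_slit \<epsilon> \<union> slit_map \<epsilon> ` (S - slits \<epsilon>)"
    using slit_unslit[OF e, of \<zeta>] unslit_map_notin[OF e, of \<zeta>] by (cases "\<zeta> \<in> image_slit \<epsilon>") (force simp: image_iff)+
qed

lemma open_filled_image:
  assumes e: "\<epsilon> > 0" and S: "slits \<epsilon> \<subseteq> S" and o: "open S"
  shows "open (image_slit \<epsilon> \<union> slit_map \<epsilon> ` (S - slits \<epsilon>))"
  unfolding filled_image_compl[OF e S] using S o
  by (intro open_Compl closed_image_slit_map[OF e] closed_Compl) auto

text \<open>Openness of filled images came from properness, as the complement is the image of a
  closed set. Here the complement is the image of an open set, so closedness comes from the open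
  mapping theorem; boundedness is the cubic estimate.\<close>

lemma compact_filled_image:
  assumes e: "\<epsilon> > 0" and S: "slits \<epsilon> \<subseteq> S" and c: "compact S"
  shows "compact (image_slit \<epsilon> \<union> slit_map \<epsilon> ` (S - slits \<epsilon>))"
  unfolding compact_eq_bounded_closed
proof
  have "closed S" using c by (rule compact_imp_closed)
  hence "open (slit_map \<epsilon> ` (- S))" using S by (intro open_slit_map_image e) auto
  thus "closed (image_slit \<epsilon> \<union> slit_map \<epsilon> ` (S - slits \<epsilon>))"
    unfolding filled_image_compl[OF e S] by (rule closed_Compl)
  obtain b where b: "\<And>x. x \<in> S \<Longrightarrow> norm x \<le> b"
    using compact_imp_bounded[OF c] by (auto simp: bounded_iff)
  have "norm \<zeta> \<le> 2 * \<epsilon>" if "\<zeta> \<in> image_slit \<epsilon>" for \<zeta>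
    using that cmod_le[of \<zeta>] by (auto simp: image_slit_def)
  moreover have "norm (slit_map \<epsilon> x) \<le> b + 2 * \<epsilon>" if "x \<in> S - slits \<epsilon>" for x
    using slit_cubic_norm_bounds(2)[of \<epsilon> x "slit_map \<epsilon> x"] slit_map_cubic[OF e, of x] b[of x] that e by force
  ultimately show "bounded (image_slit \<epsilon> \<union> slit_map \<epsilon> ` (S - slits \<epsilon>))"
    unfolding bounded_Un by (auto simp: bounded_iff)
qed

lemma compact_slits: "compact (slits \<epsilon>)"
  unfolding slits_def by (intro compact_Un compact_segment)

lemma connected_image_slit: "connected (image_slit \<epsilon>)"
proof -
  have "image_slit \<epsilon> = {\<zeta>. - 2 * \<epsilon> \<le> Re \<zeta>} \<inter> {\<zeta>. Re \<zeta> \<le> 2 * \<epsilon>} \<inter> {\<zeta>. Im \<zeta> = 0}"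
    by (auto simp: image_slit_def)
  moreover have "convex \<dots>"
    by (intro convex_Int convex_halfspace_Re_ge convex_halfspace_Re_le convex_hyperplane[of \<i> 0, simplified])
  ultimately show ?thesis by (simp add: convex_connected)
qed

section \<open>The charts of the reglued surface\<close>

locale slit_surgery =
  fixes R :: "'a surface" and D :: "'a set" and w :: "'a \<Rightarrow> complex" and \<rho> \<epsilon> :: real
  assumes compact_riemann: "compact_riemann_surface R" and chart: "(D, w) \<in> atlas R"
    and disc: "w ` D = ball 0 \<rho>" and eps: "\<epsilon> > 0" and slits_disc: "slits \<epsilon> \<subseteq> ball 0 \<rho>"
begin

abbreviation "G \<equiv> slit_map \<epsilon>"
abbreviation "H \<equiv> unslit_map \<epsilon>"
abbreviation "g \<equiv> pushed_differential \<epsilon>"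
abbreviation "X \<equiv> topspace (stop R)"
abbreviation "K \<equiv> surface_slits (D, w) \<epsilon>"
abbreviation "K' \<equiv> image_slit \<epsilon>"
abbreviation "F \<equiv> fst (filled_chart (D, w) \<epsilon>)"
abbreviation "f \<equiv> snd (filled_chart (D, w) \<epsilon>)"
abbreviation "R' \<equiv> deformed_surface R (D, w) \<epsilon>"
abbreviation "\<A> \<equiv> insert (filled_chart (D, w) \<epsilon>) (restricted_chart (D, w) \<epsilon> ` atlas R)"
abbreviation "T' \<equiv> atlas_topology \<A>"

lemma riemann: "riemann_surface R" and compact: "compact_space (stop R)"
  using compact_riemann by (auto simp: compact_riemann_surface_def)

lemma Hausdorff: "Hausdorff_space (stop R)" and connected: "connected_space (stop R)"
  using riemann by (auto simp: riemann_surface_def)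

lemmas chart_props = riemann_surfaceD[OF riemann]
lemmas chart_inv = inv_into_f_f[OF chart_props(4)]

lemma K_iff: "x \<in> K \<longleftrightarrow> x \<in> D \<and> w x \<in> slits \<epsilon>"
  by (simp add: surface_slits_def)

lemma F_eq: "F = Inl ` (D - K) \<union> Inr ` K'"
  by (simp add: filled_chart_def)

lemma f_simps [simp]: "f (Inl x) = G (w x)" "f (Inr \<zeta>) = \<zeta>"
  by (simp_all add: filled_chart_def)

lemma filled_mem: "(F, f) \<in> \<A>" by simp

lemma atlas_cases:
  assumes "(U, \<phi>) \<in> \<A>"
  obtains (filled) "U = F" "\<phi> = f"
    | (restricted) V \<psi> where "(V, \<psi>) \<in> atlas R" "U = Inl ` (V - K)" "\<phi> = \<psi> \<circ> projl"
  using assms by (auto simp: restricted_chart_def) (metis fst_conv snd_conv)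

lemma restricted_mem: "(V, \<psi>) \<in> atlas R \<Longrightarrow> (Inl ` (V - K), \<psi> \<circ> projl) \<in> \<A>"
  by (force simp: restricted_chart_def image_iff)

lemma image_disc: "C \<subseteq> ball 0 \<rho> \<Longrightarrow> w ` {x \<in> D. w x \<in> C} = C"
  using disc by auto

text \<open>The coordinate disc is merely open in the surface, so a relatively closed subset need
  not be closed. Compactness in a Hausdorff space supplies the missing part.\<close>

lemma closedin_disc_compact:
  assumes "compact C" "C \<subseteq> ball 0 \<rho>"
  shows "closedin (stop R) {x \<in> D. w x \<in> C}"
proof -
  have "compactin (stop R) {x \<in> D. w x \<in> C}"
    using chart_compactin_iff[OF riemann chart, of "{x \<in> D. w x \<in> C}"] image_disc[OF assms(2)] assms(1) by auto
  thus ?thesis by (rule compactin_imp_closedin[OF Hausdorff])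
qed

lemma closedin_K: "closedin (stop R) K"
  using closedin_disc_compact[OF compact_slits slits_disc] by (simp add: surface_slits_def)

lemma openin_disc_open:
  assumes "open C"
  shows "openin (stop R) {x \<in> D. w x \<in> C}"
proof -
  have "w ` {x \<in> D. w x \<in> C} = C \<inter> ball 0 \<rho>" using disc by auto
  thus ?thesis using chart_openin_iff[OF riemann chart, of "{x \<in> D. w x \<in> C}"] assms by auto
qed

lemma w_K_image: "w ` (D - K) = ball 0 \<rho> - slits \<epsilon>"
proof -
  have "D - K = {x \<in> D. w x \<in> ball 0 \<rho> - slits \<epsilon>}" using disc K_iff by auto
  thus ?thesis using image_disc[of "ball 0 \<rho> - slits \<epsilon>"] by simp
qed

lemma f_F: "f ` F = K' \<union> G ` (ball 0 \<rho> - slits \<epsilon>)"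
proof -
  have "f ` F = G ` w ` (D - K) \<union> K'"
    unfolding F_eq image_Un image_image by simp
  thus ?thesis unfolding w_K_image by auto
qed

lemma inj_f: "inj_on f F"
proof (rule inj_onI)
  fix p q assume p: "p \<in> F" and q: "q \<in> F" and eq: "f p = f q"
  have l: "x = y" if "x \<in> D - K" "y \<in> D - K" "G (w x) = G (w y)" for x y
  proof -
    have "w x \<notin> slits \<epsilon>" "w y \<notin> slits \<epsilon>" using that K_iff by auto
    hence "w x = w y" using that(3) unslit_slit[OF eps] by metis
    thus ?thesis using chart_props(4)[OF chart] that by (auto dest: inj_onD)
  qed
  have m: "G (w x) \<notin> K'" if "x \<in> D - K" for x
    using that K_iff slit_map_notin[OF eps] by auto
  from p q eq show "p = q" unfolding F_eq using l m by auto
qed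

lemma overlap_restricted: "openin (stop R) W \<Longrightarrow> (V, \<psi>) \<in> atlas R \<Longrightarrow> open (\<psi> ` (W \<inter> V))"
  using openin_iff_charts[OF riemann, of W] by auto

lemma openin_minus_K: "openin (stop R) W \<Longrightarrow> openin (stop R) (W - K)"
  using closedin_K by (simp add: openin_diff)

lemma open_f_Inl:
  assumes "openin (stop R) W" "W \<subseteq> D - K"
  shows "open (f ` Inl ` W)"
proof -
  have "f ` Inl ` W = G ` w ` W" by (simp add: image_image)
  moreover have "open (w ` W)" using chart_openin_iff[OF riemann chart, of W] assms by auto
  moreover have "w ` W \<inter> slits \<epsilon> = {}" using assms(2) K_iff by auto
  ultimately show ?thesis using open_slit_map_image[OF eps] by simp
qed

section \<open>The transition maps\<close>

lemma restricted_inv: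
  assumes "(V, \<psi>) \<in> atlas R" "x \<in> V - K"
  shows "inv_into (Inl ` (V - K)) (\<psi> \<circ> projl) (\<psi> x) = (Inl x :: 'a + complex)"
proof -
  have "inj_on (\<psi> \<circ> projl) (Inl ` (V - K) :: ('a + complex) set)"
    using chart_props(4)[OF assms(1)] by (auto simp: inj_on_def)
  from inv_into_f_f[OF this, of "Inl x"] show ?thesis using assms(2) by simp
qed

lemma restricted_to_restricted:
  assumes "(U, \<phi>) \<in> atlas R" "z \<in> \<phi> ` ((V - K) \<inter> U)"
  shows "((\<psi> \<circ> projl) \<circ> inv_into (Inl ` (U - K) :: ('a + complex) set) (\<phi> \<circ> projl)) z = (\<psi> \<circ> inv_into U \<phi>) z"
proof -
  obtain x where x: "x \<in> U - K" "z = \<phi> x" using assms(2) by auto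
  thus ?thesis using restricted_inv[OF assms(1) x(1)] chart_inv[OF assms(1), of x] by simp
qed

lemma restricted_to_filled:
  assumes "(U, \<phi>) \<in> atlas R" "z \<in> \<phi> ` ((D - K) \<inter> U)"
  shows "(f \<circ> inv_into (Inl ` (U - K)) (\<phi> \<circ> projl)) z = (G \<circ> (w \<circ> inv_into U \<phi>)) z"
proof -
  obtain x where x: "x \<in> U - K" "z = \<phi> x" using assms(2) by auto
  thus ?thesis using restricted_inv[OF assms(1) x(1)] chart_inv[OF assms(1), of x] by simp
qed

lemma filled_inv: "x \<in> D - K \<Longrightarrow> inv_into F f (G (w x)) = Inl x"
  using inv_into_f_f[OF inj_f, of "Inl x"] by (simp add: F_eq)

lemma filled_to_restricted:
  assumes "z \<in> G ` w ` ((D - K) \<inter> V)"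
  shows "((\<psi> \<circ> projl) \<circ> inv_into F f) z = ((\<psi> \<circ> inv_into D w) \<circ> H) z"
proof -
  obtain x where x: "x \<in> D - K" "z = G (w x)" using assms by auto
  moreover have "H z = w x" using x K_iff unslit_slit[OF eps] by auto
  ultimately show ?thesis using filled_inv[OF x(1)] chart_inv[OF chart, of x] by simp
qed

lemma filled_to_filled: "z \<in> f ` F \<Longrightarrow> (f \<circ> inv_into F f) z = z"
  using inv_into_f_f[OF inj_f] by auto

text \<open>Of the four kinds of overlap, the one of the filled chart with itself is the only one
  that contains the image slit. Its transition map is the identity, and its openness is
  \<open>open_filled_image\<close>. All other overlaps stay off the slits, where both
  \<open>G\<close> and \<open>H\<close> are holomorphic.\<close>

sublocale A: holomorphic_atlas \<A>
proof
  fix U \<phi> assume c: "(U, \<phi>) \<in> \<A>"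
  thus "inj_on \<phi> U"
  proof (cases rule: atlas_cases)
    case (restricted V \<psi>)
    thus ?thesis using chart_props(4)[OF restricted(1)] by (auto simp: inj_on_def)
  qed (simp add: inj_f)
next
  fix U V \<phi> \<psi> assume c: "(U, \<phi>) \<in> \<A>" and d: "(V, \<psi>) \<in> \<A>"
  have oD: "openin (stop R) (D - K)" using chart_props(1)[OF chart] openin_minus_K by blast
  have int: "F \<inter> Inl ` (V0 - K) = Inl ` ((D - K) \<inter> V0)" for V0 unfolding F_eq by auto
  show "open (\<phi> ` (U \<inter> V))"
    using c
  proof (cases rule: atlas_cases)
    case filled
    from d show ?thesis
    proof (cases rule: atlas_cases)
      case filled': filled
      show ?thesis unfolding filled filled' Int_absorb f_F
        by (rule open_filled_image[OF eps slits_disc open_ball])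
    next
      case (restricted V0 \<psi>0)
      show ?thesis unfolding filled restricted(2) int
        by (rule open_f_Inl) (use oD chart_props(1)[OF restricted(1)] in auto)
    qed
  next
    case (restricted U0 \<phi>0)
    have oU: "openin (stop R) (U0 - K)" using chart_props(1)[OF restricted(1)] openin_minus_K by blast
    from d show ?thesis
    proof (cases rule: atlas_cases)
      case filled
      have "\<phi> ` (U \<inter> V) = \<phi>0 ` ((D - K) \<inter> U0)"
        unfolding filled restricted(2,3) Int_commute[of _ F] int by (simp add: image_image)
      thus ?thesis using overlap_restricted[OF oD restricted(1)] by simp
    next
      case restricted': (restricted V0 \<psi>0)
      have "U \<inter> V = Inl ` ((V0 - K) \<inter> U0)" unfolding restricted(2) restricted'(2) by auto
      hence "\<phi> ` (U \<inter> V) = \<phi>0 ` ((V0 - K) \<inter> U0)" unfolding restricted(3) by (simp add: image_image)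
      thus ?thesis
        using overlap_restricted[OF openin_minus_K[OF chart_props(1)[OF restricted'(1)]] restricted(1)] by simp
    qed
  qed
  show "(\<psi> \<circ> inv_into U \<phi>) holomorphic_on \<phi> ` (U \<inter> V)"
    using c
  proof (cases rule: atlas_cases)
    case filled
    from d show ?thesis
    proof (cases rule: atlas_cases)
      case filled': filled
      have "(\<psi> \<circ> inv_into U \<phi>) z = z" if "z \<in> \<phi> ` (U \<inter> V)" for z
        using filled_to_filled that unfolding filled filled' by auto
      thus ?thesis using holomorphic_on_ident by (metis (mono_tags) holomorphic_cong)
    next
      case (restricted V0 \<psi>0)
      have im: "\<phi> ` (U \<inter> V) = G ` w ` ((D - K) \<inter> V0)"
        unfolding filled restricted(2) int by (simp add: image_image)
      have "((\<psi>0 \<circ> inv_into D w) \<circ> H) holomorphic_on \<phi> ` (U \<inter> V)"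
      proof (rule holomorphic_on_compose_gen[OF _ transition_holomorphic[OF riemann chart restricted(1)]])
        show "H holomorphic_on \<phi> ` (U \<inter> V)" unfolding im
          by (rule holomorphic_on_subset[OF holomorphic_unslit_map[OF eps]])
            (use K_iff slit_map_notin[OF eps] in auto)
        show "H ` \<phi> ` (U \<inter> V) \<subseteq> w ` (D \<inter> V0)" unfolding im
          using K_iff unslit_slit[OF eps] by auto
      qed
      moreover have "(\<psi> \<circ> inv_into U \<phi>) z = ((\<psi>0 \<circ> inv_into D w) \<circ> H) z" if z: "z \<in> \<phi> ` (U \<inter> V)" for z
        unfolding filled restricted(3) by (rule filled_to_restricted) (use z im in blast)
      ultimately show ?thesis by (metis (no_types, lifting) holomorphic_cong)
    qed
  next
    case (restricted U0 \<phi>0)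
    from d show ?thesis
    proof (cases rule: atlas_cases)
      case filled
      have im: "\<phi> ` (U \<inter> V) = \<phi>0 ` ((D - K) \<inter> U0)"
        unfolding filled restricted(2,3) Int_commute[of _ F] int by (simp add: image_image)
      have "(G \<circ> (w \<circ> inv_into U0 \<phi>0)) holomorphic_on \<phi> ` (U \<inter> V)"
      proof (rule holomorphic_on_compose_gen[OF _ holomorphic_slit_map[OF eps]])
        show "(w \<circ> inv_into U0 \<phi>0) holomorphic_on \<phi> ` (U \<inter> V)" unfolding im
          by (rule holomorphic_on_subset[OF transition_holomorphic[OF riemann restricted(1) chart]]) auto
        show "(w \<circ> inv_into U0 \<phi>0) ` \<phi> ` (U \<inter> V) \<subseteq> - slits \<epsilon>" unfolding im
          using K_iff chart_inv[OF restricted(1)] by auto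
      qed
      moreover have "(\<psi> \<circ> inv_into U \<phi>) z = (G \<circ> (w \<circ> inv_into U0 \<phi>0)) z" if z: "z \<in> \<phi> ` (U \<inter> V)" for z
        unfolding filled restricted(2,3) by (rule restricted_to_filled[OF restricted(1)]) (use z im in blast)
      ultimately show ?thesis by (metis (no_types, lifting) holomorphic_cong)
    next
      case restricted': (restricted V0 \<psi>0)
      have "U \<inter> V = Inl ` ((V0 - K) \<inter> U0)" unfolding restricted(2) restricted'(2) by auto
      hence im: "\<phi> ` (U \<inter> V) = \<phi>0 ` ((V0 - K) \<inter> U0)" unfolding restricted(3) by (simp add: image_image)
      have "(\<psi>0 \<circ> inv_into U0 \<phi>0) holomorphic_on \<phi> ` (U \<inter> V)" unfolding im
        by (rule holomorphic_on_subset[OF transition_holomorphic[OF riemann restricted(1) restricted'(1)]]) auto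
      moreover have "(\<psi> \<circ> inv_into U \<phi>) z = (\<psi>0 \<circ> inv_into U0 \<phi>0) z" if z: "z \<in> \<phi> ` (U \<inter> V)" for z
        unfolding restricted'(3) restricted(2,3) by (rule restricted_to_restricted[OF restricted(1)]) (use z im in blast)
      ultimately show ?thesis by (metis (no_types, lifting) holomorphic_cong)
    qed
  qed
qed

section \<open>The topology of the reglued surface\<close>

lemma R'_eq: "R' = \<lparr>stop = T', atlas = \<A>\<rparr>"
  by (simp add: deformed_surface_def Let_def)

lemma topspace_R': "topspace (T') = Inl ` (X - K) \<union> Inr ` K'"
proof -
  have "(\<Union>(U, \<phi>)\<in>\<A>. U) = F \<union> (\<Union>(U, \<phi>)\<in>atlas R. Inl ` (U - K))"
    unfolding UN_insert image_image by (auto simp: restricted_chart_def split_beta)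
  also have "\<dots> = F \<union> Inl ` ((\<Union>(U, \<phi>)\<in>atlas R. U) - K)" by auto
  also have "(\<Union>(U, \<phi>)\<in>atlas R. U) = X" using riemann by (simp add: riemann_surface_def)
  finally show ?thesis using chart_props(5)[OF chart] unfolding A.topspace_atlas F_eq by auto
qed

text \<open>Together with \<open>openin_Inl_image\<close> this says that the surface off the slits
  is embedded by \<open>Inl\<close> as an open subspace with its original topology.\<close>

lemma openin_Inl_vimage:
  assumes W: "openin (T') W"
  shows "openin (stop R) (Inl -` W)"
proof -
  have sub: "Inl -` W \<subseteq> X - K" using openin_subset[OF W] unfolding topspace_R' by auto
  have "open (\<psi> ` (Inl -` W \<inter> V))" if c: "(V, \<psi>) \<in> atlas R" for V \<psi>
  proof -
    have "open ((\<psi> \<circ> projl) ` (W \<inter> Inl ` (V - K)))"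
      using W restricted_mem[OF c] unfolding A.openin_atlas by blast
    moreover have "W \<inter> Inl ` (V - K) = Inl ` (Inl -` W \<inter> V)" using sub by auto
    ultimately show ?thesis by (simp add: image_image)
  qed
  thus ?thesis unfolding openin_iff_charts[OF riemann] using sub by auto
qed

lemma openin_Inl_image:
  assumes W: "openin (stop R) W" "W \<inter> K = {}"
  shows "openin (T') (Inl ` W)"
proof -
  have "open (\<phi> ` (Inl ` W \<inter> U))" if "(U, \<phi>) \<in> \<A>" for U \<phi>
    using that
  proof (cases rule: atlas_cases)
    case filled
    have "Inl ` W \<inter> F = Inl ` (W \<inter> (D - K))" by (auto simp: F_eq)
    moreover have "openin (stop R) (W \<inter> (D - K))"
      using W chart_props(1)[OF chart] openin_minus_K by blast
    ultimately show ?thesis unfolding filled using open_f_Inl[of "W \<inter> (D - K)"] by simp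
  next
    case (restricted V \<psi>)
    have "Inl ` W \<inter> Inl ` (V - K) = (Inl ` (W \<inter> V) :: ('a + complex) set)" using W(2) by auto
    hence "\<phi> ` (Inl ` W \<inter> U) = \<psi> ` (W \<inter> V)" unfolding restricted(2,3) by (simp add: image_image)
    thus ?thesis using overlap_restricted[OF W(1) restricted(1)] by simp
  qed
  moreover have "Inl ` W \<subseteq> topspace (T')"
    using openin_subset[OF W(1)] W(2) unfolding topspace_R' by auto
  ultimately show ?thesis unfolding A.openin_atlas A.topspace_atlas[symmetric] by blast
qed

text \<open>The annulus between \<open>r\<close> and \<rho> gives the room needed to separate points
  outside the disc from the filled slit and to cut the new surface into two compact pieces.\<close>

lemma intermediate_radius:
  obtains r where "slits \<epsilon> \<subseteq> ball 0 r" "r < \<rho>"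
proof -
  have "upper_tip \<epsilon> \<in> slits \<epsilon>" by (rule slit_tips[OF eps])
  hence "\<epsilon> * slit_length < \<rho>" using slits_disc eps slit_length_cube(2)
    by (auto simp: upper_tip_def norm_mult)
  then obtain r where "\<epsilon> * slit_length < r" "r < \<rho>" using dense by blast
  thus thesis using that[of r] slits_norm_le[OF eps] by force
qed

text \<open>The region \<open>S\<close> of the w-disc after surgery: its points off the slits
  together with the whole image slit.\<close>

definition filled_part :: "complex set \<Rightarrow> ('a + complex) set" where
  "filled_part S = {p \<in> F. f p \<in> K' \<union> G ` (S - slits \<epsilon>)}"

lemma f_filled_part: "S \<subseteq> ball 0 \<rho> \<Longrightarrow> f ` filled_part S = K' \<union> G ` (S - slits \<epsilon>)"
proof -
  assume "S \<subseteq> ball 0 \<rho>"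
  hence "K' \<union> G ` (S - slits \<epsilon>) \<subseteq> f ` F" unfolding f_F by auto
  moreover have "f ` filled_part S = f ` F \<inter> (K' \<union> G ` (S - slits \<epsilon>))"
    unfolding filled_part_def by blast
  ultimately show ?thesis by blast
qed

lemma Inl_filled_part: "Inl x \<in> filled_part S \<longleftrightarrow> x \<in> D - K \<and> w x \<in> S"
proof
  assume a: "Inl x \<in> filled_part S"
  hence x: "x \<in> D - K" by (auto simp: filled_part_def F_eq)
  hence wx: "w x \<notin> slits \<epsilon>" using K_iff by auto
  have "G (w x) \<in> G ` (S - slits \<epsilon>)"
    using a slit_map_notin[OF eps wx] by (auto simp: filled_part_def)
  then obtain v where "v \<in> S" "v \<notin> slits \<epsilon>" "G (w x) = G v" by auto
  hence "w x = v" using unslit_slit[OF eps] wx by metis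
  thus "x \<in> D - K \<and> w x \<in> S" using x \<open>v \<in> S\<close> by simp
next
  assume a: "x \<in> D - K \<and> w x \<in> S"
  hence "w x \<notin> slits \<epsilon>" using K_iff by auto
  thus "Inl x \<in> filled_part S" using a by (auto simp: filled_part_def F_eq)
qed

lemma Inr_filled_part: "Inr \<zeta> \<in> filled_part S \<longleftrightarrow> \<zeta> \<in> K'"
  by (auto simp: filled_part_def F_eq)

lemma openin_filled_part:
  assumes "open S" "slits \<epsilon> \<subseteq> S" "S \<subseteq> ball 0 \<rho>"
  shows "openin (T') (filled_part S)"
  using A.openin_atlas_chart[OF filled_mem, of "filled_part S"] f_filled_part[OF assms(3)]
    open_filled_image[OF eps assms(2,1)] by (auto simp: filled_part_def)

text \<open>Two points off the slits are separated in the original surface, and two points of the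
  filled chart in the \<zeta>-plane. A filled slit point and a point outside the disc share neither;
  the circle of radius \<open>r\<close> separates them.\<close>

lemma Hausdorff_deformed: "Hausdorff_space (T')"
  unfolding Hausdorff_space_def
proof (intro allI impI, elim conjE)
  let ?T = "T'"
  have sep_F: "\<exists>U V. openin ?T U \<and> openin ?T V \<and> p \<in> U \<and> q \<in> V \<and> disjnt U V"
    if "p \<in> F" "q \<in> F" "p \<noteq> q" for p q
  proof -
    have "f p \<noteq> f q" using that inj_f by (auto dest: inj_onD)
    then obtain U V where UV: "open U" "open V" "f p \<in> U" "f q \<in> V" "U \<inter> V = {}" using hausdorff by metis
    have "openin ?T {p \<in> F. f p \<in> O'}" if "open O'" for O'
    proof -
      have "f ` {p \<in> F. f p \<in> O'} = f ` F \<inter> O'" by auto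
      moreover have "open (f ` F)" using A.overlap[OF filled_mem filled_mem] by simp
      ultimately show ?thesis using A.openin_atlas_chart[OF filled_mem, of "{p \<in> F. f p \<in> O'}"] that by auto
    qed
    thus ?thesis using UV that
      by (intro exI[of _ "{p \<in> F. f p \<in> U}"] exI[of _ "{p \<in> F. f p \<in> V}"]) (auto simp: disjnt_def)
  qed
  obtain r where r: "slits \<epsilon> \<subseteq> ball 0 r" "r < \<rho>" by (rule intermediate_radius)
  have sep_Inl_Inr: "\<exists>U V. openin ?T U \<and> openin ?T V \<and> Inl x \<in> U \<and> Inr \<zeta> \<in> V \<and> disjnt U V"
    if x: "Inl x \<in> topspace ?T" and \<zeta>: "Inr \<zeta> \<in> topspace ?T" for x \<zeta>
  proof (cases "x \<in> D")
    case True
    hence "Inl x \<in> F" "Inr \<zeta> \<in> F" using x \<zeta> unfolding topspace_R' F_eq by auto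
    thus ?thesis using sep_F by blast
  next
    case False
    let ?C = "{y \<in> D. w y \<in> cball 0 r}"
    have "closedin (stop R) ?C" using r(2) by (intro closedin_disc_compact) auto
    hence "openin (stop R) (X - ?C)" by blast
    moreover have "(X - ?C) \<inter> K = {}" using r(1) K_iff by force
    ultimately have "openin ?T (Inl ` (X - ?C))" by (rule openin_Inl_image)
    moreover have "openin ?T (filled_part (ball 0 r))" using r by (intro openin_filled_part) auto
    moreover have "disjnt (Inl ` (X - ?C)) (filled_part (ball 0 r))"
      by (auto simp: disjnt_def Inl_filled_part)
    moreover have "Inl x \<in> Inl ` (X - ?C)" using x False unfolding topspace_R' by auto
    moreover have "Inr \<zeta> \<in> filled_part (ball 0 r)" using \<zeta> unfolding topspace_R' Inr_filled_part by auto
    ultimately show ?thesis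
      by (intro exI[of _ "Inl ` (X - ?C)"] exI[of _ "filled_part (ball 0 r)"] conjI)
  qed
  fix p q assume p: "p \<in> topspace ?T" and q: "q \<in> topspace ?T" and pq: "p \<noteq> q"
  show "\<exists>U V. openin ?T U \<and> openin ?T V \<and> p \<in> U \<and> q \<in> V \<and> disjnt U V"
  proof (cases p)
    case (Inl x)
    show ?thesis
    proof (cases q)
      case Inl': (Inl y)
      have xy: "x \<in> X - K" "y \<in> X - K" "x \<noteq> y"
        using p q pq Inl Inl' unfolding topspace_R' by auto
      then obtain U V where UV: "openin (stop R) U" "openin (stop R) V" "x \<in> U" "y \<in> V" "disjnt U V"
        using Hausdorff unfolding Hausdorff_space_def by blast
      have "openin ?T (Inl ` (U - K))" "openin ?T (Inl ` (V - K))"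
        using UV openin_minus_K by (auto intro!: openin_Inl_image)
      moreover have "p \<in> Inl ` (U - K)" "q \<in> Inl ` (V - K)" using UV xy Inl Inl' by auto
      moreover have "disjnt (Inl ` (U - K) :: ('a + complex) set) (Inl ` (V - K))" using UV by (auto simp: disjnt_def)
      ultimately show ?thesis by (intro exI[of _ "Inl ` (U - K)"] exI[of _ "Inl ` (V - K)"] conjI)
    next
      case (Inr \<zeta>)
      show ?thesis using sep_Inl_Inr[of x \<zeta>] p q unfolding Inl Inr by blast
    qed
  next
    case (Inr \<zeta>)
    show ?thesis
    proof (cases q)
      case (Inl y)
      obtain U V where "openin ?T U" "openin ?T V" "q \<in> U" "p \<in> V" "disjnt U V"
        using sep_Inl_Inr[of y \<zeta>] p q unfolding Inl Inr by blast
      thus ?thesis by (intro exI[of _ V] exI[of _ U]) (simp add: disjnt_sym)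
    next
      case Inr': (Inr \<xi>)
      have "p \<in> F" "q \<in> F" using p q unfolding Inr Inr' topspace_R' F_eq by auto
      thus ?thesis using pq by (rule sep_F)
    qed
  qed
qed

text \<open>If the image slit lies on the side of \<open>E1\<close>, a separation of the new surface
  yields one of the original surface: the old slits are added to the trace of \<open>E1\<close>,
  along with a neighbourhood that makes the union open.\<close>

lemma connected_aux:
  assumes E: "openin (T') E1" "openin (T') E2" "E1 \<inter> E2 = {}"
    "topspace (T') \<subseteq> E1 \<union> E2" and s: "K' \<subseteq> f ` (E1 \<inter> F)"
  shows "E2 = {}"
proof -
  let ?V = "f ` (E1 \<inter> F)"
  have oV: "open ?V" using E(1) filled_mem unfolding A.openin_atlas by blast
  have Inr_E1: "Inr \<zeta> \<in> E1" if "\<zeta> \<in> K'" for \<zeta>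
  proof -
    have "\<zeta> \<in> ?V" using that s by blast
    then obtain p where "p \<in> E1 \<inter> F" "\<zeta> = f p" by (rule imageE) auto
    hence p: "p \<in> E1" "p \<in> F" "f p = f (Inr \<zeta>)" by auto
    moreover have "Inr \<zeta> \<in> F" using that by (auto simp: F_eq)
    ultimately have "p = Inr \<zeta>" using inj_onD[OF inj_f p(3)] by blast
    thus ?thesis using p(1) by simp
  qed
  have E2: "E2 = Inl ` (Inl -` E2)" 
  proof
    show "E2 \<subseteq> Inl ` (Inl -` E2)"
    proof
      fix p assume p: "p \<in> E2"
      hence "p \<in> Inl ` (X - K) \<union> Inr ` K'"
        using openin_subset[OF E(2)] unfolding topspace_R' by blast
      thus "p \<in> Inl ` (Inl -` E2)" using p Inr_E1 E(3) by auto
    qed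
  qed auto
  \<comment> \<open>\<open>H\<close> is proper, so it maps the closed complement of
    \<open>?V\<close> to a closed set, and this set misses the slits. Its complement is the required
    open neighbourhood of the slits, and off the slits its points have their image in
    \<open>?V\<close>.\<close>
  let ?O = "- H ` (- ?V)"
  have "closed (H ` (- ?V))"
    by (rule closed_image_unslit_map[OF eps]) (use oV s in auto)
  hence "openin (stop R) {x \<in> D. w x \<in> ?O}" by (intro openin_disc_open) (rule open_Compl)
  hence o1: "openin (stop R) (Inl -` E1 \<union> {x \<in> D. w x \<in> ?O})"
    using openin_Inl_vimage[OF E(1)] by blast
  have o2: "openin (stop R) (Inl -` E2)" by (rule openin_Inl_vimage[OF E(2)])
  have mem: "Inl x \<in> E1" if x: "x \<in> D - K" "w x \<in> ?O" for x
  proof -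
    have wx: "w x \<notin> slits \<epsilon>" using x K_iff by auto
    have "G (w x) \<in> ?V"
    proof (rule ccontr)
      assume "G (w x) \<notin> ?V"
      hence "H (G (w x)) \<in> H ` (- ?V)" by blast
      thus False using x(2) unslit_slit[OF eps wx] by simp
    qed
    then obtain p where "p \<in> E1 \<inter> F" "G (w x) = f p" by (rule imageE) auto
    hence p: "p \<in> E1" "p \<in> F" "f p = f (Inl x)" by auto
    moreover have "Inl x \<in> F" using x by (auto simp: F_eq)
    ultimately have "p = Inl x" using inj_onD[OF inj_f p(3)] by blast
    thus ?thesis using p(1) by simp
  qed
  have sub2: "Inl -` E2 \<subseteq> X - K" using openin_subset[OF E(2)] unfolding topspace_R' by auto
  have KO: "K \<subseteq> {x \<in> D. w x \<in> ?O}"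
  proof
    fix x assume x: "x \<in> K"
    have "w x \<notin> H ` (- ?V)"
    proof
      assume "w x \<in> H ` (- ?V)"
      then obtain \<zeta> where \<zeta>: "w x = H \<zeta>" "\<zeta> \<in> - ?V" by (rule imageE)
      hence "\<zeta> \<notin> K'" using s by (meson ComplD subsetD)
      from unslit_map_notin[OF eps this] show False using \<zeta>(1) x K_iff by simp
    qed
    thus "x \<in> {x \<in> D. w x \<in> ?O}" using x K_iff by auto
  qed
  have disj: "(Inl -` E1 \<union> {x \<in> D. w x \<in> ?O}) \<inter> Inl -` E2 = {}"
  proof (rule equals0I)
    fix x assume "x \<in> (Inl -` E1 \<union> {x \<in> D. w x \<in> ?O}) \<inter> Inl -` E2"
    hence x: "Inl x \<in> E1 \<or> x \<in> D \<and> w x \<in> ?O" "Inl x \<in> E2" by blast+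
    hence "x \<in> X - K" using sub2 by auto
    hence "Inl x \<in> E1" using x(1) mem by blast
    thus False using x(2) E(3) by blast
  qed
  have cover: "X \<subseteq> (Inl -` E1 \<union> {x \<in> D. w x \<in> ?O}) \<union> Inl -` E2"
  proof
    fix x assume x: "x \<in> X"
    show "x \<in> (Inl -` E1 \<union> {x \<in> D. w x \<in> ?O}) \<union> Inl -` E2"
    proof (cases "x \<in> K")
      case False
      hence "Inl x \<in> E1 \<union> E2" using x E(4) unfolding topspace_R' by blast
      thus ?thesis by auto
    qed (use KO in blast)
  qed
  have "0 \<in> slits \<epsilon>" by (simp add: slits_def)
  then obtain x where "x \<in> K" using slits_disc disc K_iff by (metis imageE subsetD)
  hence ne: "Inl -` E1 \<union> {x \<in> D. w x \<in> ?O} \<noteq> {}" using KO by blast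
  have "Inl -` E2 = {}"
  proof (rule ccontr)
    assume "Inl -` E2 \<noteq> {}"
    with o1 o2 disj cover ne have "\<exists>A B. openin (stop R) A \<and> openin (stop R) B \<and>
        X \<subseteq> A \<union> B \<and> A \<inter> B = {} \<and> A \<noteq> {} \<and> B \<noteq> {}"
      by (intro exI conjI)
    thus False using connected unfolding connected_space_def by simp
  qed
  thus "E2 = {}" using E2 by auto
qed

text \<open>The image slit is connected and hence lies entirely on one side of a separation. By
  \<open>connected_aux\<close> the other side is then empty.\<close>

lemma connected_deformed: "connected_space (T')"
  unfolding connected_space_def
proof (intro notI, elim exE conjE)
  fix E1 E2
  assume E: "openin (T') E1" "openin (T') E2"
    "topspace (T') \<subseteq> E1 \<union> E2" "E1 \<inter> E2 = {}" "E1 \<noteq> {}" "E2 \<noteq> {}"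
  have oV: "open (f ` (E1 \<inter> F))" "open (f ` (E2 \<inter> F))"
    using E(1,2) filled_mem unfolding A.openin_atlas by blast+
  have cover: "K' \<subseteq> f ` (E1 \<inter> F) \<union> f ` (E2 \<inter> F)"
  proof
    fix \<zeta> assume \<zeta>: "\<zeta> \<in> K'"
    hence "Inr \<zeta> \<in> E1 \<union> E2" "Inr \<zeta> \<in> F" using E(3) unfolding topspace_R' F_eq by auto
    thus "\<zeta> \<in> f ` (E1 \<inter> F) \<union> f ` (E2 \<inter> F)" by (metis (no_types) IntI UnE UnI1 UnI2 f_simps(2) imageI)
  qed
  have "f ` (E1 \<inter> F) \<inter> f ` (E2 \<inter> F) = {}"
    using inj_f E(4) by (auto dest: inj_onD)
  hence "f ` (E1 \<inter> F) \<inter> f ` (E2 \<inter> F) \<inter> K' = {}" by blast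
  from connectedD[OF connected_image_slit oV this cover]
  have "K' \<subseteq> f ` (E1 \<inter> F) \<or> K' \<subseteq> f ` (E2 \<inter> F)" using cover by blast
  thus False
    using connected_aux[OF E(1,2,4,3)] connected_aux[OF E(2,1)] E(3-6) by (auto simp: Int_commute Un_commute)
qed

lemma riemann_deformed: "riemann_surface R'"
  unfolding R'_eq by (rule A.riemann_surface_atlas[OF connected_deformed Hausdorff_deformed])

lemma stop_R': "stop R' = T'" and atlas_R': "atlas R' = \<A>"
  by (simp_all add: R'_eq)

lemma continuous_map_Inl:
  "continuous_map (subtopology (stop R) (X - K)) (T') Inl"
  unfolding continuous_map_def
proof (intro conjI allI impI)
  show "Inl \<in> topspace (subtopology (stop R) (X - K)) \<rightarrow> topspace (T')"
    unfolding topspace_R' by auto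
  fix W assume W: "openin (T') W"
  have "{x \<in> topspace (subtopology (stop R) (X - K)). Inl x \<in> W}
      = Inl -` W \<inter> (X - K)" by auto
  thus "openin (subtopology (stop R) (X - K))
      {x \<in> topspace (subtopology (stop R) (X - K)). Inl x \<in> W}"
    using openin_subtopology_Int[OF openin_Inl_vimage[OF W]] by simp
qed

text \<open>The surface is the union of two compact pieces: the complement of the open disc of
  radius \<open>r\<close>, carried over by \<open>Inl\<close>, and the filled closed disc of the
  same radius.\<close>

lemma compact_deformed: "compact_space (T')"
proof -
  obtain r where r: "slits \<epsilon> \<subseteq> ball 0 r" "r < \<rho>" by (rule intermediate_radius)
  let ?B = "{y \<in> D. w y \<in> ball 0 r}"
  have "openin (stop R) ?B" by (intro openin_disc_open) auto
  hence "closedin (stop R) (X - ?B)" by blast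
  hence "compactin (stop R) (X - ?B)" by (rule closedin_compact_space[OF compact])
  moreover have "K \<subseteq> ?B" using r(1) K_iff by auto
  ultimately have "compactin (subtopology (stop R) (X - K)) (X - ?B)"
    by (auto simp: compactin_subtopology)
  hence 1: "compactin (T') (Inl ` (X - ?B))"
    by (rule image_compactin[OF _ continuous_map_Inl])
  have s: "slits \<epsilon> \<subseteq> cball 0 r" and rr: "cball (0 :: complex) r \<subseteq> ball 0 \<rho>" using r by auto
  have 2: "compactin (T') (filled_part (cball 0 r))"
  proof -
    have "(F, f) \<in> atlas R'" by (simp add: atlas_R')
    moreover have "filled_part (cball 0 r) \<subseteq> F" by (auto simp: filled_part_def)
    moreover have "compact (f ` filled_part (cball 0 r))"
      unfolding f_filled_part[OF rr] by (rule compact_filled_image[OF eps s compact_cball])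
    ultimately show ?thesis using chart_compactin_iff[OF riemann_deformed] stop_R' by metis
  qed
  have "topspace (T') \<subseteq> Inl ` (X - ?B) \<union> filled_part (cball 0 r)"
  proof
    fix p assume "p \<in> topspace (T')"
    hence "p \<in> Inl ` (X - K) \<union> Inr ` K'" unfolding topspace_R' .
    thus "p \<in> Inl ` (X - ?B) \<union> filled_part (cball 0 r)"
      by (auto simp: Inl_filled_part Inr_filled_part)
  qed
  hence "topspace (T') = Inl ` (X - ?B) \<union> filled_part (cball 0 r)"
    using compactin_subset_topspace[OF 1] compactin_subset_topspace[OF 2] by blast
  thus ?thesis using compactin_Un[OF 1 2] by (simp add: compact_space_def)
qed

theorem compact_riemann_deformed: "compact_riemann_surface R'"
  using riemann_deformed compact_deformed by (simp add: compact_riemann_surface_def stop_R')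

end

section \<open>The deformed differential\<close>

lemma deriv_cong_open:
  assumes "open S" "z \<in> S" "\<And>y. y \<in> S \<Longrightarrow> f y = g y"
  shows "deriv f z = deriv g z"
  by (rule deriv_cong_ev) (use assms in \<open>auto intro: eventually_nhds_in_open[THEN eventually_mono]\<close>)

lemma abelian_differential_transition:
  assumes "abelian_differential R \<omega>" "(U, \<phi>) \<in> atlas R" "(V, \<psi>) \<in> atlas R" "x \<in> U" "x \<in> V"
  shows "\<omega> (U, \<phi>) x = \<omega> (V, \<psi>) x * deriv (\<psi> \<circ> inv_into U \<phi>) (\<phi> x)"
  using assms unfolding abelian_differential_def by fastforce

lemma abelian_differential_holomorphic:
  assumes "abelian_differential R \<omega>" "(U, \<phi>) \<in> atlas R"
  shows "(\<omega> (U, \<phi>) \<circ> inv_into U \<phi>) holomorphic_on \<phi> ` U"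
  using assms unfolding abelian_differential_def by fastforce

text \<open>\<open>path_pullback\<close> chooses a chart at each parameter, independently on the two
  surfaces, so integrands can be compared only after this. Differentiability at \<open>t\<close> is
  assumed in one chart; the chain rule carries it to the other, because near \<open>t\<close> the
  path stays in both.\<close>

lemma path_pullback_chart_independent:
  assumes R: "riemann_surface R" and \<omega>: "abelian_differential R \<omega>"
    and c: "(U, \<phi>) \<in> atlas R" and d: "(V, \<psi>) \<in> atlas R"
    and \<gamma>: "pathin (stop R) \<gamma>" and t: "t \<in> {0<..<1}" "\<gamma> t \<in> U" "\<gamma> t \<in> V"
    and v: "((\<psi> \<circ> \<gamma>) has_vector_derivative v) (at t)"
  shows "\<omega> (U, \<phi>) (\<gamma> t) * vector_derivative (\<phi> \<circ> \<gamma>) (at t)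
    = \<omega> (V, \<psi>) (\<gamma> t) * vector_derivative (\<psi> \<circ> \<gamma>) (at t)"
proof -
  let ?T = "\<phi> \<circ> inv_into V \<psi>"
  have UV: "openin (stop R) (U \<inter> V)" using riemann_surfaceD(1)[OF R] c d by blast
  have "?T holomorphic_on \<psi> ` (V \<inter> U)" by (rule transition_holomorphic[OF R d c])
  moreover have "open (\<psi> ` (V \<inter> U))" using chart_openin_iff[OF R d, of "V \<inter> U"] UV by (simp add: Int_commute)
  ultimately have T: "(?T has_field_derivative deriv ?T ((\<psi> \<circ> \<gamma>) t)) (at ((\<psi> \<circ> \<gamma>) t))"
    using t by (intro holomorphic_derivI) auto
  have "openin (top_of_set {0..1}) {s \<in> topspace (top_of_set {0..1}). \<gamma> s \<in> U \<inter> V}"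
    using \<gamma> UV unfolding pathin_def by (rule openin_continuous_map_preimage)
  then obtain O' where O': "open O'" "{s \<in> {0..1}. \<gamma> s \<in> U \<inter> V} = {0..1} \<inter> O'"
    unfolding openin_open by auto
  have "((?T \<circ> (\<psi> \<circ> \<gamma>)) has_vector_derivative v * deriv ?T ((\<psi> \<circ> \<gamma>) t)) (at t)"
    by (rule field_vector_diff_chain_at[OF v T])
  hence "((\<phi> \<circ> \<gamma>) has_vector_derivative v * deriv ?T ((\<psi> \<circ> \<gamma>) t)) (at t)"
  proof (rule has_vector_derivative_transform_within_open)
    show "open ({0<..<1} \<inter> O')" using O'(1) by auto
    have "t \<in> {s \<in> {0..1}. \<gamma> s \<in> U \<inter> V}" using t by auto
    thus "t \<in> {0<..<1} \<inter> O'" using t(1) unfolding O'(2) by auto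
    fix s assume "s \<in> {0<..<1} \<inter> O'"
    hence "s \<in> {0..1} \<inter> O'" by auto
    hence "\<gamma> s \<in> V" unfolding O'(2)[symmetric] by auto
    thus "(?T \<circ> (\<psi> \<circ> \<gamma>)) s = (\<phi> \<circ> \<gamma>) s"
      using inv_into_f_f[OF riemann_surfaceD(4)[OF R d]] by simp
  qed
  hence "vector_derivative (\<phi> \<circ> \<gamma>) (at t) = v * deriv ?T ((\<psi> \<circ> \<gamma>) t)" by (rule vector_derivative_at)
  moreover have "vector_derivative (\<psi> \<circ> \<gamma>) (at t) = v" using v by (rule vector_derivative_at)
  moreover have "\<omega> (V, \<psi>) (\<gamma> t) = \<omega> (U, \<phi>) (\<gamma> t) * deriv ?T (\<psi> (\<gamma> t))"
    by (rule abelian_differential_transition[OF \<omega> d c t(3,2)])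
  ultimately show ?thesis by simp
qed

section \<open>Transfer of chains\<close>

lemma lookup_transferred_chain:
  "Poly_Mapping.lookup (transferred_chain k) (Inl \<circ> \<gamma>) = Poly_Mapping.lookup k \<gamma>"
proof -
  have inj: "Inl \<circ> \<gamma> = Inl \<circ> i \<longleftrightarrow> i = \<gamma>" for i :: "real \<Rightarrow> 'a" by (auto simp: fun_eq_iff)
  have "Poly_Mapping.lookup (transferred_chain k) (Inl \<circ> \<gamma>)
      = (\<Sum>i\<in>Poly_Mapping.keys k. Poly_Mapping.lookup k i * (if i = \<gamma> then 1 else 0))"
    by (simp add: transferred_chain_def frag_extend_def lookup_sum inj)
  also have "\<dots> = (\<Sum>i\<in>Poly_Mapping.keys k. if i = \<gamma> then Poly_Mapping.lookup k i else 0)"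
    by (intro sum.cong) auto
  also have "\<dots> = Poly_Mapping.lookup k \<gamma>"
    by (simp add: sum.delta' in_keys_iff)
  finally show ?thesis .
qed

lemma keys_transferred_chain:
  "Poly_Mapping.keys (transferred_chain k) = (\<lambda>\<gamma>. Inl \<circ> \<gamma>) ` Poly_Mapping.keys k"
proof
  show "Poly_Mapping.keys (transferred_chain k) \<subseteq> (\<lambda>\<gamma>. Inl \<circ> \<gamma>) ` Poly_Mapping.keys k"
    unfolding transferred_chain_def
    using keys_frag_extend[of "\<lambda>\<gamma>. frag_of (Inl \<circ> \<gamma>)" k] by auto
  show "(\<lambda>\<gamma>. Inl \<circ> \<gamma>) ` Poly_Mapping.keys k \<subseteq> Poly_Mapping.keys (transferred_chain k)"
    by (auto simp: in_keys_iff lookup_transferred_chain)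
qed

lemma period_transferred_chain:
  "period R' \<omega>' (transferred_chain k)
    = (\<Sum>\<gamma>\<in>Poly_Mapping.keys k. of_int (Poly_Mapping.lookup k \<gamma>) * path_integral R' \<omega>' (Inl \<circ> \<gamma>))"
proof -
  have "inj_on (\<lambda>\<gamma>. Inl \<circ> \<gamma> :: real \<Rightarrow> 'a + complex) (Poly_Mapping.keys k)"
    by (auto simp: inj_on_def fun_eq_iff)
  thus ?thesis unfolding period_def keys_transferred_chain
    by (simp add: sum.reindex lookup_transferred_chain)
qed

text \<open>The boundary commutes with the map that \<open>Inl\<close> induces on 0-chains, so a
  vanishing boundary is preserved.\<close>

lemma boundary_transferred_chain:
  assumes "frag_extend (\<lambda>\<gamma>. frag_of (\<gamma> 1) - frag_of (\<gamma> 0)) k = 0"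
  shows "frag_extend (\<lambda>\<gamma>. frag_of (\<gamma> 1) - frag_of (\<gamma> 0)) (transferred_chain k) = 0"
proof -
  have "frag_extend (\<lambda>\<gamma>. frag_of (\<gamma> 1) - frag_of (\<gamma> 0)) (transferred_chain k)
      = frag_extend (\<lambda>\<gamma>. frag_of (Inl (\<gamma> 1)) - frag_of (Inl (\<gamma> 0))) k"
    unfolding transferred_chain_def
    using frag_extend_compose[of "\<lambda>\<gamma>. frag_of (\<gamma> 1) - frag_of (\<gamma> 0)" "\<lambda>\<gamma>. Inl \<circ> \<gamma>" k] by (simp add: o_def)
  also have "\<dots> = frag_extend (frag_of \<circ> Inl) (frag_extend (\<lambda>\<gamma>. frag_of (\<gamma> 1) - frag_of (\<gamma> 0)) k)"
  proof (induction k rule: frag_induction[OF subset_UNIV])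
    case (3 a b)
    thus ?case by (simp add: frag_extend_diff)
  qed (simp_all add: frag_extend_diff)
  also have "\<dots> = 0" using assms by simp
  finally show ?thesis .
qed

section \<open>Comparison of integral norms\<close>

definition borel_piece :: "'a surface \<Rightarrow> 'a set \<Rightarrow> 'a chart \<Rightarrow> bool" where
  "borel_piece R E c \<longleftrightarrow> c \<in> atlas R \<and> E \<subseteq> fst c \<and> snd c ` E \<in> sets borel"

text \<open>An operation \<open>J\<close> on pieces that preserves disjointness and norms turns
  every family competing in the supremum for \<open>R\<close> into one for \<open>R'\<close> with
  the same sum. Equality of norms follows from two such operations in opposite directions.\<close>

lemma integral_norm_mono:
  assumes J: "\<And>A B. A \<inter> B = {} \<Longrightarrow> J A \<inter> J B = {}"
    and ex: "\<And>E c. borel_piece R E c \<Longrightarrow> \<exists>c'. borel_piece R' (J E) c' \<and> chart_norm \<omega>' c' (J E) = chart_norm \<omega> c E"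
  shows "integral_norm R \<omega> \<le> integral_norm R' \<omega>'"
  unfolding integral_norm_def
proof (rule SUP_mono)
  fix \<F>
  assume "\<F> \<in> {\<F>. finite \<F> \<and> disjoint_family_on fst \<F> \<and>
       (\<forall>(E, U, \<phi>)\<in>\<F>. (U, \<phi>) \<in> atlas R \<and> E \<subseteq> U \<and> \<phi> ` E \<in> sets borel)}"
  hence \<F>: "finite \<F>" "disjoint_family_on fst \<F>"
    "\<And>E U \<phi>. (E, U, \<phi>) \<in> \<F> \<Longrightarrow> (U, \<phi>) \<in> atlas R \<and> E \<subseteq> U \<and> \<phi> ` E \<in> sets borel"
    by blast+
  have piece: "borel_piece R (fst p) (snd p)" if "p \<in> \<F>" for p
    using \<F>(3)[of "fst p" "fst (snd p)" "snd (snd p)"] that by (simp add: borel_piece_def)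
  define h where "h p = (J (fst p), SOME c'. borel_piece R' (J (fst p)) c' \<and> chart_norm \<omega>' c' (J (fst p)) = chart_norm \<omega> (snd p) (fst p))" for p
  have h: "borel_piece R' (fst (h p)) (snd (h p))" "chart_norm \<omega>' (snd (h p)) (fst (h p)) = chart_norm \<omega> (snd p) (fst p)"
    if "p \<in> \<F>" for p
    using someI_ex[OF ex[OF piece[OF that]]] by (auto simp: h_def)
  have disj: "fst (h p) \<inter> fst (h q) = {}" if "p \<in> \<F>" "q \<in> \<F>" "p \<noteq> q" for p q
    using \<F>(2) that J by (auto simp: h_def disjoint_family_on_def)
  have "(\<Sum>(E, c)\<in>h ` \<F>. chart_norm \<omega>' c E) = (\<Sum>p\<in>\<F>. chart_norm \<omega>' (snd (h p)) (fst (h p)))"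
  proof (subst sum.reindex_nontrivial[OF \<F>(1)])
    fix p q assume pq: "p \<in> \<F>" "q \<in> \<F>" "p \<noteq> q" "h p = h q"
    \<comment> \<open>\<open>h\<close> can merge two distinct pieces only when \<open>J\<close>
      empties both, and an empty piece contributes 0 to the sum.\<close>
    hence "fst (h p) = {}" using disj[OF pq(1-3)] by simp
    thus "(case h p of (E, c) \<Rightarrow> chart_norm \<omega>' c E) = 0" by (simp add: case_prod_beta chart_norm_def)
  qed (simp add: case_prod_beta o_def)
  also have "\<dots> = (\<Sum>(E, c)\<in>\<F>. chart_norm \<omega> c E)" using h(2) by (auto intro!: sum.cong simp: case_prod_beta)
  finally have "(\<Sum>(E, c)\<in>\<F>. chart_norm \<omega> c E) \<le> (\<Sum>(E, c)\<in>h ` \<F>. chart_norm \<omega>' c E)" by simp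
  moreover have "h ` \<F> \<in> {\<F>. finite \<F> \<and> disjoint_family_on fst \<F> \<and>
       (\<forall>(E, U, \<phi>)\<in>\<F>. (U, \<phi>) \<in> atlas R' \<and> E \<subseteq> U \<and> \<phi> ` E \<in> sets borel)}"
  proof -
    have "disjoint_family_on fst (h ` \<F>)" unfolding disjoint_family_on_def
    proof (intro ballI impI)
      fix m n assume "m \<in> h ` \<F>" "n \<in> h ` \<F>" and mn: "m \<noteq> n"
      then obtain p q where "p \<in> \<F>" "q \<in> \<F>" "m = h p" "n = h q" by (elim imageE)
      thus "fst m \<inter> fst n = {}" using disj[of p q] mn by blast
    qed
    moreover have "\<forall>(E, U, \<phi>)\<in>h ` \<F>. (U, \<phi>) \<in> atlas R' \<and> E \<subseteq> U \<and> \<phi> ` E \<in> sets borel"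
      unfolding split_beta using h(1) by (simp add: borel_piece_def)
    ultimately show ?thesis using \<F>(1) by simp
  qed
  ultimately show "\<exists>\<G>\<in>{\<F>. finite \<F> \<and> disjoint_family_on fst \<F> \<and>
       (\<forall>(E, U, \<phi>)\<in>\<F>. (U, \<phi>) \<in> atlas R' \<and> E \<subseteq> U \<and> \<phi> ` E \<in> sets borel)}.
      (\<Sum>(E, c)\<in>\<F>. chart_norm \<omega> c E) \<le> (\<Sum>(E, c)\<in>\<G>. chart_norm \<omega>' c E)" by blast
qed

lemma nn_integral_cong_negligible:
  fixes f g :: "complex \<Rightarrow> ennreal"
  assumes "negligible N" "\<And>z. z \<notin> N \<Longrightarrow> f z = g z"
  shows "(\<integral>\<^sup>+z. f z \<partial>lborel) = (\<integral>\<^sup>+z. g z \<partial>lborel)"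
proof -
  obtain N' where "N' \<in> null_sets lborel" "N \<subseteq> N'"
    using assms(1) unfolding negligible_iff_null_sets null_sets_completion_iff2 by blast
  hence "AE z in lborel. f z = g z"
    using AE_not_in[of N' lborel] assms(2) by (auto elim!: eventually_mono)
  thus ?thesis by (rule nn_integral_cong_AE)
qed

lemma negligible_image_slit: "negligible (image_slit \<epsilon>)"
proof (rule negligible_subset)
  show "negligible {z :: complex. \<i> \<bullet> z = 0}" by (rule negligible_hyperplane) simp
qed (auto simp: image_slit_def inner_complex_def)

lemma negligible_slits:
  assumes "\<epsilon> > 0"
  shows "negligible (slits \<epsilon>)"
proof (rule negligible_subset)
  show "negligible ({z. Complex (sqrt 3) (- 1) \<bullet> z = 0} \<union> {z. Complex (sqrt 3) 1 \<bullet> z = 0})"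
    by (intro negligible_Un negligible_hyperplane) (auto simp: complex_eq_iff)
qed (use slits_coordinates(3)[OF assms] in \<open>auto simp: inner_complex_def\<close>)

section \<open>Existence of the deformed differential\<close>

locale slit_surgery_differential = slit_surgery R D w \<rho> \<epsilon>
  for R :: "'a surface" and D w \<rho> \<epsilon> +
  fixes \<omega> :: "'a differential"
  assumes abelian: "abelian_differential R \<omega>" and normal_form: "x \<in> D \<Longrightarrow> \<omega> (D, w) x = - (w x)\<^sup>2"
begin

lemmas \<omega>_transition = abelian_differential_transition[OF abelian]

lemma restricted_chart_eq: "restricted_chart (D, w) \<epsilon> (V, \<psi>) = (Inl ` (V - K), \<psi> \<circ> projl)"
  by (simp add: restricted_chart_def)

text \<open>\<open>glued_differential\<close> tells charts apart by equality, so its two cases must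
  not collide. The filled chart is the only one that contains points of the form
  \<open>Inr\<close>.\<close>

lemma restricted_neq_filled: "restricted_chart (D, w) \<epsilon> d \<noteq> (F, f)"
proof
  assume "restricted_chart (D, w) \<epsilon> d = (F, f)"
  hence "fst (restricted_chart (D, w) \<epsilon> d) = F" by (simp only: fst_conv)
  hence "Inl ` (fst d - K) = F" by (simp add: restricted_chart_def)
  moreover have "Inr 0 \<in> F" using eps by (auto simp: F_eq image_slit_def)
  ultimately show False by blast
qed

lemma open_overlap_restricted: "(U, \<phi>) \<in> atlas R \<Longrightarrow> (V, \<psi>) \<in> atlas R \<Longrightarrow> open (\<phi> ` ((V - K) \<inter> U))"
  using overlap_restricted openin_minus_K chart_props(1) by blast

lemma open_overlap_filled: "(V, \<psi>) \<in> atlas R \<Longrightarrow> open (G ` w ` ((D - K) \<inter> V))"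
  using open_f_Inl[of "(D - K) \<inter> V"] openin_minus_K[OF chart_props(1)[OF chart]] chart_props(1)
  by (force simp: image_image)

lemma deriv_restricted_to_restricted:
  assumes "(U, \<phi>) \<in> atlas R" "(V, \<psi>) \<in> atlas R" "x \<in> U - K" "x \<in> V"
  shows "deriv ((\<psi> \<circ> projl) \<circ> inv_into (Inl ` (U - K) :: ('a + complex) set) (\<phi> \<circ> projl)) (\<phi> x)
    = deriv (\<psi> \<circ> inv_into U \<phi>) (\<phi> x)"
  by (rule deriv_cong_open[OF open_overlap_restricted[OF assms(1,2)] _ restricted_to_restricted[OF assms(1)]])
    (use assms in auto)

lemma w_transition_derivative:
  assumes "(U, \<phi>) \<in> atlas R" "x \<in> D" "x \<in> U"
  shows "((w \<circ> inv_into U \<phi>) has_field_derivative deriv (w \<circ> inv_into U \<phi>) (\<phi> x)) (at (\<phi> x))"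
proof (rule holomorphic_derivI[OF transition_holomorphic[OF riemann assms(1) chart]])
  show "open (\<phi> ` (U \<inter> D))"
    using overlap_restricted[OF chart_props(1)[OF chart] assms(1)] by (simp add: Int_commute)
qed (use assms in auto)

lemma deriv_restricted_to_filled:
  assumes "(U, \<phi>) \<in> atlas R" "x \<in> D - K" "x \<in> U"
  shows "deriv (f \<circ> inv_into (Inl ` (U - K)) (\<phi> \<circ> projl)) (\<phi> x)
    = deriv (G) (w x) * deriv (w \<circ> inv_into U \<phi>) (\<phi> x)"
proof -
  have "deriv (f \<circ> inv_into (Inl ` (U - K)) (\<phi> \<circ> projl)) (\<phi> x)
      = deriv (G \<circ> (w \<circ> inv_into U \<phi>)) (\<phi> x)"
    by (rule deriv_cong_open[OF open_overlap_restricted[OF assms(1) chart] _ restricted_to_filled[OF assms(1)]])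
      (use assms in auto)
  also have "(w \<circ> inv_into U \<phi>) (\<phi> x) = w x" using chart_inv[OF assms(1,3)] by simp
  hence "deriv (G \<circ> (w \<circ> inv_into U \<phi>)) (\<phi> x) = deriv (G) (w x) * deriv (w \<circ> inv_into U \<phi>) (\<phi> x)"
    using DERIV_chain[OF _ w_transition_derivative[OF assms(1)], of "G" _ x]
      holomorphic_derivI[OF holomorphic_slit_map[OF eps] open_compl_slits[OF eps], of "w x"] assms K_iff
    by (intro DERIV_imp_deriv) auto
  finally show ?thesis .
qed

lemma deriv_filled_to_restricted:
  assumes "(V, \<psi>) \<in> atlas R" "x \<in> D - K" "x \<in> V"
  shows "deriv ((\<psi> \<circ> projl) \<circ> inv_into F f) (G (w x))
    = deriv (\<psi> \<circ> inv_into D w) (w x) * deriv (H) (G (w x))"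
proof -
  have wx: "w x \<notin> slits \<epsilon>" using assms K_iff by auto
  let ?\<zeta> = "G (w x)"
  have H: "(H has_field_derivative deriv (H) ?\<zeta>) (at ?\<zeta>)"
    using holomorphic_derivI[OF holomorphic_unslit_map[OF eps] open_compl_image_slit[OF eps], of ?\<zeta>]
      slit_map_notin[OF eps wx] by simp
  have T: "((\<psi> \<circ> inv_into D w) has_field_derivative deriv (\<psi> \<circ> inv_into D w) (w x)) (at (w x))"
    by (rule holomorphic_derivI[OF transition_holomorphic[OF riemann chart assms(1)]])
      (use assms overlap_restricted[OF chart_props(1)[OF assms(1)] chart] in \<open>auto simp: Int_commute\<close>)
  have "deriv ((\<psi> \<circ> projl) \<circ> inv_into F f) ?\<zeta> = deriv ((\<psi> \<circ> inv_into D w) \<circ> H) ?\<zeta>"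
    by (rule deriv_cong_open[OF open_overlap_filled[OF assms(1)] _ filled_to_restricted]) (use assms in auto)
  also have "\<dots> = deriv (\<psi> \<circ> inv_into D w) (w x) * deriv (H) ?\<zeta>"
    by (intro DERIV_imp_deriv DERIV_chain H) (simp add: unslit_slit[OF eps wx] T)
  finally show ?thesis .
qed

text \<open>A differential takes the chart as an argument, so in a restricted chart the original
  chart has to be recovered from its restriction by choice.\<close>

definition glued_differential :: "('a + complex) differential" where
  "glued_differential e p = (if e = (F, f) then g (f p)
     else \<omega> (SOME d. d \<in> atlas R \<and> restricted_chart (D, w) \<epsilon> d = e) (projl p))"

lemma glued_filled: "glued_differential (F, f) p = g (f p)"
  by (simp add: glued_differential_def)

text \<open>Distinct charts of \<open>R\<close> can have the same restriction; the value does not depend on the choice.\<close>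

lemma glued_restricted:
  assumes c: "(V, \<psi>) \<in> atlas R" and x: "x \<in> V - K"
  shows "glued_differential (Inl ` (V - K), \<psi> \<circ> projl) (Inl x) = \<omega> (V, \<psi>) x"
proof -
  let ?e = "restricted_chart (D, w) \<epsilon> (V, \<psi>)"
  define d where "d = (SOME d. d \<in> atlas R \<and> restricted_chart (D, w) \<epsilon> d = ?e)"
  have d: "d \<in> atlas R \<and> restricted_chart (D, w) \<epsilon> d = ?e"
    unfolding d_def by (rule someI[of _ "(V, \<psi>)"]) (use c in simp)
  obtain U \<phi> where Ud: "d = (U, \<phi>)" by (cases d)
  have U: "(U, \<phi>) \<in> atlas R" using d Ud by simp
  have eq: "(Inl ` (U - K) :: ('a + complex) set) = Inl ` (V - K)" "(\<phi> \<circ> projl :: 'a + complex \<Rightarrow> complex) = \<psi> \<circ> projl"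
    using d by (auto simp: Ud restricted_chart_eq)
  \<comment> \<open>The composites agree as total functions, so the coordinates agree everywhere and
    the transition map is the identity; the two domains can still differ on the slits.\<close>
  have "\<phi> y = \<psi> y" for y using fun_cong[OF eq(2), of "Inl y"] by simp
  hence \<phi>: "\<phi> = \<psi>" by blast
  have xU: "x \<in> U" using eq(1) x by blast
  have "deriv (\<phi> \<circ> inv_into V \<psi>) (\<psi> x) = deriv (\<lambda>z. z) (\<psi> x)"
    by (rule deriv_cong_open[OF chart_props(2)[OF c]]) (use x \<phi> chart_inv[OF c] in auto)
  hence "\<omega> (V, \<psi>) x = \<omega> (U, \<phi>) x" using \<omega>_transition[OF c U, of x] x xU by simp
  moreover have "glued_differential ?e (Inl x) = \<omega> d x"
    using restricted_neq_filled[of "(V, \<psi>)"] by (simp add: glued_differential_def d_def)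
  ultimately show ?thesis by (simp add: Ud restricted_chart_eq)
qed

text \<open>The transformation law has content only between the filled chart and a restricted one.
  There it combines the law of the original differential, the normal form - w^2 dw, and the pullback
  identity for the slit map or its inverse.\<close>

lemma abelian_glued: "abelian_differential R' glued_differential"
proof -
  have hol: "(glued_differential (U, \<phi>) \<circ> inv_into U \<phi>) holomorphic_on \<phi> ` U" if "(U, \<phi>) \<in> \<A>" for U \<phi>
    using that
  proof (cases rule: atlas_cases)
    case filled
    have "(glued_differential (F, f) \<circ> inv_into F f) z = g z" if "z \<in> f ` F" for z
      using filled_to_filled[OF that] unfolding o_apply glued_filled by simp
    thus ?thesis unfolding filled using holomorphic_pushed_differential by (metis (no_types, lifting) holomorphic_cong)
  next
    case (restricted V \<psi>)
    have im: "(\<psi> \<circ> projl) ` (Inl ` (V - K) :: ('a + complex) set) = \<psi> ` (V - K)" by (simp add: image_image)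
    have "(glued_differential (U, \<phi>) \<circ> inv_into U \<phi>) z = (\<omega> (V, \<psi>) \<circ> inv_into V \<psi>) z" if z: "z \<in> \<psi> ` (V - K)" for z
    proof -
      obtain x where x: "x \<in> V - K" "z = \<psi> x" using z by auto
      show ?thesis unfolding restricted(2,3) x(2)
        using restricted_inv[OF restricted(1) x(1)] glued_restricted[OF restricted(1) x(1)]
          chart_inv[OF restricted(1), of x] x(1) by simp
    qed
    moreover have "(\<omega> (V, \<psi>) \<circ> inv_into V \<psi>) holomorphic_on \<psi> ` (V - K)"
      by (rule holomorphic_on_subset[OF abelian_differential_holomorphic[OF abelian restricted(1)]]) auto
    ultimately have "(glued_differential (U, \<phi>) \<circ> inv_into U \<phi>) holomorphic_on \<psi> ` (V - K)"
      by (metis (no_types, lifting) holomorphic_cong)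
    thus ?thesis using im unfolding restricted(2,3) by simp
  qed
  have law: "glued_differential (U, \<phi>) p = glued_differential (V, \<psi>) p * deriv (\<psi> \<circ> inv_into U \<phi>) (\<phi> p)"
    if c: "(U, \<phi>) \<in> \<A>" and d: "(V, \<psi>) \<in> \<A>" and p: "p \<in> U" "p \<in> V" for U \<phi> V \<psi> p
    using c
  proof (cases rule: atlas_cases)
    case filled
    from d show ?thesis
    proof (cases rule: atlas_cases)
      case filled': filled
      have "deriv (f \<circ> inv_into F f) (f p) = deriv (\<lambda>z. z) (f p)"
        by (rule deriv_cong_open[OF _ _ filled_to_filled])
          (use p filled A.overlap[OF filled_mem filled_mem] in auto)
      thus ?thesis unfolding filled filled' by simp
    next
      case (restricted V0 \<psi>0)
      obtain x where x: "p = Inl x" "x \<in> D - K" "x \<in> V0" using p unfolding filled restricted(2) F_eq by auto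
      have "\<omega> (V0, \<psi>0) x * deriv (\<psi>0 \<circ> inv_into D w) (w x) = - (w x)\<^sup>2"
        using \<omega>_transition[OF chart restricted(1), of x] normal_form[of x] x by simp
      moreover have "- (w x)\<^sup>2 * deriv (H) (G (w x)) = g (G (w x))"
        using unslit_map_pullback[OF eps, of "G (w x)"] x K_iff unslit_slit[OF eps] slit_map_notin[OF eps] by auto
      moreover have "x \<in> V0 - K" using x by auto
      ultimately show ?thesis
        unfolding filled restricted(2,3) x(1) glued_filled f_simps
        using glued_restricted[OF restricted(1)] deriv_filled_to_restricted[OF restricted(1) x(2,3)]
        by (simp add: mult.assoc[symmetric])
    qed
  next
    case (restricted U0 \<phi>0)
    from d show ?thesis
    proof (cases rule: atlas_cases)
      case filled
      obtain x where x: "p = Inl x" "x \<in> D - K" "x \<in> U0" using p unfolding filled restricted(2) F_eq by auto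
      have "\<omega> (U0, \<phi>0) x = - (w x)\<^sup>2 * deriv (w \<circ> inv_into U0 \<phi>0) (\<phi>0 x)"
        using \<omega>_transition[OF restricted(1) chart, of x] normal_form[of x] x by simp
      moreover have "g (G (w x)) * deriv (G) (w x) = - (w x)\<^sup>2"
        using slit_map_pullback[OF eps, of "w x"] x K_iff by auto
      moreover have "x \<in> U0 - K" using x by auto
      ultimately show ?thesis
        unfolding filled restricted(2,3) x(1) glued_filled f_simps
        using glued_restricted[OF restricted(1)] deriv_restricted_to_filled[OF restricted(1) x(2,3)]
        by (simp add: mult.assoc[symmetric])
    next
      case restricted': (restricted V0 \<psi>0)
      obtain x where x: "p = Inl x" "x \<in> U0 - K" "x \<in> V0 - K" using p unfolding restricted(2) restricted'(2) by auto
      show ?thesis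
        unfolding restricted(2,3) restricted'(2,3) x(1)
        using glued_restricted[OF restricted(1) x(2)] glued_restricted[OF restricted'(1) x(3)]
          deriv_restricted_to_restricted[OF restricted(1) restricted'(1) x(2)]
          \<omega>_transition[OF restricted(1) restricted'(1), of x] x by simp
    qed
  qed
  have pair: "(fst c, snd c) \<in> \<A>" if "c \<in> \<A>" for c using that by (simp only: prod.collapse)
  show ?thesis unfolding abelian_differential_def atlas_R' split_beta
  proof (intro conjI ballI)
    fix c assume "c \<in> \<A>"
    from hol[OF pair[OF this]]
    show "(glued_differential (fst c, snd c) \<circ> inv_into (fst c) (snd c)) holomorphic_on snd c ` fst c" .
  next
    fix c d p assume c: "c \<in> \<A>" and d: "d \<in> \<A>" and p: "p \<in> fst c \<inter> fst d"
    show "glued_differential (fst c, snd c) p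
        = glued_differential (fst d, snd d) p * deriv (snd d \<circ> inv_into (fst c) (snd c)) (snd c p)"
      by (rule law[OF pair[OF c] pair[OF d] IntD1[OF p] IntD2[OF p]])
  qed
qed

lemma deformed_differential_glued: "deformed_differential R (D, w) \<epsilon> \<omega> glued_differential"
  unfolding deformed_differential_def
proof (intro conjI ballI)
  fix d x assume "d \<in> atlas R" "x \<in> fst d - K"
  thus "glued_differential (restricted_chart (D, w) \<epsilon> d) (Inl x) = \<omega> d x"
    using glued_restricted[of "fst d" "snd d" x] by (simp add: restricted_chart_def)
qed (rule abelian_glued)

section \<open>Properties of every deformed differential\<close>

context
  fixes \<omega>' assumes def: "deformed_differential R (D, w) \<epsilon> \<omega> \<omega>'"
begin

lemma deformed_abelian: "abelian_differential R' \<omega>'"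
  using def by (simp add: deformed_differential_def)

lemma deformed_restricted:
  assumes "(V, \<psi>) \<in> atlas R" "x \<in> V - K"
  shows "\<omega>' (Inl ` (V - K), \<psi> \<circ> projl) (Inl x) = \<omega> (V, \<psi>) x"
proof -
  have "\<omega>' (restricted_chart (D, w) \<epsilon> (V, \<psi>)) (Inl x) = \<omega> (V, \<psi>) x"
    using def assms unfolding deformed_differential_def by fastforce
  thus ?thesis by (simp add: restricted_chart_eq)
qed

text \<open>Agreement with the original differential is required in restricted charts only. In the
  filled chart, away from the image slit, the coefficient is then forced by the transformation
  law.\<close>

lemma deformed_filled:
  assumes x: "x \<in> D - K"
  shows "\<omega>' (F, f) (Inl x) = g (G (w x))"
proof -
  have wx: "w x \<notin> slits \<epsilon>" using x K_iff by auto
  have "\<omega>' (F, f) (Inl x) = \<omega>' (Inl ` (D - K), w \<circ> projl) (Inl x) * deriv ((w \<circ> projl) \<circ> inv_into F f) (f (Inl x))"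
  proof (rule abelian_differential_transition[OF deformed_abelian])
    show "(F, f) \<in> atlas R'" unfolding atlas_R' by (rule filled_mem)
    show "(Inl ` (D - K), w \<circ> projl) \<in> atlas R'" unfolding atlas_R' by (rule restricted_mem[OF chart])
    show "Inl x \<in> F" using x by (simp add: F_eq)
    show "Inl x \<in> Inl ` (D - K)" using x by blast
  qed
  also have "\<omega>' (Inl ` (D - K), w \<circ> projl) (Inl x) = - (w x)\<^sup>2"
    using deformed_restricted[OF chart x] normal_form[of x] x by simp
  also have "deriv ((w \<circ> projl) \<circ> inv_into F f) (f (Inl x))
      = deriv (w \<circ> inv_into D w) (w x) * deriv (H) (G (w x))"
    using deriv_filled_to_restricted[OF chart x] x by simp
  also have "deriv (w \<circ> inv_into D w) (w x) = deriv (\<lambda>z. z) (w x)"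
    by (rule deriv_cong_open[OF chart_props(2)[OF chart]]) (use x chart_inv[OF chart] in auto)
  finally have "\<omega>' (F, f) (Inl x) = - (w x)\<^sup>2 * deriv (H) (G (w x))" by simp
  thus ?thesis using unslit_map_pullback[OF eps slit_map_notin[OF eps wx]] unslit_slit[OF eps wx] by simp
qed

lemma piecewise_C1_path_Inl:
  assumes \<gamma>: "piecewise_C1_path R \<gamma>" "\<gamma> ` {0..1} \<subseteq> X - D"
  shows "piecewise_C1_path R' (Inl \<circ> \<gamma>)"
    "(Inl \<circ> \<gamma>) ` {0..1} \<subseteq> topspace (stop R') - F"
proof -
  have K: "K \<subseteq> D" using K_iff by auto
  have sub: "\<gamma> ` {0..1} \<subseteq> X - K" using \<gamma>(2) K by auto
  obtain L where L: "finite L"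
    "\<And>U \<phi>. (U, \<phi>) \<in> atlas R \<Longrightarrow> (\<phi> \<circ> \<gamma>) C1_differentiable_on ({0..1} \<inter> \<gamma> -` U - L)"
    using \<gamma>(1) unfolding piecewise_C1_path_def by fastforce
  have "pathin (stop R) \<gamma>" using \<gamma>(1) by (simp add: piecewise_C1_path_def)
  hence "continuous_map (top_of_set {0..1}) (subtopology (stop R) (X - K)) \<gamma>"
    using sub unfolding pathin_def continuous_map_in_subtopology by auto
  hence "pathin (stop R') (Inl \<circ> \<gamma>)" unfolding pathin_def stop_R'
    by (rule continuous_map_compose[OF _ continuous_map_Inl])
  moreover have "(\<phi> \<circ> (Inl \<circ> \<gamma>)) C1_differentiable_on ({0..1} \<inter> (Inl \<circ> \<gamma>) -` U - L)" if "(U, \<phi>) \<in> \<A>" for U \<phi>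
    using that
  proof (cases rule: atlas_cases)
    case filled
    have e: "{0..1} \<inter> (Inl \<circ> \<gamma>) -` U - L = {}" unfolding filled F_eq using \<gamma>(2) by auto
    show ?thesis unfolding e C1_differentiable_on_def by simp
  next
    case (restricted V \<psi>)
    have "\<phi> \<circ> (Inl \<circ> \<gamma>) = \<psi> \<circ> \<gamma>" unfolding restricted(3) by (simp add: fun_eq_iff)
    moreover have "(\<psi> \<circ> \<gamma>) C1_differentiable_on ({0..1} \<inter> (Inl \<circ> \<gamma>) -` U - L)"
      by (rule C1_differentiable_on_subset[OF L(2)[OF restricted(1)]]) (auto simp: restricted(2))
    ultimately show ?thesis by simp
  qed
  ultimately show "piecewise_C1_path R' (Inl \<circ> \<gamma>)"
    unfolding piecewise_C1_path_def atlas_R' using L(1) by (intro conjI exI[of _ L] ballI case_prodI2) simp_all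
  show "(Inl \<circ> \<gamma>) ` {0..1} \<subseteq> topspace (stop R') - F"
    unfolding stop_R' topspace_R' F_eq using \<gamma>(2) sub by auto
qed

text \<open>The path avoids the disc, so the chart chosen on the new surface is always a restricted
  one. It may restrict a different chart than the one chosen on the original surface, which is where
  chart independence enters.\<close>

lemma path_integral_Inl:
  assumes \<gamma>: "piecewise_C1_path R \<gamma>" "\<gamma> ` {0..1} \<subseteq> X - D"
  shows "path_integral R' \<omega>' (Inl \<circ> \<gamma>) = path_integral R \<omega> \<gamma>"
proof -
  obtain L where L: "finite L"
    "\<And>U \<phi>. (U, \<phi>) \<in> atlas R \<Longrightarrow> (\<phi> \<circ> \<gamma>) C1_differentiable_on ({0..1} \<inter> \<gamma> -` U - L)"
    using \<gamma>(1) unfolding piecewise_C1_path_def by fastforce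
  have path: "pathin (stop R) \<gamma>" using \<gamma>(1) by (simp add: piecewise_C1_path_def)
  \<comment> \<open>The break points are dropped for differentiability and the endpoints because
    chart independence holds at interior parameters; finitely many values do not affect the
    integral.\<close>
  have "path_pullback R' \<omega>' (Inl \<circ> \<gamma>) t = path_pullback R \<omega> \<gamma> t" if t: "t \<in> {0..1} - (L \<union> {0, 1})" for t
  proof -
    have t01: "t \<in> {0<..<1}" using t by auto
    have "\<gamma> t \<in> \<gamma> ` {0..1}" using t by auto
    hence \<gamma>t: "\<gamma> t \<in> X" "\<gamma> t \<notin> D" "\<gamma> t \<notin> K" using \<gamma>(2) K_iff by auto
    define c0 where "c0 = (SOME c. c \<in> atlas R \<and> \<gamma> t \<in> fst c)"
    have "\<exists>c. c \<in> atlas R \<and> \<gamma> t \<in> fst c" using chart_at[OF riemann \<gamma>t(1)] by (metis fst_conv)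
    hence c0: "c0 \<in> atlas R" "\<gamma> t \<in> fst c0" unfolding c0_def using someI_ex by (metis (mono_tags, lifting))+
    obtain V \<psi> where V: "c0 = (V, \<psi>)" by (cases c0)
    define c1 where "c1 = (SOME c. c \<in> atlas R' \<and> (Inl \<circ> \<gamma>) t \<in> fst c)"
    have ex: "(Inl ` (V - K), \<psi> \<circ> projl) \<in> atlas R' \<and> (Inl \<circ> \<gamma>) t \<in> fst (Inl ` (V - K), \<psi> \<circ> projl)"
      using c0 V \<gamma>t restricted_mem[of V \<psi>] by (simp add: atlas_R')
    have "c1 \<in> atlas R' \<and> (Inl \<circ> \<gamma>) t \<in> fst c1"
      using someI[where P = "\<lambda>c. c \<in> atlas R' \<and> (Inl \<circ> \<gamma>) t \<in> fst c", OF ex] unfolding c1_def .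
    hence c1: "c1 \<in> \<A>" "Inl (\<gamma> t) \<in> fst c1" unfolding atlas_R' by simp_all
    obtain U' \<phi>' where U': "c1 = (U', \<phi>')" by (cases c1)
    have "(U', \<phi>') \<in> \<A>" using c1 U' by simp
    thus ?thesis
    proof (cases rule: atlas_cases)
      case filled
      thus ?thesis using c1(2) \<gamma>t unfolding U' by (auto simp: F_eq)
    next
      case (restricted U \<phi>)
      have \<gamma>U: "\<gamma> t \<in> U - K" using c1(2) unfolding U' restricted(2) by auto
      have "path_pullback R' \<omega>' (Inl \<circ> \<gamma>) t = \<omega>' c1 (Inl (\<gamma> t)) * vector_derivative (snd c1 \<circ> (Inl \<circ> \<gamma>)) (at t)"
        by (simp add: path_pullback_def c1_def Let_def)
      also have "\<omega>' c1 (Inl (\<gamma> t)) = \<omega> (U, \<phi>) (\<gamma> t)"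
        unfolding U' restricted(2,3) by (rule deformed_restricted[OF restricted(1) \<gamma>U])
      also have "snd c1 \<circ> (Inl \<circ> \<gamma>) = \<phi> \<circ> \<gamma>" unfolding U' restricted(3) by (simp add: fun_eq_iff)
      also have "\<omega> (U, \<phi>) (\<gamma> t) * vector_derivative (\<phi> \<circ> \<gamma>) (at t)
          = \<omega> (V, \<psi>) (\<gamma> t) * vector_derivative (\<psi> \<circ> \<gamma>) (at t)"
      proof -
        have VV: "(V, \<psi>) \<in> atlas R" "\<gamma> t \<in> V" using c0 V by auto
        have "t \<in> {0..1} \<inter> \<gamma> -` V - L" using t VV by auto
        then obtain v where "((\<psi> \<circ> \<gamma>) has_vector_derivative v) (at t)"
          using L(2)[OF VV(1)] unfolding C1_differentiable_on_def by blast
        thus ?thesis using \<gamma>U VV by (intro path_pullback_chart_independent[OF riemann abelian restricted(1) _ path t01]) auto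
      qed
      also have "\<dots> = path_pullback R \<omega> \<gamma> t"
        unfolding path_pullback_def c0_def[symmetric] Let_def by (simp add: V)
      finally show ?thesis .
    qed
  qed
  thus ?thesis unfolding path_integral_def
    using L(1) by (intro integral_spike[of "L \<union> {0, 1}"] negligible_finite) auto
qed

theorem isoperiodic:
  assumes k: "cycle_in R (X - D) k"
  shows "cycle_in R' (topspace (stop R') - F) (transferred_chain k)"
    "period R' \<omega>' (transferred_chain k) = period R \<omega> k"
proof -
  have \<gamma>: "piecewise_C1_path R \<gamma>" "\<gamma> ` {0..1} \<subseteq> X - D" if "\<gamma> \<in> Poly_Mapping.keys k" for \<gamma>
    using k that by (auto simp: cycle_in_def)
  show "cycle_in R' (topspace (stop R') - F) (transferred_chain k)"
    unfolding cycle_in_def keys_transferred_chain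
  proof (intro conjI ballI)
    show "frag_extend (\<lambda>\<gamma>. frag_of (\<gamma> 1) - frag_of (\<gamma> 0)) (transferred_chain k) = 0"
      using k by (intro boundary_transferred_chain) (simp add: cycle_in_def)
  qed (use piecewise_C1_path_Inl \<gamma> in blast)+
  show "period R' \<omega>' (transferred_chain k) = period R \<omega> k"
    unfolding period_transferred_chain unfolding period_def using path_integral_Inl \<gamma> by (intro sum.cong) auto
qed

text \<open>In the disc chart the slits lie on two lines; any other chart sees a differentiable
  image of that null set.\<close>

lemma negligible_chart_K:
  assumes c: "(U, \<phi>) \<in> atlas R"
  shows "negligible (\<phi> ` (U \<inter> K))"
proof -
  have "\<phi> ` (U \<inter> K) = (\<phi> \<circ> inv_into D w) ` (w ` (D \<inter> U \<inter> K))"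
    using chart_inv[OF chart] K_iff by (force simp: image_image)
  moreover have n: "negligible (w ` (D \<inter> U \<inter> K))"
    by (rule negligible_subset[OF negligible_slits[OF eps]]) (use K_iff in auto)
  have d: "(\<phi> \<circ> inv_into D w) differentiable_on w ` (D \<inter> U \<inter> K)"
    by (rule differentiable_on_subset[OF holomorphic_on_imp_differentiable_on[OF transition_holomorphic[OF riemann chart c]]]) auto
  have "negligible ((\<phi> \<circ> inv_into D w) ` (w ` (D \<inter> U \<inter> K)))"
    by (rule negligible_differentiable_image_negligible[OF order_refl n d])
  ultimately show ?thesis by (simp only:)
qed

lemma chart_norm_restricted:
  assumes c: "(U, \<phi>) \<in> atlas R" and E: "E \<subseteq> U"
  shows "chart_norm \<omega>' (Inl ` (U - K), \<phi> \<circ> projl) (Inl ` (E - K)) = chart_norm \<omega> (U, \<phi>) E"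
proof -
  have im: "(\<phi> \<circ> projl) ` (Inl ` (E - K) :: ('a + complex) set) = \<phi> ` (E - K)" by (simp add: image_image)
  have "ennreal ((norm (\<omega>' (Inl ` (U - K), \<phi> \<circ> projl) (inv_into (Inl ` (U - K)) (\<phi> \<circ> projl) z)))\<^sup>2) * indicator (\<phi> ` (E - K)) z
      = ennreal ((norm (\<omega> (U, \<phi>) (inv_into U \<phi> z)))\<^sup>2) * indicator (\<phi> ` E) z"
    if z: "z \<notin> \<phi> ` (U \<inter> K)" for z
  proof (cases "z \<in> \<phi> ` E")
    case True
    then obtain x where x: "x \<in> E" "z = \<phi> x" by auto
    hence xK: "x \<in> U - K" using z E by auto
    hence "z \<in> \<phi> ` (E - K)" using x by auto
    moreover have "\<omega>' (Inl ` (U - K), \<phi> \<circ> projl) (inv_into (Inl ` (U - K)) (\<phi> \<circ> projl) z) = \<omega> (U, \<phi>) (inv_into U \<phi> z)"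
      unfolding x(2) restricted_inv[OF c xK] deformed_restricted[OF c xK] using chart_inv[OF c, of x] xK by simp
    ultimately show ?thesis using True by simp
  next
    case False
    thus ?thesis by (auto simp: indicator_def)
  qed
  thus ?thesis unfolding chart_norm_def snd_conv fst_conv im
    by (rule nn_integral_cong_negligible[OF negligible_chart_K[OF c]])
qed

text \<open>Up to the null image slit, the piece in the \<zeta>-plane is the \<open>G\<close>-image
  of a piece in the w-disc. Substitution contributes the squared norm of the derivative of
  \<open>G\<close>, and the pullback identity turns the integrand into that of - w^2 dw.\<close>

lemma chart_norm_filled:
  assumes E: "E \<subseteq> F" and b: "f ` E \<in> sets borel"
  shows "w ` (Inl -` E) \<in> sets borel" "chart_norm \<omega> (D, w) (Inl -` E) = chart_norm \<omega>' (F, f) E"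
proof -
  let ?A = "w ` (Inl -` E)"
  have sub: "Inl -` E \<subseteq> D - K" using E by (auto simp: F_eq)
  have A: "?A \<subseteq> - slits \<epsilon>" using sub K_iff by auto
  have GA: "G ` ?A = f ` E - K'"
  proof (intro equalityI subsetI)
    fix \<zeta> assume "\<zeta> \<in> G ` ?A"
    then obtain x where x: "Inl x \<in> E" "\<zeta> = G (w x)" by auto
    hence "w x \<notin> slits \<epsilon>" using sub K_iff by auto
    moreover have "f (Inl x) \<in> f ` E" using x(1) by (rule imageI)
    ultimately show "\<zeta> \<in> f ` E - K'" using x slit_map_notin[OF eps] by simp
  next
    fix \<zeta> assume \<zeta>: "\<zeta> \<in> f ` E - K'"
    then obtain p where p: "p \<in> E" "\<zeta> = f p" by auto
    show "\<zeta> \<in> G ` ?A"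
    proof (cases p)
      case (Inl x)
      thus ?thesis using p by auto
    next
      case (Inr \<xi>)
      thus ?thesis using p \<zeta> E by (auto simp: F_eq)
    qed
  qed
  have "closed (K')" using open_compl_image_slit[OF eps] by (simp add: closed_def)
  hence bG: "G ` ?A \<in> sets borel" unfolding GA using b by auto
  have "?A = H ` G ` ?A"
  proof -
    have "H ` G ` ?A = (\<lambda>v. v) ` ?A"
      unfolding image_image[of "H"] by (rule image_cong[OF refl]) (use A unslit_slit[OF eps] in blast)
    thus ?thesis by simp
  qed
  moreover have "H ` G ` ?A \<in> sets borel"
  proof (rule borel_image_holomorphic[OF open_compl_image_slit[OF eps] holomorphic_unslit_map[OF eps] _ bG])
    show "inj_on (H) (- K')"
      by (rule inj_on_inverseI[where g = "G"]) (use slit_unslit[OF eps] in simp)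
    show "G ` ?A \<subseteq> - K'" unfolding GA by auto
  qed
  ultimately show bA: "?A \<in> sets borel" by simp
  have "chart_norm \<omega>' (F, f) E = (\<integral>\<^sup>+\<zeta>\<in>G ` ?A. ennreal ((norm (g \<zeta>))\<^sup>2) \<partial>lborel)"
    unfolding chart_norm_def fst_conv snd_conv
  proof (rule nn_integral_cong_negligible[OF negligible_image_slit])
    fix \<zeta> assume \<zeta>: "\<zeta> \<notin> K'"
    show "ennreal ((norm (\<omega>' (F, f) (inv_into F f \<zeta>)))\<^sup>2) * indicator (f ` E) \<zeta>
        = ennreal ((norm (g \<zeta>))\<^sup>2) * indicator (G ` ?A) \<zeta>"
    proof (cases "\<zeta> \<in> G ` ?A")
      case True
      then obtain x where x: "x \<in> D - K" "\<zeta> = G (w x)" using sub by auto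
      have "\<zeta> \<in> f ` E" using True unfolding GA by blast
      thus ?thesis using True x filled_inv[OF x(1)] deformed_filled[OF x(1)] by simp
    next
      case False
      thus ?thesis using \<zeta> unfolding GA by (simp add: indicator_def)
    qed
  qed
  also have "\<dots> = (\<integral>\<^sup>+v\<in>?A. ennreal ((norm (deriv (G) v))\<^sup>2 * (norm (g (G v)))\<^sup>2) \<partial>lborel)"
  proof (rule nn_integral_holomorphic_substitution[OF open_compl_slits[OF eps] holomorphic_slit_map[OF eps] _ bA A])
    show "inj_on (G) (- slits \<epsilon>)" using bij_betw_slit_map[OF eps] by (simp add: bij_betw_def)
    have "continuous_on UNIV (g)"
      by (rule holomorphic_on_imp_continuous_on[OF holomorphic_pushed_differential])
    hence [measurable]: "g \<in> borel_measurable borel" by (rule borel_measurable_continuous_onI)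
    show "(\<lambda>z. (norm (g z))\<^sup>2) \<in> borel_measurable borel" by measurable
  qed simp
  also have "\<dots> = chart_norm \<omega> (D, w) (Inl -` E)"
    unfolding chart_norm_def fst_conv snd_conv
  proof (rule nn_integral_cong)
    fix v
    show "ennreal ((norm (deriv (G) v))\<^sup>2 * (norm (g (G v)))\<^sup>2) * indicator ?A v
        = ennreal ((norm (\<omega> (D, w) (inv_into D w v)))\<^sup>2) * indicator ?A v"
    proof (cases "v \<in> ?A")
      case True
      then obtain x where x: "x \<in> D - K" "v = w x" using sub by auto
      have v: "v \<notin> slits \<epsilon>" using A True by auto
      have "(norm (deriv (G) v))\<^sup>2 * (norm (g (G v)))\<^sup>2
          = (norm (g (G v) * deriv (G) v))\<^sup>2"
        by (simp add: norm_mult power_mult_distrib mult.commute)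
      also have "\<dots> = (norm (\<omega> (D, w) (inv_into D w v)))\<^sup>2"
        unfolding slit_map_pullback[OF eps v] using x chart_inv[OF chart, of x] normal_form[of x] by simp
      finally show ?thesis by simp
    qed simp
  qed
  finally show "chart_norm \<omega> (D, w) (Inl -` E) = chart_norm \<omega>' (F, f) E" by simp
qed

text \<open>Pieces are carried forward by cutting out the slits and backward by dropping the points
  of the image slit. A piece in the filled chart goes back to the disc chart, a piece in a
  restricted chart to the chart it came from.\<close>

lemma integral_norm_deformed: "integral_norm R' \<omega>' = integral_norm R \<omega>"
proof (rule antisym)
  show "integral_norm R \<omega> \<le> integral_norm R' \<omega>'"
  proof (rule integral_norm_mono[where J = "\<lambda>E. Inl ` (E - K)"])
    fix E c assume "borel_piece R E c"
    then obtain U \<phi> where c: "c = (U, \<phi>)" "(U, \<phi>) \<in> atlas R" "E \<subseteq> U" "\<phi> ` E \<in> sets borel"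
      by (cases c) (auto simp: borel_piece_def)
    have "\<phi> ` (E - K) = \<phi> ` E \<inter> \<phi> ` (U - K)"
      using c(3) chart_props(4)[OF c(2)] by (auto dest: inj_onD)
    moreover have "open (\<phi> ` (U - K))"
      using open_overlap_restricted[OF c(2,2)] by (simp add: Int_absorb2 Diff_subset)
    ultimately have "\<phi> ` (E - K) \<in> sets borel" using c(4) by auto
    hence "borel_piece R' (Inl ` (E - K)) (Inl ` (U - K), \<phi> \<circ> projl)"
      using c(3) restricted_mem[OF c(2)] by (auto simp: borel_piece_def atlas_R' image_image)
    thus "\<exists>c'. borel_piece R' (Inl ` (E - K)) c' \<and> chart_norm \<omega>' c' (Inl ` (E - K)) = chart_norm \<omega> c E"
      using chart_norm_restricted[OF c(2,3)] c(1) by blast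
  qed auto
  show "integral_norm R' \<omega>' \<le> integral_norm R \<omega>"
  proof (rule integral_norm_mono[where J = "\<lambda>E. Inl -` E"])
    fix E c assume p: "borel_piece R' E c"
    obtain U' \<phi>' where c: "c = (U', \<phi>')" by (cases c)
    have E: "(U', \<phi>') \<in> \<A>" "E \<subseteq> U'" "\<phi>' ` E \<in> sets borel" using p by (auto simp: borel_piece_def c atlas_R')
    from E(1) show "\<exists>c'. borel_piece R (Inl -` E) c' \<and> chart_norm \<omega> c' (Inl -` E) = chart_norm \<omega>' c E"
    proof (cases rule: atlas_cases)
      case filled
      have "E \<subseteq> F" "f ` E \<in> sets borel" using E filled by auto
      note n = chart_norm_filled[OF this]
      have "borel_piece R (Inl -` E) (D, w)" using n(1) chart \<open>E \<subseteq> F\<close> by (auto simp: borel_piece_def F_eq)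
      thus ?thesis using n(2) c filled by blast
    next
      case (restricted U \<phi>)
      have sub: "Inl -` E \<subseteq> U - K" and EE: "E = Inl ` (Inl -` E - K)" using E(2) unfolding restricted(2) by auto
      have "\<phi>' ` E = \<phi> ` (Inl -` E)" using E(2) unfolding restricted(2,3) by (force simp: image_iff)
      hence "borel_piece R (Inl -` E) (U, \<phi>)" using E(3) sub restricted(1) by (auto simp: borel_piece_def)
      moreover have "chart_norm \<omega>' c E = chart_norm \<omega> (U, \<phi>) (Inl -` E)"
        using chart_norm_restricted[OF restricted(1), of "Inl -` E"] sub EE unfolding c restricted(2,3) by auto
      ultimately show ?thesis by metis
    qed
  qed auto
qed

end

end

theorem mainTheorem8:
  shows
    "(\<forall>\<epsilon>>0.
        rescale \<epsilon> Smap holomorphic_on exterior \<epsilon> \<and>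
        bij_betw (rescale \<epsilon> Smap) (exterior \<epsilon>) (- image_slit \<epsilon>) \<and>
        rescale \<epsilon> Pmap holomorphic_on exterior \<epsilon> \<and>
        bij_betw (rescale \<epsilon> Pmap) (exterior \<epsilon>) (- slits \<epsilon>))
     \<and>
     (holomorphic_family_from_id slit_map \<and>
      has_variation_cocycles slit_map (\<lambda>w. - (2 / 3)) (\<lambda>w. 32 / 9 * (1 / w)))
     \<and>
     (\<exists>\<kappa>>0. \<forall>\<epsilon>>0. \<exists>g a b c.
        g holomorphic_on UNIV \<and>
        (\<forall>\<zeta>\<in>- image_slit \<epsilon>. g \<zeta> = pushforward (- slits \<epsilon>) (slit_map \<epsilon>) (\<lambda>w. - w\<^sup>2) \<zeta>) \<and>
        (slit_map \<epsilon> \<longlongrightarrow> a) (at 0 within narrow_sector) \<and> g a \<noteq> 0 \<and>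
        (slit_map \<epsilon> \<longlongrightarrow> b) (at (upper_tip \<epsilon>) within - slits \<epsilon>) \<and>
        (slit_map \<epsilon> \<longlongrightarrow> b) (at (lower_tip \<epsilon>) within - slits \<epsilon>) \<and> simple_zero g b \<and>
        (slit_map \<epsilon> \<longlongrightarrow> c) (at 0 within wide_sector) \<and> simple_zero g c \<and>
        {\<zeta>. g \<zeta> = 0} = {b, c} \<and> dist b c = \<kappa> * \<epsilon>)
     \<and>
     (\<forall>(R :: 'a surface) \<omega> D w \<rho> \<epsilon>.
        compact_riemann_surface R \<longrightarrow> abelian_differential R \<omega> \<longrightarrow>
        (D, w) \<in> atlas R \<longrightarrow> w ` D = ball 0 \<rho> \<longrightarrow>
        (\<forall>x\<in>D. \<omega> (D, w) x = - (w x)\<^sup>2) \<longrightarrow>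
        \<epsilon> > 0 \<longrightarrow> slits \<epsilon> \<subseteq> ball 0 \<rho> \<longrightarrow>
        compact_riemann_surface (deformed_surface R (D, w) \<epsilon>) \<and>
        (\<exists>\<omega>'. deformed_differential R (D, w) \<epsilon> \<omega> \<omega>') \<and>
        (\<forall>\<omega>'. deformed_differential R (D, w) \<epsilon> \<omega> \<omega>' \<longrightarrow>
           (\<forall>k. cycle_in R (topspace (stop R) - D) k \<longrightarrow>
              cycle_in (deformed_surface R (D, w) \<epsilon>)
                (topspace (stop (deformed_surface R (D, w) \<epsilon>)) - fst (filled_chart (D, w) \<epsilon>))
                (transferred_chain k) \<and>
              period (deformed_surface R (D, w) \<epsilon>) \<omega>' (transferred_chain k) = period R \<omega> k) \<and>
           integral_norm (deformed_surface R (D, w) \<epsilon>) \<omega>' = integral_norm R \<omega>))"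
    (is "?A \<and> (?B1 \<and> ?B2) \<and> ?C \<and> ?D")
proof (intro conjI)
  show ?A by (intro allI impI conjI slit_maps_riemann)
  show ?B1 by (rule slit_map_holomorphic_family)
  show ?B2 by (rule slit_map_variation_cocycles)
  \<comment> \<open>The constant is the distance between the critical points 2/3 and -2 of the cubic
    at scale 1.\<close>
  show ?C by (rule exI[of _ "8 / 3"], intro conjI allI impI slit_map_splits_zero) simp
  show ?D
  proof (intro allI impI, goal_cases)
    case (1 R \<omega> D w \<rho> \<epsilon>)
    then interpret slit_surgery_differential R D w \<rho> \<epsilon> \<omega>
      by unfold_locales auto
    show ?case
      using compact_riemann_deformed deformed_differential_glued isoperiodic integral_norm_deformed by blast
  qed
qed

end
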